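(* Let $R$ be a quasi-Frobenius finite-dimensional algebra over a field $K$, and let $\alpha\in\mathrm{Aut}(R)$. Then $R^*\otimes_R\,{}_1R_\alpha\simeq{}_1R_\alpha\otimes_R R^*$ as $R$-bimodules. Thus the element $[R^*]$ of the Picard group $\mathrm{Pic}(R)$ lies in the centralizer of the image of $\mathrm{Out}(R)$ in $\mathrm{Pic}(R)$.
   Context: Algebras are associative unital $K$-algebras, and bimodules are bimodules on which $K$ acts centrally. A finite-dimensional algebra $R$ is quasi-Frobenius if it is injective as a left (equivalently, right) $R$-module; in that case the bimodule $R^*$ is invertible. $R^*=\mathrm{Hom}_K(R,K)$ is an $R$-bimodule by $(r\rightharpoonup r^* )(a)=r^*(ar)$ and $(r^*\leftharpoonup r)(a)=r^*(ra)$. An $R$-bimodule $P$ is invertible if there is an $R$-bimodule $Q$ with $P\otimes_R Q\simeq R\simeq Q\otimes_R P$ as bimodules; $\mathrm{Pic}(R)$ is the group of isomorphism classes $[P]$ of invertible $R$-bimodules, with $[U][V]=[U\otimes_R V]$. $\mathrm{Aut}(R)$ is the group of $K$-algebra automorphisms of $R$, $\mathrm{Inn}(R)$ the normal subgroup of inner automorphisms $r\mapsto u^{-1}ru$, and $\mathrm{Out}(R)=\mathrm{Aut}(R)/\mathrm{Inn}(R)$. ${}_1R_\alpha$ is the bimodule $R$ with usual left action and right action $a\ast r=a\alpha(r)$. The group $\mathrm{Out}(R)$ embeds in $\mathrm{Pic}(R)$ by sending the class of $\alpha$ to $[{}_1R_\alpha]$. *)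

theory Defs
  imports "HOL-Algebra.Algebra"
begin

section \<open>Algebras over a field\<close>

text \<open>
  The library locale \<open>algebra\<close> requires the multiplication to be commutative, so unital associative
  algebras are introduced here. The zero algebra is allowed.
\<close>

locale K_algebra = K: field K + R: ring R + KR: module K R
  for K :: "('k, 'd) ring_scheme" (structure) and R :: "('k, 'r, 'e) module_scheme" (structure) +
  assumes scale_mult_left:
    "\<lbrakk>k \<in> carrier K; x \<in> carrier R; y \<in> carrier R\<rbrakk>
      \<Longrightarrow> (k \<odot>\<^bsub>R\<^esub> x) \<otimes>\<^bsub>R\<^esub> y = k \<odot>\<^bsub>R\<^esub> (x \<otimes>\<^bsub>R\<^esub> y)"
    and scale_mult_right:
    "\<lbrakk>k \<in> carrier K; x \<in> carrier R; y \<in> carrier R\<rbrakk>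
      \<Longrightarrow> x \<otimes>\<^bsub>R\<^esub> (k \<odot>\<^bsub>R\<^esub> y) = k \<odot>\<^bsub>R\<^esub> (x \<otimes>\<^bsub>R\<^esub> y)"

locale fd_algebra = K_algebra +
  assumes finite_dimensional:
    "\<exists>B. finite B \<and> B \<subseteq> carrier R \<and>
      (\<forall>x\<in>carrier R. \<exists>c\<in>B \<rightarrow> carrier K. x = (\<Oplus>\<^bsub>R\<^esub>b\<in>B. c b \<odot>\<^bsub>R\<^esub> b))"


section \<open>Modules and bimodules\<close>

text \<open>
  The library locale \<open>module\<close> requires a commutative ring of scalars. As in the library, modules are
  records extending rings whose fields \<open>mult\<close> and \<open>one\<close> play no role.
\<close>

locale left_module = R: ring R + M: abelian_group M
  for R :: "('r, 'e) ring_scheme" (structure) and M :: "('r, 'm, 'f) module_scheme" (structure) +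
  assumes smult_closed: "\<lbrakk>r \<in> carrier R; x \<in> carrier M\<rbrakk> \<Longrightarrow> r \<odot>\<^bsub>M\<^esub> x \<in> carrier M"
    and smult_l_distr: "\<lbrakk>r \<in> carrier R; s \<in> carrier R; x \<in> carrier M\<rbrakk>
      \<Longrightarrow> (r \<oplus>\<^bsub>R\<^esub> s) \<odot>\<^bsub>M\<^esub> x = r \<odot>\<^bsub>M\<^esub> x \<oplus>\<^bsub>M\<^esub> s \<odot>\<^bsub>M\<^esub> x"
    and smult_r_distr: "\<lbrakk>r \<in> carrier R; x \<in> carrier M; y \<in> carrier M\<rbrakk>
      \<Longrightarrow> r \<odot>\<^bsub>M\<^esub> (x \<oplus>\<^bsub>M\<^esub> y) = r \<odot>\<^bsub>M\<^esub> x \<oplus>\<^bsub>M\<^esub> r \<odot>\<^bsub>M\<^esub> y"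
    and smult_assoc: "\<lbrakk>r \<in> carrier R; s \<in> carrier R; x \<in> carrier M\<rbrakk>
      \<Longrightarrow> (r \<otimes>\<^bsub>R\<^esub> s) \<odot>\<^bsub>M\<^esub> x = r \<odot>\<^bsub>M\<^esub> (s \<odot>\<^bsub>M\<^esub> x)"
    and smult_one: "x \<in> carrier M \<Longrightarrow> \<one>\<^bsub>R\<^esub> \<odot>\<^bsub>M\<^esub> x = x"

definition left_module_hom ::
    "('r, 'e) ring_scheme \<Rightarrow> ('r, 'm, 'f) module_scheme \<Rightarrow> ('r, 'n, 'g) module_scheme \<Rightarrow> ('m \<Rightarrow> 'n) set"
  where "left_module_hom R M N =
    {f \<in> carrier M \<rightarrow> carrier N.
      (\<forall>x\<in>carrier M. \<forall>y\<in>carrier M. f (x \<oplus>\<^bsub>M\<^esub> y) = f x \<oplus>\<^bsub>N\<^esub> f y) \<and>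
      (\<forall>r\<in>carrier R. \<forall>x\<in>carrier M. f (r \<odot>\<^bsub>M\<^esub> x) = r \<odot>\<^bsub>N\<^esub> f x)}"

text \<open>
  HOL cannot quantify over all types inside a formula, so the test modules in the definition of
  injectivity have carriers in an explicitly given type \<open>'u\<close>. By Baer's criterion the notion does not
  depend on \<open>'u\<close> as soon as the carrier of \<open>R\<close> injects into \<open>'u\<close>.
\<close>

definition injective_left_module ::
    "'u itself \<Rightarrow> ('r, 'e) ring_scheme \<Rightarrow> ('r, 'm, 'f) module_scheme \<Rightarrow> bool"
  where "injective_left_module TYPE('u) R E \<longleftrightarrow>
    left_module R E \<and>
    (\<forall>(M :: ('r, 'u) module) (N :: ('r, 'u) module).
      left_module R M \<longrightarrow> left_module R N \<longrightarrow>
      (\<forall>i\<in>left_module_hom R M N. inj_on i (carrier M) \<longrightarrow>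
        (\<forall>g\<in>left_module_hom R M E. \<exists>h\<in>left_module_hom R N E. \<forall>x\<in>carrier M. h (i x) = g x)))"

record ('r, 'm) bimodule = "('r, 'm) module" +
  rsmult :: "['m, 'r] \<Rightarrow> 'm" (infixl \<open>\<triangleleft>\<index>\<close> 70)

locale bimodule = left_module R P 
  for K :: "('k, 'd) ring_scheme" (structure)
    and R :: "('k, 'r, 'e) module_scheme" (structure)
    and P :: "('r, 'p, 'f) bimodule_scheme" (structure) +
  assumes rsmult_closed: "\<lbrakk>x \<in> carrier P; r \<in> carrier R\<rbrakk> \<Longrightarrow> x \<triangleleft>\<^bsub>P\<^esub> r \<in> carrier P"
    and rsmult_l_distr: "\<lbrakk>x \<in> carrier P; y \<in> carrier P; r \<in> carrier R\<rbrakk>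
      \<Longrightarrow> (x \<oplus>\<^bsub>P\<^esub> y) \<triangleleft>\<^bsub>P\<^esub> r = x \<triangleleft>\<^bsub>P\<^esub> r \<oplus>\<^bsub>P\<^esub> y \<triangleleft>\<^bsub>P\<^esub> r"
    and rsmult_r_distr: "\<lbrakk>x \<in> carrier P; r \<in> carrier R; s \<in> carrier R\<rbrakk>
      \<Longrightarrow> x \<triangleleft>\<^bsub>P\<^esub> (r \<oplus>\<^bsub>R\<^esub> s) = x \<triangleleft>\<^bsub>P\<^esub> r \<oplus>\<^bsub>P\<^esub> x \<triangleleft>\<^bsub>P\<^esub> s"
    and rsmult_assoc: "\<lbrakk>x \<in> carrier P; r \<in> carrier R; s \<in> carrier R\<rbrakk>
      \<Longrightarrow> x \<triangleleft>\<^bsub>P\<^esub> (r \<otimes>\<^bsub>R\<^esub> s) = (x \<triangleleft>\<^bsub>P\<^esub> r) \<triangleleft>\<^bsub>P\<^esub> s"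
    and rsmult_one: "x \<in> carrier P \<Longrightarrow> x \<triangleleft>\<^bsub>P\<^esub> \<one>\<^bsub>R\<^esub> = x"
    and smult_rsmult: "\<lbrakk>r \<in> carrier R; x \<in> carrier P; s \<in> carrier R\<rbrakk>
      \<Longrightarrow> (r \<odot>\<^bsub>P\<^esub> x) \<triangleleft>\<^bsub>P\<^esub> s = r \<odot>\<^bsub>P\<^esub> (x \<triangleleft>\<^bsub>P\<^esub> s)"
    and central: "\<lbrakk>k \<in> carrier K; x \<in> carrier P\<rbrakk>
      \<Longrightarrow> (k \<odot>\<^bsub>R\<^esub> \<one>\<^bsub>R\<^esub>) \<odot>\<^bsub>P\<^esub> x = x \<triangleleft>\<^bsub>P\<^esub> (k \<odot>\<^bsub>R\<^esub> \<one>\<^bsub>R\<^esub>)"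

definition bimodule_iso ::
    "('r, 'e) ring_scheme \<Rightarrow> ('r, 'p, 'f) bimodule_scheme \<Rightarrow> ('r, 'q, 'g) bimodule_scheme \<Rightarrow> ('p \<Rightarrow> 'q) set"
  where "bimodule_iso R P Q =
    {f \<in> left_module_hom R P Q. bij_betw f (carrier P) (carrier Q) \<and>
      (\<forall>x\<in>carrier P. \<forall>r\<in>carrier R. f (x \<triangleleft>\<^bsub>P\<^esub> r) = f x \<triangleleft>\<^bsub>Q\<^esub> r)}"

definition bimodule_isomorphic ::
    "('r, 'e) ring_scheme \<Rightarrow> ('r, 'p, 'f) bimodule_scheme \<Rightarrow> ('r, 'q, 'g) bimodule_scheme \<Rightarrow> bool"
    (infix \<open>\<simeq>\<index>\<close> 50)
  where "P \<simeq>\<^bsub>R\<^esub> Q \<longleftrightarrow> bimodule_iso R P Q \<noteq> {}"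

definition regular_bimodule :: "('r, 'e) ring_scheme \<Rightarrow> ('r, 'r) bimodule"
  where "regular_bimodule R =
    \<lparr>carrier = carrier R, monoid.mult = monoid.mult R, monoid.one = \<one>\<^bsub>R\<^esub>, ring.zero = \<zero>\<^bsub>R\<^esub>, ring.add = ring.add R,
     module.smult = monoid.mult R, rsmult = monoid.mult R\<rparr>"

text \<open>The bimodule \<open>\<^sub>1R\<^sub>\<alpha>\<close>:\<close>

definition twisted_bimodule :: "('r, 'e) ring_scheme \<Rightarrow> ('r \<Rightarrow> 'r) \<Rightarrow> ('r, 'r) bimodule"
  where "twisted_bimodule R \<alpha> = (regular_bimodule R)\<lparr>rsmult := \<lambda>a r. a \<otimes>\<^bsub>R\<^esub> \<alpha> r\<rparr>"

text \<open>
  The dual \<open>R\<^sup>* = Hom\<^sub>K(R, K)\<close>. Its elements are extensional functions, so that linear forms which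
  agree on the carrier of \<open>R\<close> are equal.
\<close>

definition dual_bimodule ::
    "('k, 'd) ring_scheme \<Rightarrow> ('k, 'r, 'e) module_scheme \<Rightarrow> ('r, 'r \<Rightarrow> 'k) bimodule"
  where "dual_bimodule K R =
    \<lparr>carrier = {f \<in> carrier R \<rightarrow>\<^sub>E carrier K.
        (\<forall>x\<in>carrier R. \<forall>y\<in>carrier R. f (x \<oplus>\<^bsub>R\<^esub> y) = f x \<oplus>\<^bsub>K\<^esub> f y) \<and>
        (\<forall>k\<in>carrier K. \<forall>x\<in>carrier R. f (k \<odot>\<^bsub>R\<^esub> x) = k \<otimes>\<^bsub>K\<^esub> f x)},
     monoid.mult = undefined, monoid.one = undefined,
     ring.zero = (\<lambda>a\<in>carrier R. \<zero>\<^bsub>K\<^esub>),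
     ring.add = (\<lambda>f g. \<lambda>a\<in>carrier R. f a \<oplus>\<^bsub>K\<^esub> g a),
     module.smult = (\<lambda>r f. \<lambda>a\<in>carrier R. f (a \<otimes>\<^bsub>R\<^esub> r)),
     rsmult = (\<lambda>f r. \<lambda>a\<in>carrier R. f (r \<otimes>\<^bsub>R\<^esub> a))\<rparr>"


section \<open>Tensor products\<close>

text \<open>
  \<open>P \<otimes>\<^sub>R Q\<close> is the free abelian group on \<open>P \<times> Q\<close> modulo the subgroup generated by the usual relations.
  Its elements are cosets; the two actions are induced by \<open>(p, q) \<mapsto> (r p, q)\<close> and
  \<open>(p, q) \<mapsto> (p, q r)\<close>.
\<close>

definition tensor_relators ::
    "('r, 'e) ring_scheme \<Rightarrow> ('r, 'p, 'f) bimodule_scheme \<Rightarrow> ('r, 'q, 'g) bimodule_scheme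
      \<Rightarrow> ('p \<times> 'q \<Rightarrow>\<^sub>0 int) set"
  where "tensor_relators R P Q =
    {frag_of (x \<oplus>\<^bsub>P\<^esub> x', y) - frag_of (x, y) - frag_of (x', y) | x x' y.
      x \<in> carrier P \<and> x' \<in> carrier P \<and> y \<in> carrier Q} \<union>
    {frag_of (x, y \<oplus>\<^bsub>Q\<^esub> y') - frag_of (x, y) - frag_of (x, y') | x y y'.
      x \<in> carrier P \<and> y \<in> carrier Q \<and> y' \<in> carrier Q} \<union>
    {frag_of (x \<triangleleft>\<^bsub>P\<^esub> r, y) - frag_of (x, r \<odot>\<^bsub>Q\<^esub> y) | x r y.
      x \<in> carrier P \<and> r \<in> carrier R \<and> y \<in> carrier Q}"

definition tensor ::
    "('r, 'e) ring_scheme \<Rightarrow> ('r, 'p, 'f) bimodule_scheme \<Rightarrow> ('r, 'q, 'g) bimodule_scheme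
      \<Rightarrow> ('r, ('p \<times> 'q \<Rightarrow>\<^sub>0 int) set) bimodule"
    (infixl \<open>\<boxtimes>\<index>\<close> 70)
  where "P \<boxtimes>\<^bsub>R\<^esub> Q =
    (let F = free_Abelian_group (carrier P \<times> carrier Q);
         N = generate F (tensor_relators R P Q);
         T = F Mod N
     in \<lparr>carrier = carrier T, monoid.mult = undefined, monoid.one = undefined,
         ring.zero = one T, ring.add = monoid.mult T,
         module.smult = (\<lambda>r A. the_elem
           ((\<lambda>c. N #>\<^bsub>F\<^esub> frag_extend (\<lambda>(x, y). frag_of (r \<odot>\<^bsub>P\<^esub> x, y)) c) ` A)),
         rsmult = (\<lambda>A r. the_elem
           ((\<lambda>c. N #>\<^bsub>F\<^esub> frag_extend (\<lambda>(x, y). frag_of (x, y \<triangleleft>\<^bsub>Q\<^esub> r)) c) ` A))\<rparr>)"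


section \<open>Quasi-Frobenius algebras and the Picard group\<close>

text \<open>
  The type \<open>nat \<Rightarrow> 'k\<close> serves as a universe of carriers. Every vector space of at most countable
  dimension over a field \<open>K\<close> with elements in \<open>'k\<close> is isomorphic to one with carrier in this type, so
  for a finite-dimensional algebra \<open>R\<close> the universe contains copies of all finitely generated modules.
  In particular it contains \<open>R\<close>, as needed for injectivity, and all invertible bimodules together with
  their inverses, since these are finitely generated (projective) on either side.
\<close>

definition quasi_frobenius :: "('k, 'd) ring_scheme \<Rightarrow> ('k, 'r, 'e) module_scheme \<Rightarrow> bool"
  where "quasi_frobenius K R \<longleftrightarrow> injective_left_module TYPE(nat \<Rightarrow> 'k) R (regular_bimodule R)"

definition invertible_bimodule ::
    "('k, 'd) ring_scheme \<Rightarrow> ('k, 'r, 'e) module_scheme \<Rightarrow> ('r, 'p, 'f) bimodule_scheme \<Rightarrow> bool"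
  where "invertible_bimodule K R P \<longleftrightarrow>
    bimodule K R P \<and>
    (\<exists>Q :: ('r, nat \<Rightarrow> 'k) bimodule. bimodule K R Q \<and>
      P \<boxtimes>\<^bsub>R\<^esub> Q \<simeq>\<^bsub>R\<^esub> regular_bimodule R \<and> Q \<boxtimes>\<^bsub>R\<^esub> P \<simeq>\<^bsub>R\<^esub> regular_bimodule R)"

text \<open>
  The isomorphism class \<open>[P]\<close> consists of the bimodules in the universe that are isomorphic to \<open>P\<close>;
  the bimodule \<open>P\<close> itself may have its carrier in any type.
\<close>

definition bimodule_class ::
    "('k, 'd) ring_scheme \<Rightarrow> ('k, 'r, 'e) module_scheme \<Rightarrow> ('r, 'p, 'f) bimodule_scheme
      \<Rightarrow> ('r, nat \<Rightarrow> 'k) bimodule set"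
  where "bimodule_class K R P = {U. bimodule K R U \<and> U \<simeq>\<^bsub>R\<^esub> P}"

definition Pic ::
    "('k, 'd) ring_scheme \<Rightarrow> ('k, 'r, 'e) module_scheme \<Rightarrow> ('r, nat \<Rightarrow> 'k) bimodule set monoid"
  where "Pic K R =
    \<lparr>carrier = {bimodule_class K R P | P :: ('r, nat \<Rightarrow> 'k) bimodule. invertible_bimodule K R P},
     monoid.mult = (\<lambda>A B. \<Union>U\<in>A. \<Union>V\<in>B. bimodule_class K R (U \<boxtimes>\<^bsub>R\<^esub> V)),
     monoid.one = bimodule_class K R (regular_bimodule R)\<rparr>"


section \<open>Outer automorphisms\<close>

definition algebra_auto :: "('k, 'd) ring_scheme \<Rightarrow> ('k, 'r, 'e) module_scheme \<Rightarrow> ('r \<Rightarrow> 'r) set"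
  where "algebra_auto K R =
    {\<alpha> \<in> Bij (carrier R). \<alpha> \<in> ring_hom R R \<and>
      (\<forall>k\<in>carrier K. \<forall>x\<in>carrier R. \<alpha> (k \<odot>\<^bsub>R\<^esub> x) = k \<odot>\<^bsub>R\<^esub> \<alpha> x)}"

definition Aut :: "('k, 'd) ring_scheme \<Rightarrow> ('k, 'r, 'e) module_scheme \<Rightarrow> ('r \<Rightarrow> 'r) monoid"
  where "Aut K R = BijGroup (carrier R) \<lparr>carrier := algebra_auto K R\<rparr>"

definition Inn :: "('r, 'e) ring_scheme \<Rightarrow> ('r \<Rightarrow> 'r) set"
  where "Inn R = {\<lambda>r\<in>carrier R. inv\<^bsub>R\<^esub> u \<otimes>\<^bsub>R\<^esub> r \<otimes>\<^bsub>R\<^esub> u | u. u \<in> Units R}"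

definition Out :: "('k, 'd) ring_scheme \<Rightarrow> ('k, 'r, 'e) module_scheme \<Rightarrow> ('r \<Rightarrow> 'r) set monoid"
  where "Out K R = Aut K R Mod Inn R"

definition Out_to_Pic ::
    "('k, 'd) ring_scheme \<Rightarrow> ('k, 'r, 'e) module_scheme \<Rightarrow> ('r \<Rightarrow> 'r) set
      \<Rightarrow> ('r, nat \<Rightarrow> 'k) bimodule set"
  where "Out_to_Pic K R C = the_elem ((\<lambda>\<alpha>. bimodule_class K R (twisted_bimodule R \<alpha>)) ` C)"

definition centralizer :: "('g, 'e) monoid_scheme \<Rightarrow> 'g set \<Rightarrow> 'g set"
  where "centralizer G H = {x \<in> carrier G. \<forall>h\<in>H. x \<otimes>\<^bsub>G\<^esub> h = h \<otimes>\<^bsub>G\<^esub> x}"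

end

theory Submission
  imports Defs
begin

text \<open>
  If \<open>U \<simeq> R\<^sup>*\<close> and \<open>V \<simeq> \<^sub>1R\<^sub>\<alpha>\<close>, then \<open>U \<otimes> V\<close> is \<open>U\<close> with right action twisted by \<open>\<alpha>\<close> and \<open>V \<otimes> U\<close> is \<open>U\<close>
  with left action twisted by \<open>\<alpha>\<^sup>-\<^sup>1\<close>; for \<open>U = R\<^sup>*\<close> the two are identified by \<open>f \<mapsto> f \<circ> \<alpha>\<close>.

  It remains to see that \<open>R\<^sup>*\<close> is invertible, with inverse \<open>Q = Hom\<^sub>R(R\<^sup>*, R)\<close> (left module
  homomorphisms). The pairings are \<open>(f, q) = q(f)\<close> and \<open>[q, f] = q\<^sup>T(f)\<close>, where \<open>q\<^sup>T : R\<^sup>* \<rightarrow> R\<^sup>*\<^sup>* = R\<close>,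
  and by Morita's argument it suffices that the values of each of them span \<open>R\<close>. For \<open>(f, q)\<close> this
  holds because the embedding of the injective module \<open>R\<close> into a power of \<open>R\<^sup>*\<close> splits. The span \<open>I\<close>
  of the values \<open>[q, f]\<close> is a two-sided ideal with right annihilator \<open>r(I) = 0\<close>. Injectivity
  of \<open>R\<close> gives \<open>r(l(J)) = J\<close> for ideals \<open>J\<close> and \<open>r(J \<inter> J') = r(J) + r(J')\<close> for left ideals, and from these
  rules and the descending chain condition one gets \<open>I = R\<close>.
\<close>

section \<open>Homomorphisms of modules and bimodules\<close>

text \<open>Membership in \<open>Pic\<close> is what makes the proof long: commutation of the
  classes is a calculation with twists, but the centralizer also asks that the class of the dual be
  invertible. Injectivity is given on the left only. The pairing (f, q) is directly accessible,
  because its spanning property concerns left module maps into R. For [q, f] the mirror argument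
  would require injectivity on the right, hence the detour through annihilators. Left injectivity
  yields r(l(J)) = J directly, but not l(r(J)) = J, which would give I = l(r(I)) = R at once. Since
  r turns intersections into sums, and sums back into intersections, the chain argument is run with
  r^2 and l^2. A second constraint is the universe \<open>nat \<Rightarrow> 'k\<close>: injectivity
  may only be tested on modules that embed in it, and inverses in \<open>Pic\<close> must lie in it,
  so the modules concerned are encoded by coordinates.\<close>

lemma additive_map_simps:
  assumes "abelian_group M" "abelian_group N" "f \<in> carrier M \<rightarrow> carrier N"
    and add: "\<And>x y. x \<in> carrier M \<Longrightarrow> y \<in> carrier M \<Longrightarrow> f (x \<oplus>\<^bsub>M\<^esub> y) = f x \<oplus>\<^bsub>N\<^esub> f y"
  shows "f \<zero>\<^bsub>M\<^esub> = \<zero>\<^bsub>N\<^esub>"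
    and "x \<in> carrier M \<Longrightarrow> f (\<ominus>\<^bsub>M\<^esub> x) = \<ominus>\<^bsub>N\<^esub> f x"
    and "x \<in> carrier M \<Longrightarrow> y \<in> carrier M \<Longrightarrow> f (x \<ominus>\<^bsub>M\<^esub> y) = f x \<ominus>\<^bsub>N\<^esub> f y"
proof -
  interpret M: abelian_group M by fact
  interpret N: abelian_group N by fact
  interpret abelian_group_hom M N f
    using assms by (intro abelian_group_homI group_hom.intro group_hom_axioms.intro)
      (auto simp: hom_def M.a_group N.a_group)
  show "f \<zero>\<^bsub>M\<^esub> = \<zero>\<^bsub>N\<^esub>" by (rule hom_zero)
  show inv: "f (\<ominus>\<^bsub>M\<^esub> x) = \<ominus>\<^bsub>N\<^esub> f x" if "x \<in> carrier M" for x
    using that by (rule hom_a_inv)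
  show "f (x \<ominus>\<^bsub>M\<^esub> y) = f x \<ominus>\<^bsub>N\<^esub> f y" if "x \<in> carrier M" "y \<in> carrier M"
    using that by (simp add: a_minus_def inv add)
qed

lemma left_module_homD:
  assumes "f \<in> left_module_hom R M N"
  shows "x \<in> carrier M \<Longrightarrow> f x \<in> carrier N"
    and "x \<in> carrier M \<Longrightarrow> y \<in> carrier M \<Longrightarrow> f (x \<oplus>\<^bsub>M\<^esub> y) = f x \<oplus>\<^bsub>N\<^esub> f y"
    and "r \<in> carrier R \<Longrightarrow> x \<in> carrier M \<Longrightarrow> f (r \<odot>\<^bsub>M\<^esub> x) = r \<odot>\<^bsub>N\<^esub> f x"
  using assms by (auto simp: left_module_hom_def)

lemma bimodule_isoD:
  assumes "f \<in> bimodule_iso R P Q"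
  shows "x \<in> carrier P \<Longrightarrow> f x \<in> carrier Q"
    and "x \<in> carrier P \<Longrightarrow> y \<in> carrier P \<Longrightarrow> f (x \<oplus>\<^bsub>P\<^esub> y) = f x \<oplus>\<^bsub>Q\<^esub> f y"
    and "r \<in> carrier R \<Longrightarrow> x \<in> carrier P \<Longrightarrow> f (r \<odot>\<^bsub>P\<^esub> x) = r \<odot>\<^bsub>Q\<^esub> f x"
    and "r \<in> carrier R \<Longrightarrow> x \<in> carrier P \<Longrightarrow> f (x \<triangleleft>\<^bsub>P\<^esub> r) = f x \<triangleleft>\<^bsub>Q\<^esub> r"
    and "bij_betw f (carrier P) (carrier Q)"
  using assms by (auto simp: bimodule_iso_def left_module_hom_def)

lemma bimodule_isoI:
  assumes "bij_betw f (carrier P) (carrier Q)"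
    and "\<And>x y. x \<in> carrier P \<Longrightarrow> y \<in> carrier P \<Longrightarrow> f (x \<oplus>\<^bsub>P\<^esub> y) = f x \<oplus>\<^bsub>Q\<^esub> f y"
    and "\<And>r x. r \<in> carrier R \<Longrightarrow> x \<in> carrier P \<Longrightarrow> f (r \<odot>\<^bsub>P\<^esub> x) = r \<odot>\<^bsub>Q\<^esub> f x"
    and "\<And>r x. r \<in> carrier R \<Longrightarrow> x \<in> carrier P \<Longrightarrow> f (x \<triangleleft>\<^bsub>P\<^esub> r) = f x \<triangleleft>\<^bsub>Q\<^esub> r"
  shows "f \<in> bimodule_iso R P Q"
  using assms bij_betw_imp_funcset[OF assms(1)] by (simp add: bimodule_iso_def left_module_hom_def)

lemma bimodule_iso_comp:
  assumes "f \<in> bimodule_iso R P Q" "g \<in> bimodule_iso R Q S"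
  shows "g \<circ> f \<in> bimodule_iso R P S"
  using bimodule_isoD[OF assms(1)] bimodule_isoD[OF assms(2)]
  by (intro bimodule_isoI) (auto intro: bij_betw_trans)

text \<open>An identity is transported back along \<open>f\<close> by recognising an element of
  \<open>carrier P\<close> as the preimage of its image; closure of the operations of
  \<open>P\<close> puts the candidate in the carrier. This is why symmetry of \<simeq> carries a
  bimodule hypothesis.\<close>

lemma bimodule_iso_inv:
  assumes "bimodule K R P" and f: "f \<in> bimodule_iso R P Q"
  shows "inv_into (carrier P) f \<in> bimodule_iso R Q P"
proof -
  interpret P: bimodule K R P by fact
  note fD = bimodule_isoD[OF f]
  let ?g = "inv_into (carrier P) f"
  have bij: "bij_betw ?g (carrier Q) (carrier P)" using fD(5) by (rule bij_betw_inv_into)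
  have inv: "?g y = x" if "x \<in> carrier P" "y = f x" for x y
    using that bij_betw_inv_into_left[OF fD(5)] by auto
  have g: "?g y \<in> carrier P" "f (?g y) = y" if "y \<in> carrier Q" for y
    using that bij_betw_apply[OF bij] bij_betw_inv_into_right[OF fD(5)] by auto
  show ?thesis
  proof (rule bimodule_isoI[OF bij])
    fix x y assume "x \<in> carrier Q" "y \<in> carrier Q"
    then show "?g (x \<oplus>\<^bsub>Q\<^esub> y) = ?g x \<oplus>\<^bsub>P\<^esub> ?g y" by (intro inv) (auto simp: g fD)
  next
    fix r x assume "r \<in> carrier R" "x \<in> carrier Q"
    then show "?g (r \<odot>\<^bsub>Q\<^esub> x) = r \<odot>\<^bsub>P\<^esub> ?g x" "?g (x \<triangleleft>\<^bsub>Q\<^esub> r) = ?g x \<triangleleft>\<^bsub>P\<^esub> r"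
      by (intro inv; auto simp: g fD P.smult_closed P.rsmult_closed)+
  qed
qed

lemma bimodule_isomorphic_trans [trans]: "P \<simeq>\<^bsub>R\<^esub> Q \<Longrightarrow> Q \<simeq>\<^bsub>R\<^esub> S \<Longrightarrow> P \<simeq>\<^bsub>R\<^esub> S"
  unfolding bimodule_isomorphic_def using bimodule_iso_comp by blast

lemma bimodule_isomorphic_sym: "bimodule K R P \<Longrightarrow> P \<simeq>\<^bsub>R\<^esub> Q \<Longrightarrow> Q \<simeq>\<^bsub>R\<^esub> P"
  unfolding bimodule_isomorphic_def using bimodule_iso_inv by blast

section \<open>Tensor products\<close>

declare carrier_free_Abelian_group_iff [simp del]

locale tensor_product = KR: K_algebra K R + P: bimodule K R P + Q: bimodule K R Q
  for K :: "('k, 'd) ring_scheme" (structure)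
    and R :: "('k, 'r, 'e) module_scheme" (structure)
    and P :: "('r, 'p, 'f) bimodule_scheme" (structure)
    and Q :: "('r, 'q, 'g) bimodule_scheme" (structure)
begin

abbreviation "F \<equiv> free_Abelian_group (carrier P \<times> carrier Q)"
abbreviation "N \<equiv> generate F (tensor_relators R P Q)"
abbreviation "T \<equiv> P \<boxtimes>\<^bsub>R\<^esub> Q"

definition tensor_coset :: "('p \<times> 'q \<Rightarrow>\<^sub>0 int) \<Rightarrow> ('p \<times> 'q \<Rightarrow>\<^sub>0 int) set"
  where "tensor_coset c = N #>\<^bsub>F\<^esub> c"

definition pure_tensor :: "'p \<Rightarrow> 'q \<Rightarrow> ('p \<times> 'q \<Rightarrow>\<^sub>0 int) set"
  where "pure_tensor x y = tensor_coset (frag_of (x, y))"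

interpretation F: comm_group F by (rule abelian_free_Abelian_group)

lemma carrier_F_add: "c \<in> carrier F \<Longrightarrow> d \<in> carrier F \<Longrightarrow> c + d \<in> carrier F"
  using F.m_closed[of c d] by simp

lemma carrier_F_diff: "c \<in> carrier F \<Longrightarrow> d \<in> carrier F \<Longrightarrow> c - d \<in> carrier F"
  by (simp only: carrier_free_Abelian_group_iff) (meson Un_least keys_diff order_trans)

lemma inv_F: "c \<in> carrier F \<Longrightarrow> inv\<^bsub>F\<^esub> c = - c"
  by (simp add: carrier_free_Abelian_group_iff)

lemma frag_of_carrier_F: "x \<in> carrier P \<Longrightarrow> y \<in> carrier Q \<Longrightarrow> frag_of (x, y) \<in> carrier F"
  by simp

lemma tensor_relatorsI:
  "x \<in> carrier P \<Longrightarrow> x' \<in> carrier P \<Longrightarrow> y \<in> carrier Q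
    \<Longrightarrow> frag_of (x \<oplus>\<^bsub>P\<^esub> x', y) - frag_of (x, y) - frag_of (x', y) \<in> tensor_relators R P Q"
  "x \<in> carrier P \<Longrightarrow> y \<in> carrier Q \<Longrightarrow> y' \<in> carrier Q
    \<Longrightarrow> frag_of (x, y \<oplus>\<^bsub>Q\<^esub> y') - frag_of (x, y) - frag_of (x, y') \<in> tensor_relators R P Q"
  "x \<in> carrier P \<Longrightarrow> r \<in> carrier R \<Longrightarrow> y \<in> carrier Q
    \<Longrightarrow> frag_of (x \<triangleleft>\<^bsub>P\<^esub> r, y) - frag_of (x, r \<odot>\<^bsub>Q\<^esub> y) \<in> tensor_relators R P Q"
  unfolding tensor_relators_def by blast+

lemma tensor_relatorsE:
  assumes "c \<in> tensor_relators R P Q"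
  obtains (add_left) x x' y where "x \<in> carrier P" "x' \<in> carrier P" "y \<in> carrier Q"
      "c = frag_of (x \<oplus>\<^bsub>P\<^esub> x', y) - frag_of (x, y) - frag_of (x', y)"
    | (add_right) x y y' where "x \<in> carrier P" "y \<in> carrier Q" "y' \<in> carrier Q"
      "c = frag_of (x, y \<oplus>\<^bsub>Q\<^esub> y') - frag_of (x, y) - frag_of (x, y')"
    | (balanced) x r y where "x \<in> carrier P" "r \<in> carrier R" "y \<in> carrier Q"
      "c = frag_of (x \<triangleleft>\<^bsub>P\<^esub> r, y) - frag_of (x, r \<odot>\<^bsub>Q\<^esub> y)"
  using assms(1) unfolding tensor_relators_def
  apply (elim UnE CollectE exE conjE)
  apply (rule add_left; assumption)
  apply (rule add_right; assumption)
  apply (rule balanced; assumption)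
  done

lemma tensor_relators_carrier: "tensor_relators R P Q \<subseteq> carrier F"
  unfolding tensor_relators_def
  by (auto
      intro!: carrier_F_diff frag_of_carrier_F P.M.a_closed Q.M.a_closed P.rsmult_closed Q.smult_closed)

lemma subgroup_N: "subgroup N F"
  by (rule F.generate_is_subgroup[OF tensor_relators_carrier])

interpretation N: normal N F
  by (rule F.subgroup_imp_normal[OF subgroup_N])

lemma N_carrier: "c \<in> N \<Longrightarrow> c \<in> carrier F"
  using subgroup.subset[OF subgroup_N] by blast

lemma tensor_coset_eq_iff:
  assumes "c \<in> carrier F" "d \<in> carrier F"
  shows "tensor_coset c = tensor_coset d \<longleftrightarrow> c - d \<in> N"
proof
  assume "tensor_coset c = tensor_coset d"
  then have "c \<in> N #>\<^bsub>F\<^esub> d" using F.rcos_self[OF assms(1) subgroup_N] by (simp add: tensor_coset_def)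
  then show "c - d \<in> N" by (auto simp: r_coset_def)
next
  assume "c - d \<in> N"
  then have "c \<in> N #>\<^bsub>F\<^esub> d" by (auto simp: r_coset_def intro!: bexI[of _ "c - d"])
  then show "tensor_coset c = tensor_coset d"
    unfolding tensor_coset_def using F.repr_independence[OF _ assms(2) subgroup_N] by simp
qed

section \<open>The quotient as an abelian group\<close>

lemma carrier_tensor: "carrier T = tensor_coset ` carrier F"
  by (auto simp: tensor_def Let_def carrier_FactGroup tensor_coset_def)

lemma zero_tensor: "\<zero>\<^bsub>T\<^esub> = tensor_coset 0"
  using F.coset_mult_one[OF subgroup.subset[OF subgroup_N]]
  by (simp add: tensor_def Let_def tensor_coset_def)

lemma add_tensor:
  "c \<in> carrier F \<Longrightarrow> d \<in> carrier F \<Longrightarrow> tensor_coset c \<oplus>\<^bsub>T\<^esub> tensor_coset d = tensor_coset (c + d)"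
  using N.rcos_sum[of c d] by (simp add: tensor_def Let_def tensor_coset_def)

lemma abelian_group_tensor: "abelian_group T"
proof (rule abelian_groupI)
  show "\<exists>y\<in>carrier T. y \<oplus>\<^bsub>T\<^esub> x = \<zero>\<^bsub>T\<^esub>" if x: "x \<in> carrier T" for x
  proof -
    from x obtain c where "c \<in> carrier F" "x = tensor_coset c" by (auto simp: carrier_tensor)
    moreover have "- c \<in> carrier F" using \<open>c \<in> carrier F\<close> by (simp add: carrier_free_Abelian_group_iff)
    ultimately show ?thesis
      by (intro bexI[of _ "tensor_coset (- c)"]) (simp_all only: add_tensor carrier_tensor zero_tensor imageI left_minus)
  qed
qed (use F.one_closed in \<open>auto simp: carrier_tensor zero_tensor add_tensor carrier_F_add add.commute add.left_commute add.assoc\<close>)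

interpretation T: abelian_group T by (rule abelian_group_tensor)

lemma minus_tensor:
  assumes "c \<in> carrier F" "d \<in> carrier F"
  shows "tensor_coset c \<ominus>\<^bsub>T\<^esub> tensor_coset d = tensor_coset (c - d)"
proof -
  have "tensor_coset (c - d) \<oplus>\<^bsub>T\<^esub> tensor_coset d = tensor_coset c"
    using assms by (subst add_tensor) (auto intro: carrier_F_diff)
  moreover have "tensor_coset (c - d) \<in> carrier T" "tensor_coset d \<in> carrier T"
    using assms by (auto simp: carrier_tensor intro: carrier_F_diff)
  ultimately show ?thesis
    by (metis T.add.inv_closed T.add.inv_solve_right T.add.m_closed a_minus_def)
qed

lemma pure_tensor_closed: "x \<in> carrier P \<Longrightarrow> y \<in> carrier Q \<Longrightarrow> pure_tensor x y \<in> carrier T"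
  by (auto simp: pure_tensor_def carrier_tensor)

text \<open>Mirrors the induction principle of free abelian groups: zero, generators and differences
  suffice, since sums and negatives are differences.\<close>

lemma tensor_induct [consumes 1, case_names zero pure diff]:
  assumes "A \<in> carrier T"
    and "\<Phi> \<zero>\<^bsub>T\<^esub>"
    and "\<And>x y. x \<in> carrier P \<Longrightarrow> y \<in> carrier Q \<Longrightarrow> \<Phi> (pure_tensor x y)"
    and "\<And>A B. A \<in> carrier T \<Longrightarrow> B \<in> carrier T \<Longrightarrow> \<Phi> A \<Longrightarrow> \<Phi> B \<Longrightarrow> \<Phi> (A \<ominus>\<^bsub>T\<^esub> B)"
  shows "\<Phi> A"
proof -
  obtain c where c: "c \<in> carrier F" "A = tensor_coset c" using assms(1) by (auto simp: carrier_tensor)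
  then have "Poly_Mapping.keys c \<subseteq> carrier P \<times> carrier Q" by (simp add: carrier_free_Abelian_group_iff)
  then have "\<Phi> (tensor_coset c)"
  proof (induction c rule: free_Abelian_group_induct[consumes 1])
    case 1
    then show ?case using assms(2) by (simp add: zero_tensor)
  next
    case (2 x y)
    then have "x \<in> carrier F" "y \<in> carrier F" by (simp_all add: carrier_free_Abelian_group_iff)
    then show ?case using assms(4)[of "tensor_coset x" "tensor_coset y"] 2 by (simp add: minus_tensor carrier_tensor)
  next
    case (3 a)
    then show ?case using assms(3) by (auto simp: pure_tensor_def)
  qed
  then show ?thesis using c by simp
qed

lemma tensor_coset_eqI: "c - d \<in> N \<Longrightarrow> c \<in> carrier F \<Longrightarrow> d \<in> carrier F \<Longrightarrow> tensor_coset c = tensor_coset d"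
  by (simp add: tensor_coset_eq_iff)

lemma pure_tensor_add_left:
  assumes "x \<in> carrier P" "x' \<in> carrier P" "y \<in> carrier Q"
  shows "pure_tensor (x \<oplus>\<^bsub>P\<^esub> x') y = pure_tensor x y \<oplus>\<^bsub>T\<^esub> pure_tensor x' y"
proof -
  have "frag_of (x \<oplus>\<^bsub>P\<^esub> x', y) - frag_of (x, y) - frag_of (x', y) \<in> tensor_relators R P Q"
    using assms by (intro tensor_relatorsI)
  then have "frag_of (x \<oplus>\<^bsub>P\<^esub> x', y) - (frag_of (x, y) + frag_of (x', y)) \<in> N"
    by (simp add: generate.incl diff_diff_eq)
  then show ?thesis
    using assms by (simp add: pure_tensor_def add_tensor tensor_coset_eqI carrier_F_add frag_of_carrier_F)
qed

lemma pure_tensor_add_right: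
  assumes "x \<in> carrier P" "y \<in> carrier Q" "y' \<in> carrier Q"
  shows "pure_tensor x (y \<oplus>\<^bsub>Q\<^esub> y') = pure_tensor x y \<oplus>\<^bsub>T\<^esub> pure_tensor x y'"
proof -
  have "frag_of (x, y \<oplus>\<^bsub>Q\<^esub> y') - frag_of (x, y) - frag_of (x, y') \<in> tensor_relators R P Q"
    using assms by (intro tensor_relatorsI)
  then have "frag_of (x, y \<oplus>\<^bsub>Q\<^esub> y') - (frag_of (x, y) + frag_of (x, y')) \<in> N"
    by (simp add: generate.incl diff_diff_eq)
  then show ?thesis
    using assms by (simp add: pure_tensor_def add_tensor tensor_coset_eqI carrier_F_add frag_of_carrier_F)
qed

lemma pure_tensor_balanced:
  assumes "x \<in> carrier P" "y \<in> carrier Q" "r \<in> carrier R"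
  shows "pure_tensor (x \<triangleleft>\<^bsub>P\<^esub> r) y = pure_tensor x (r \<odot>\<^bsub>Q\<^esub> y)"
proof -
  have "frag_of (x \<triangleleft>\<^bsub>P\<^esub> r, y) - frag_of (x, r \<odot>\<^bsub>Q\<^esub> y) \<in> tensor_relators R P Q"
    using assms by (intro tensor_relatorsI)
  then have "frag_of (x \<triangleleft>\<^bsub>P\<^esub> r, y) - frag_of (x, r \<odot>\<^bsub>Q\<^esub> y) \<in> N"
    by (simp add: generate.incl)
  then show ?thesis
    using assms by (simp add: pure_tensor_def tensor_coset_eqI frag_of_carrier_F P.rsmult_closed Q.smult_closed)
qed

section \<open>Universal property of the tensor product\<close>

lemma hom_F_zero_minus:
  assumes "abelian_group V" "h \<in> hom F (add_monoid V)"
  shows "h 0 = \<zero>\<^bsub>V\<^esub>" "c \<in> carrier F \<Longrightarrow> d \<in> carrier F \<Longrightarrow> h (c - d) = h c \<ominus>\<^bsub>V\<^esub> h d"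
proof -
  interpret V: abelian_group V by fact
  interpret h: group_hom F "add_monoid V" h
    using assms(2) by (simp add: group_hom_def group_hom_axioms_def V.a_group)
  show "h 0 = \<zero>\<^bsub>V\<^esub>" using h.hom_one by simp
  assume cd: "c \<in> carrier F" "d \<in> carrier F"
  then have "h (c \<otimes>\<^bsub>F\<^esub> inv\<^bsub>F\<^esub> d) = h c \<ominus>\<^bsub>V\<^esub> h d"
    by (subst h.hom_mult) (auto simp del: mult_free_Abelian_group simp: a_minus_def a_inv_def)
  then show "h (c - d) = h c \<ominus>\<^bsub>V\<^esub> h d" using cd by (simp add: inv_F)
qed

lemma hom_F_N:
  assumes V: "abelian_group V" and h: "h \<in> hom F (add_monoid V)"
    and 0: "\<And>c. c \<in> tensor_relators R P Q \<Longrightarrow> h c = \<zero>\<^bsub>V\<^esub>"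
    and c: "c \<in> N"
  shows "h c = \<zero>\<^bsub>V\<^esub>"
proof -
  interpret V: abelian_group V by fact
  interpret h: group_hom F "add_monoid V" h
    using h by (simp add: group_hom_def group_hom_axioms_def V.a_group)
  have "N \<subseteq> kernel F (add_monoid V) h"
    using 0 tensor_relators_carrier
    by (intro F.generate_subgroup_incl h.subgroup_kernel) (auto simp: kernel_def)
  then show ?thesis using c by (auto simp: kernel_def)
qed

text \<open>A balanced biadditive map extends to a homomorphism on the free group; the extension
  kills the relators, so its kernel contains \<open>N\<close> and it is constant on cosets.\<close>

lemma tensor_lift:
  assumes V: "abelian_group V"
    and closed: "\<And>x y. x \<in> carrier P \<Longrightarrow> y \<in> carrier Q \<Longrightarrow> \<beta> x y \<in> carrier V"
    and add_left: "\<And>x x' y. x \<in> carrier P \<Longrightarrow> x' \<in> carrier P \<Longrightarrow> y \<in> carrier Q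
      \<Longrightarrow> \<beta> (x \<oplus>\<^bsub>P\<^esub> x') y = \<beta> x y \<oplus>\<^bsub>V\<^esub> \<beta> x' y"
    and add_right: "\<And>x y y'. x \<in> carrier P \<Longrightarrow> y \<in> carrier Q \<Longrightarrow> y' \<in> carrier Q
      \<Longrightarrow> \<beta> x (y \<oplus>\<^bsub>Q\<^esub> y') = \<beta> x y \<oplus>\<^bsub>V\<^esub> \<beta> x y'"
    and balanced: "\<And>x y r. x \<in> carrier P \<Longrightarrow> y \<in> carrier Q \<Longrightarrow> r \<in> carrier R
      \<Longrightarrow> \<beta> (x \<triangleleft>\<^bsub>P\<^esub> r) y = \<beta> x (r \<odot>\<^bsub>Q\<^esub> y)"
  obtains g where "g \<in> carrier T \<rightarrow> carrier V"
    and "\<And>A B. A \<in> carrier T \<Longrightarrow> B \<in> carrier T \<Longrightarrow> g (A \<oplus>\<^bsub>T\<^esub> B) = g A \<oplus>\<^bsub>V\<^esub> g B"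
    and "\<And>x y. x \<in> carrier P \<Longrightarrow> y \<in> carrier Q \<Longrightarrow> g (pure_tensor x y) = \<beta> x y"
proof -
  interpret V: abelian_group V by fact
  obtain h where h: "h \<in> hom F (add_monoid V)"
    and h_of: "\<And>z. z \<in> carrier P \<times> carrier Q \<Longrightarrow> h (frag_of z) = (case z of (x, y) \<Rightarrow> \<beta> x y)"
    using comm_group.free_Abelian_group_universal[OF V.a_comm_group, of "\<lambda>(x, y). \<beta> x y" "carrier P \<times> carrier Q"] closed
    by (auto simp: image_subset_iff)
  have h_rel: "h c = \<zero>\<^bsub>V\<^esub>" if "c \<in> tensor_relators R P Q" for c
  proof -
    have "a \<oplus>\<^bsub>V\<^esub> b \<ominus>\<^bsub>V\<^esub> a \<ominus>\<^bsub>V\<^esub> b = \<zero>\<^bsub>V\<^esub>" if "a \<in> carrier V" "b \<in> carrier V" for a b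
    proof -
      have "a \<oplus>\<^bsub>V\<^esub> b \<ominus>\<^bsub>V\<^esub> a \<ominus>\<^bsub>V\<^esub> b = (a \<oplus>\<^bsub>V\<^esub> b) \<oplus>\<^bsub>V\<^esub> \<ominus>\<^bsub>V\<^esub> (a \<oplus>\<^bsub>V\<^esub> b)"
        using that by (simp add: V.minus_eq V.minus_add V.a_assoc)
      then show ?thesis using that by (simp add: V.r_neg)
    qed
    moreover have "a \<ominus>\<^bsub>V\<^esub> a = \<zero>\<^bsub>V\<^esub>" if "a \<in> carrier V" for a
      using that by (simp add: V.minus_eq V.r_neg)
    ultimately show ?thesis
      by (cases rule: tensor_relatorsE[OF that])
        (simp_all add: hom_F_zero_minus[OF V h] carrier_F_diff h_of closed add_left add_right balanced
          P.rsmult_closed Q.smult_closed)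
  qed
  have h_closed: "h c \<in> carrier V" if "c \<in> carrier F" for c using that h by (auto simp: hom_def)
  have h_cong: "h c = h d" if "tensor_coset c = tensor_coset d" "c \<in> carrier F" "d \<in> carrier F" for c d
  proof -
    have "h c \<ominus>\<^bsub>V\<^esub> h d = \<zero>\<^bsub>V\<^esub>"
      using hom_F_N[OF V h h_rel, of "c - d"] that tensor_coset_eq_iff[of c d] hom_F_zero_minus(2)[OF V h, of c d]
      by simp
    then show ?thesis using that h_closed V.minus_equality[of "h c" "\<ominus>\<^bsub>V\<^esub> h d"] by (simp add: V.minus_eq)
  qed
  \<comment> \<open>\<open>h_cong\<close> makes the choice of representative immaterial.\<close>
  define g where "g A = h (SOME c. c \<in> carrier F \<and> tensor_coset c = A)" for A
  have g: "g (tensor_coset c) = h c" if "c \<in> carrier F" for c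
    unfolding g_def by (rule someI2[of _ c]) (use that in \<open>blast intro: h_cong\<close>)+
  show thesis
  proof
    show "g \<in> carrier T \<rightarrow> carrier V" by (auto simp: carrier_tensor g h_closed)
    show "g (A \<oplus>\<^bsub>T\<^esub> B) = g A \<oplus>\<^bsub>V\<^esub> g B" if "A \<in> carrier T" "B \<in> carrier T" for A B
      using that hom_mult[OF h]
      by (auto simp: carrier_tensor add_tensor g carrier_F_add)
    show "g (pure_tensor x y) = \<beta> x y" if "x \<in> carrier P" "y \<in> carrier Q" for x y
      using that by (simp add: pure_tensor_def g h_of)
  qed
qed

text \<open>Both actions on the tensor product are of this form.\<close>

lemma tensor_action:
  assumes S: "\<And>z. z \<in> carrier P \<times> carrier Q \<Longrightarrow> \<sigma> z \<in> carrier P \<times> carrier Q"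
    and rel: "\<And>c. c \<in> tensor_relators R P Q \<Longrightarrow> frag_extend (frag_of \<circ> \<sigma>) c \<in> N"
    and c: "c \<in> carrier F"
  shows "the_elem ((\<lambda>c. N #>\<^bsub>F\<^esub> frag_extend (frag_of \<circ> \<sigma>) c) ` tensor_coset c)
    = tensor_coset (frag_extend (frag_of \<circ> \<sigma>) c)"
    and "frag_extend (frag_of \<circ> \<sigma>) c \<in> carrier F"
proof -
  let ?e = "frag_extend (frag_of \<circ> \<sigma>)"
  have e_F: "?e d \<in> carrier F" if "d \<in> carrier F" for d
  proof -
    have "Poly_Mapping.keys (?e d) \<subseteq> \<sigma> ` Poly_Mapping.keys d"
      using keys_frag_extend[of "frag_of \<circ> \<sigma>" d] by auto
    also have "\<dots> \<subseteq> carrier P \<times> carrier Q" using that S by (simp only: carrier_free_Abelian_group_iff) blast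
    finally show ?thesis by (simp add: carrier_free_Abelian_group_iff)
  qed
  show "?e c \<in> carrier F" using c by (rule e_F)
  \<comment> \<open>The elements sent into \<open>N\<close> form a subgroup; it contains the
    relators, hence all of \<open>N\<close>.\<close>
  have "subgroup {d \<in> carrier F. ?e d \<in> N} F"
  proof (rule F.subgroupI)
    show "{d \<in> carrier F. ?e d \<in> N} \<noteq> {}" using F.one_closed subgroup.one_closed[OF subgroup_N] by force
  next
    fix a assume "a \<in> {d \<in> carrier F. ?e d \<in> N}"
    then show "inv\<^bsub>F\<^esub> a \<in> {d \<in> carrier F. ?e d \<in> N}"
      using subgroup.m_inv_closed[OF subgroup_N, of "?e a"] e_F[of a] F.inv_closed[of a]
      by (simp add: frag_extend_minus inv_F)
  next
    fix a b assume "a \<in> {d \<in> carrier F. ?e d \<in> N}" "b \<in> {d \<in> carrier F. ?e d \<in> N}"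
    then show "a \<otimes>\<^bsub>F\<^esub> b \<in> {d \<in> carrier F. ?e d \<in> N}"
      using subgroup.m_closed[OF subgroup_N, of "?e a" "?e b"] carrier_F_add[of a b] by (simp add: frag_extend_add)
  qed auto
  then have "N \<subseteq> {d \<in> carrier F. ?e d \<in> N}"
    using rel tensor_relators_carrier by (intro F.generate_subgroup_incl) auto
  then have e_N: "?e d \<in> N" if "d \<in> N" for d using that by auto
  \<comment> \<open>All elements of one coset thus yield the same coset, so \<open>the_elem\<close>
    is applied to a singleton.\<close>
  have image: "tensor_coset (?e d) = tensor_coset (?e c)" if "d \<in> tensor_coset c" for d
  proof -
    from that obtain n where "n \<in> N" "d = n + c" by (auto simp: tensor_coset_def r_coset_def)
    then show ?thesis
      using c by (intro tensor_coset_eqI) (auto simp: frag_extend_add e_N e_F N_carrier carrier_F_add)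
  qed
  have "c \<in> tensor_coset c" unfolding tensor_coset_def by (rule F.rcos_self[OF c subgroup_N])
  then have "tensor_coset c \<noteq> {}" by blast
  from the_elem_image_unique[OF this image]
  show "the_elem ((\<lambda>c. N #>\<^bsub>F\<^esub> ?e c) ` tensor_coset c) = tensor_coset (?e c)"
    unfolding tensor_coset_def[symmetric] .
qed

text \<open>Relators go to relators of the same kind: the additive ones because r acts additively,
  the balancing ones because the two actions on \<open>P\<close> commute, (r x) s = r (x s).\<close>

lemma frag_extend_smult_relators:
  assumes "r \<in> carrier R" "c \<in> tensor_relators R P Q"
  shows "frag_extend (frag_of \<circ> (\<lambda>(x, y). (r \<odot>\<^bsub>P\<^esub> x, y))) c \<in> N"
proof -
  have "frag_extend (frag_of \<circ> (\<lambda>(x, y). (r \<odot>\<^bsub>P\<^esub> x, y))) c \<in> tensor_relators R P Q"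
    using assms(2)
    by (cases rule: tensor_relatorsE)
      (simp_all add: frag_extend_diff tensor_relatorsI assms(1) P.smult_closed P.smult_r_distr P.smult_rsmult[symmetric])
  then show ?thesis by (rule generate.incl)
qed

lemma frag_extend_rsmult_relators:
  assumes "r \<in> carrier R" "c \<in> tensor_relators R P Q"
  shows "frag_extend (frag_of \<circ> (\<lambda>(x, y). (x, y \<triangleleft>\<^bsub>Q\<^esub> r))) c \<in> N"
proof -
  have "frag_extend (frag_of \<circ> (\<lambda>(x, y). (x, y \<triangleleft>\<^bsub>Q\<^esub> r))) c \<in> tensor_relators R P Q"
    using assms(2)
    by (cases rule: tensor_relatorsE)
      (simp_all add: frag_extend_diff tensor_relatorsI assms(1) Q.rsmult_closed Q.rsmult_l_distr Q.smult_rsmult)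
  then show ?thesis by (rule generate.incl)
qed

lemma smult_tensor_coset:
  assumes "r \<in> carrier R" "c \<in> carrier F"
  shows "r \<odot>\<^bsub>T\<^esub> tensor_coset c = tensor_coset (frag_extend (frag_of \<circ> (\<lambda>(x, y). (r \<odot>\<^bsub>P\<^esub> x, y))) c)"
    and "frag_extend (frag_of \<circ> (\<lambda>(x, y). (r \<odot>\<^bsub>P\<^esub> x, y))) c \<in> carrier F"
proof -
  have eq: "(\<lambda>(x, y). frag_of (r \<odot>\<^bsub>P\<^esub> x, y)) = frag_of \<circ> (\<lambda>(x, y). (r \<odot>\<^bsub>P\<^esub> x, y))" by auto
  note t = tensor_action[of "\<lambda>(x, y). (r \<odot>\<^bsub>P\<^esub> x, y)" c]
  show "r \<odot>\<^bsub>T\<^esub> tensor_coset c = tensor_coset (frag_extend (frag_of \<circ> (\<lambda>(x, y). (r \<odot>\<^bsub>P\<^esub> x, y))) c)"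
    using t(1) assms frag_extend_smult_relators by (auto simp: tensor_def Let_def eq P.smult_closed)
  show "frag_extend (frag_of \<circ> (\<lambda>(x, y). (r \<odot>\<^bsub>P\<^esub> x, y))) c \<in> carrier F"
    by (rule t(2)) (use assms frag_extend_smult_relators in \<open>auto simp: P.smult_closed\<close>)
qed

lemma rsmult_tensor_coset:
  assumes "r \<in> carrier R" "c \<in> carrier F"
  shows "tensor_coset c \<triangleleft>\<^bsub>T\<^esub> r = tensor_coset (frag_extend (frag_of \<circ> (\<lambda>(x, y). (x, y \<triangleleft>\<^bsub>Q\<^esub> r))) c)"
    and "frag_extend (frag_of \<circ> (\<lambda>(x, y). (x, y \<triangleleft>\<^bsub>Q\<^esub> r))) c \<in> carrier F"
proof -
  have eq: "(\<lambda>(x, y). frag_of (x, y \<triangleleft>\<^bsub>Q\<^esub> r)) = frag_of \<circ> (\<lambda>(x, y). (x, y \<triangleleft>\<^bsub>Q\<^esub> r))" by auto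
  note t = tensor_action[of "\<lambda>(x, y). (x, y \<triangleleft>\<^bsub>Q\<^esub> r)" c]
  show "tensor_coset c \<triangleleft>\<^bsub>T\<^esub> r = tensor_coset (frag_extend (frag_of \<circ> (\<lambda>(x, y). (x, y \<triangleleft>\<^bsub>Q\<^esub> r))) c)"
    using t(1) assms frag_extend_rsmult_relators by (auto simp: tensor_def Let_def eq Q.rsmult_closed)
  show "frag_extend (frag_of \<circ> (\<lambda>(x, y). (x, y \<triangleleft>\<^bsub>Q\<^esub> r))) c \<in> carrier F"
    by (rule t(2)) (use assms frag_extend_rsmult_relators in \<open>auto simp: Q.rsmult_closed\<close>)
qed

lemma smult_pure_tensor:
  assumes "r \<in> carrier R" "x \<in> carrier P" "y \<in> carrier Q"
  shows "r \<odot>\<^bsub>T\<^esub> pure_tensor x y = pure_tensor (r \<odot>\<^bsub>P\<^esub> x) y"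
  using assms by (simp add: pure_tensor_def smult_tensor_coset)

lemma rsmult_pure_tensor:
  assumes "r \<in> carrier R" "x \<in> carrier P" "y \<in> carrier Q"
  shows "pure_tensor x y \<triangleleft>\<^bsub>T\<^esub> r = pure_tensor x (y \<triangleleft>\<^bsub>Q\<^esub> r)"
  using assms by (simp add: pure_tensor_def rsmult_tensor_coset)

lemma smult_tensor_closed: "r \<in> carrier R \<Longrightarrow> A \<in> carrier T \<Longrightarrow> r \<odot>\<^bsub>T\<^esub> A \<in> carrier T"
  using smult_tensor_coset by (auto simp: carrier_tensor)

lemma rsmult_tensor_closed: "r \<in> carrier R \<Longrightarrow> A \<in> carrier T \<Longrightarrow> A \<triangleleft>\<^bsub>T\<^esub> r \<in> carrier T"
  using rsmult_tensor_coset by (auto simp: carrier_tensor)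

lemma smult_tensor_add:
  assumes "r \<in> carrier R" "A \<in> carrier T" "B \<in> carrier T"
  shows "r \<odot>\<^bsub>T\<^esub> (A \<oplus>\<^bsub>T\<^esub> B) = r \<odot>\<^bsub>T\<^esub> A \<oplus>\<^bsub>T\<^esub> r \<odot>\<^bsub>T\<^esub> B"
  using assms by (auto simp: carrier_tensor add_tensor smult_tensor_coset carrier_F_add frag_extend_add)

lemma rsmult_tensor_add:
  assumes "r \<in> carrier R" "A \<in> carrier T" "B \<in> carrier T"
  shows "(A \<oplus>\<^bsub>T\<^esub> B) \<triangleleft>\<^bsub>T\<^esub> r = A \<triangleleft>\<^bsub>T\<^esub> r \<oplus>\<^bsub>T\<^esub> B \<triangleleft>\<^bsub>T\<^esub> r"
  using assms by (auto simp: carrier_tensor add_tensor rsmult_tensor_coset carrier_F_add frag_extend_add)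

text \<open>Pure tensors generate, so additive maps that agree on them are equal. Most identities in
  tensor products are reduced to pure tensors through this rule.\<close>

lemma additive_eq_on_tensor:
  assumes V: "abelian_group V"
    and g: "g \<in> carrier T \<rightarrow> carrier V" and h: "h \<in> carrier T \<rightarrow> carrier V"
    and "\<And>A B. A \<in> carrier T \<Longrightarrow> B \<in> carrier T \<Longrightarrow> g (A \<oplus>\<^bsub>T\<^esub> B) = g A \<oplus>\<^bsub>V\<^esub> g B"
    and "\<And>A B. A \<in> carrier T \<Longrightarrow> B \<in> carrier T \<Longrightarrow> h (A \<oplus>\<^bsub>T\<^esub> B) = h A \<oplus>\<^bsub>V\<^esub> h B"
    and pure: "\<And>x y. x \<in> carrier P \<Longrightarrow> y \<in> carrier Q \<Longrightarrow> g (pure_tensor x y) = h (pure_tensor x y)"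
    and A: "A \<in> carrier T"
  shows "g A = h A"
proof -
  note g_simps = additive_map_simps[OF abelian_group_tensor V g assms(4)]
  note h_simps = additive_map_simps[OF abelian_group_tensor V h assms(5)]
  from A show ?thesis
    by (induction rule: tensor_induct) (simp_all add: g_simps h_simps pure)
qed

lemma bimodule_tensor: "bimodule K R T"
proof -
  note [simp] = smult_tensor_closed rsmult_tensor_closed smult_tensor_add rsmult_tensor_add
    smult_pure_tensor rsmult_pure_tensor pure_tensor_closed P.smult_closed Q.smult_closed
    P.rsmult_closed Q.rsmult_closed
  note eqI = additive_eq_on_tensor[OF abelian_group_tensor]
  show ?thesis
  proof (intro bimodule.intro left_module.intro left_module_axioms.intro bimodule_axioms.intro
      abelian_group_tensor KR.R.ring_axioms)
    fix r s A assume rs: "r \<in> carrier R" "s \<in> carrier R" and A: "A \<in> carrier T"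
    show "(r \<oplus>\<^bsub>R\<^esub> s) \<odot>\<^bsub>T\<^esub> A = r \<odot>\<^bsub>T\<^esub> A \<oplus>\<^bsub>T\<^esub> s \<odot>\<^bsub>T\<^esub> A"
      by (rule eqI[OF _ _ _ _ _ A]) (use rs in \<open>auto simp: P.smult_l_distr pure_tensor_add_left T.a_ac\<close>)
    show "(r \<otimes>\<^bsub>R\<^esub> s) \<odot>\<^bsub>T\<^esub> A = r \<odot>\<^bsub>T\<^esub> (s \<odot>\<^bsub>T\<^esub> A)"
      by (rule eqI[OF _ _ _ _ _ A]) (use rs in \<open>auto simp: P.smult_assoc\<close>)
  next
    fix r s A assume rs: "r \<in> carrier R" "s \<in> carrier R" and A: "A \<in> carrier T"
    show "A \<triangleleft>\<^bsub>T\<^esub> (r \<oplus>\<^bsub>R\<^esub> s) = A \<triangleleft>\<^bsub>T\<^esub> r \<oplus>\<^bsub>T\<^esub> A \<triangleleft>\<^bsub>T\<^esub> s"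
      by (rule eqI[OF _ _ _ _ _ A]) (use rs in \<open>auto simp: Q.rsmult_r_distr pure_tensor_add_right T.a_ac\<close>)
    show "A \<triangleleft>\<^bsub>T\<^esub> (r \<otimes>\<^bsub>R\<^esub> s) = A \<triangleleft>\<^bsub>T\<^esub> r \<triangleleft>\<^bsub>T\<^esub> s"
      by (rule eqI[OF _ _ _ _ _ A]) (use rs in \<open>auto simp: Q.rsmult_assoc\<close>)
    show "(r \<odot>\<^bsub>T\<^esub> A) \<triangleleft>\<^bsub>T\<^esub> s = r \<odot>\<^bsub>T\<^esub> (A \<triangleleft>\<^bsub>T\<^esub> s)"
      by (rule eqI[OF _ _ _ _ _ A]) (use rs in auto)
  next
    fix A assume A: "A \<in> carrier T"
    show "\<one>\<^bsub>R\<^esub> \<odot>\<^bsub>T\<^esub> A = A"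
      by (rule eqI[OF _ _ _ _ _ A]) (auto simp: P.smult_one)
    show "A \<triangleleft>\<^bsub>T\<^esub> \<one>\<^bsub>R\<^esub> = A"
      by (rule eqI[OF _ _ _ _ _ A]) (auto simp: Q.rsmult_one)
  next
    fix k A assume k: "k \<in> carrier K" and A: "A \<in> carrier T"
    show "(k \<odot>\<^bsub>R\<^esub> \<one>\<^bsub>R\<^esub>) \<odot>\<^bsub>T\<^esub> A = A \<triangleleft>\<^bsub>T\<^esub> (k \<odot>\<^bsub>R\<^esub> \<one>\<^bsub>R\<^esub>)"
    proof (rule eqI[OF _ _ _ _ _ A])
      let ?k = "k \<odot>\<^bsub>R\<^esub> \<one>\<^bsub>R\<^esub>"
      have R: "?k \<in> carrier R" using k by (simp add: KR.KR.smult_closed)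
      \<comment> \<open>The scalar crosses the tensor sign: (k x) \<otimes> y = (x k) \<otimes> y =
        x \<otimes> (k y) = x \<otimes> (y k).\<close>
      show "?k \<odot>\<^bsub>T\<^esub> pure_tensor x y = pure_tensor x y \<triangleleft>\<^bsub>T\<^esub> ?k" if "x \<in> carrier P" "y \<in> carrier Q" for x y
        using that R k pure_tensor_balanced[of x y ?k] by (simp add: P.central Q.central)
    qed (use k KR.KR.smult_closed[of k "\<one>\<^bsub>R\<^esub>"] in auto)
  qed auto
qed

text \<open>An additive \<open>s\<close> with s(\<beta> x y) = x \<otimes> y is a left inverse of
  the map induced by \<beta>, because it is one on pure tensors; surjectivity comes from the values
  of \<beta> generating \<open>V\<close>. An application only has to exhibit \<beta> and an explicit
  formula for \<open>s\<close>.\<close>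

lemma tensor_isomorphicI:
  assumes V: "bimodule K R V"
    and closed: "\<And>x y. x \<in> carrier P \<Longrightarrow> y \<in> carrier Q \<Longrightarrow> \<beta> x y \<in> carrier V"
    and add_left: "\<And>x x' y. x \<in> carrier P \<Longrightarrow> x' \<in> carrier P \<Longrightarrow> y \<in> carrier Q
      \<Longrightarrow> \<beta> (x \<oplus>\<^bsub>P\<^esub> x') y = \<beta> x y \<oplus>\<^bsub>V\<^esub> \<beta> x' y"
    and add_right: "\<And>x y y'. x \<in> carrier P \<Longrightarrow> y \<in> carrier Q \<Longrightarrow> y' \<in> carrier Q
      \<Longrightarrow> \<beta> x (y \<oplus>\<^bsub>Q\<^esub> y') = \<beta> x y \<oplus>\<^bsub>V\<^esub> \<beta> x y'"
    and balanced: "\<And>x y r. x \<in> carrier P \<Longrightarrow> y \<in> carrier Q \<Longrightarrow> r \<in> carrier R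
      \<Longrightarrow> \<beta> (x \<triangleleft>\<^bsub>P\<^esub> r) y = \<beta> x (r \<odot>\<^bsub>Q\<^esub> y)"
    and smult: "\<And>x y r. x \<in> carrier P \<Longrightarrow> y \<in> carrier Q \<Longrightarrow> r \<in> carrier R
      \<Longrightarrow> \<beta> (r \<odot>\<^bsub>P\<^esub> x) y = r \<odot>\<^bsub>V\<^esub> \<beta> x y"
    and rsmult: "\<And>x y r. x \<in> carrier P \<Longrightarrow> y \<in> carrier Q \<Longrightarrow> r \<in> carrier R
      \<Longrightarrow> \<beta> x (y \<triangleleft>\<^bsub>Q\<^esub> r) = \<beta> x y \<triangleleft>\<^bsub>V\<^esub> r"
    and generates: "carrier V \<subseteq> generate (add_monoid V) {\<beta> x y | x y. x \<in> carrier P \<and> y \<in> carrier Q}"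
    and s: "s \<in> carrier V \<rightarrow> carrier T"
    and s_add: "\<And>x y. x \<in> carrier V \<Longrightarrow> y \<in> carrier V \<Longrightarrow> s (x \<oplus>\<^bsub>V\<^esub> y) = s x \<oplus>\<^bsub>T\<^esub> s y"
    and s_\<beta>: "\<And>x y. x \<in> carrier P \<Longrightarrow> y \<in> carrier Q \<Longrightarrow> s (\<beta> x y) = pure_tensor x y"
  shows "T \<simeq>\<^bsub>R\<^esub> V"
proof -
  interpret V: bimodule K R V by fact
  note Vg = V.M.abelian_group_axioms
  obtain g where g: "g \<in> carrier T \<rightarrow> carrier V"
    and g_add: "\<And>A B. A \<in> carrier T \<Longrightarrow> B \<in> carrier T \<Longrightarrow> g (A \<oplus>\<^bsub>T\<^esub> B) = g A \<oplus>\<^bsub>V\<^esub> g B"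
    and g_pure: "\<And>x y. x \<in> carrier P \<Longrightarrow> y \<in> carrier Q \<Longrightarrow> g (pure_tensor x y) = \<beta> x y"
    using tensor_lift[of V \<beta>, OF Vg closed add_left add_right balanced] by blast
  note g_closed = funcset_mem[OF g] and s_closed = funcset_mem[OF s]
  have sg: "s (g A) = A" if A: "A \<in> carrier T" for A
    by (rule additive_eq_on_tensor[OF abelian_group_tensor _ _ _ _ _ A])
      (auto simp: g_closed s_closed g_add s_add g_pure s_\<beta>)
  \<comment> \<open>The image of \<open>g\<close> contains the generators \<beta> x y and is closed
    under the group operations.\<close>
  have "x \<in> g ` carrier T" if "x \<in> generate (add_monoid V) {\<beta> x y | x y. x \<in> carrier P \<and> y \<in> carrier Q}" for x
    using that
  proof (induction rule: generate.induct)
    case one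
    then show ?case using additive_map_simps(1)[OF abelian_group_tensor Vg g g_add] by force
  next
    case (incl h)
    then show ?case using g_pure pure_tensor_closed by (force simp: image_iff)
  next
    case (inv h)
    then obtain x y where xy: "x \<in> carrier P" "y \<in> carrier Q" "h = \<beta> x y" by blast
    have "\<ominus>\<^bsub>V\<^esub> h = g (\<ominus>\<^bsub>T\<^esub> pure_tensor x y)"
      using xy additive_map_simps(2)[OF abelian_group_tensor Vg g g_add] by (simp add: g_pure pure_tensor_closed)
    then show ?case using xy by (auto simp: a_inv_def[symmetric] pure_tensor_closed)
  next
    case (eng h1 h2)
    then obtain A B where "A \<in> carrier T" "B \<in> carrier T" "h1 = g A" "h2 = g B" by blast
    then show ?case using g_add[of A B] T.a_closed[of A B] by (auto intro!: image_eqI[of _ _ "A \<oplus>\<^bsub>T\<^esub> B"])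
  qed
  then have surj: "carrier V \<subseteq> g ` carrier T" using generates by blast
  have "g \<in> bimodule_iso R T V"
  proof (rule bimodule_isoI)
    show "bij_betw g (carrier T) (carrier V)"
      using surj g by (auto simp: bij_betw_def intro!: inj_on_inverseI[of _ s] sg)
    fix r A assume r: "r \<in> carrier R" and A: "A \<in> carrier T"
    show "g (r \<odot>\<^bsub>T\<^esub> A) = r \<odot>\<^bsub>V\<^esub> g A"
      by (rule additive_eq_on_tensor[OF Vg _ _ _ _ _ A])
        (auto simp: r smult_tensor_closed g_closed V.smult_closed smult_tensor_add g_add V.smult_r_distr
          smult_pure_tensor P.smult_closed g_pure smult)
    show "g (A \<triangleleft>\<^bsub>T\<^esub> r) = g A \<triangleleft>\<^bsub>V\<^esub> r"
      by (rule additive_eq_on_tensor[OF Vg _ _ _ _ _ A])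
        (auto simp: r rsmult_tensor_closed g_closed V.rsmult_closed rsmult_tensor_add g_add V.rsmult_l_distr
          rsmult_pure_tensor Q.rsmult_closed g_pure rsmult)
  qed (rule g_add)
  then show ?thesis by (auto simp: bimodule_isomorphic_def)
qed

end

section \<open>Twisted bimodules and the dual\<close>

lemma algebra_autoD:
  assumes "\<alpha> \<in> algebra_auto K R"
  shows "bij_betw \<alpha> (carrier R) (carrier R)"
    and "x \<in> carrier R \<Longrightarrow> \<alpha> x \<in> carrier R"
    and "x \<in> carrier R \<Longrightarrow> y \<in> carrier R \<Longrightarrow> \<alpha> (x \<oplus>\<^bsub>R\<^esub> y) = \<alpha> x \<oplus>\<^bsub>R\<^esub> \<alpha> y"
    and "x \<in> carrier R \<Longrightarrow> y \<in> carrier R \<Longrightarrow> \<alpha> (x \<otimes>\<^bsub>R\<^esub> y) = \<alpha> x \<otimes>\<^bsub>R\<^esub> \<alpha> y"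
    and "\<alpha> \<one>\<^bsub>R\<^esub> = \<one>\<^bsub>R\<^esub>"
    and "k \<in> carrier K \<Longrightarrow> x \<in> carrier R \<Longrightarrow> \<alpha> (k \<odot>\<^bsub>R\<^esub> x) = k \<odot>\<^bsub>R\<^esub> \<alpha> x"
  using assms by (auto simp: algebra_auto_def Bij_def ring_hom_def)

lemma (in K_algebra) algebra_auto_inv:
  assumes \<alpha>: "\<alpha> \<in> algebra_auto K R"
  obtains \<alpha>' where "\<alpha>' \<in> algebra_auto K R"
    and "\<And>x. x \<in> carrier R \<Longrightarrow> \<alpha>' (\<alpha> x) = x" and "\<And>x. x \<in> carrier R \<Longrightarrow> \<alpha> (\<alpha>' x) = x"
proof -
  note \<alpha>D = algebra_autoD[OF \<alpha>]
  \<comment> \<open>Elements of \<open>Bij\<close> are extensional, hence the restriction of the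
    inverse.\<close>
  define \<alpha>' where "\<alpha>' = (\<lambda>x\<in>carrier R. inv_into (carrier R) \<alpha> x)"
  have left: "\<alpha>' (\<alpha> x) = x" if "x \<in> carrier R" for x
    using that bij_betw_inv_into_left[OF \<alpha>D(1)] by (simp add: \<alpha>'_def \<alpha>D)
  have right: "\<alpha> (\<alpha>' x) = x" if "x \<in> carrier R" for x
    using that bij_betw_inv_into_right[OF \<alpha>D(1)] by (simp add: \<alpha>'_def)
  have Bij: "\<alpha>' \<in> Bij (carrier R)"
    using \<alpha> unfolding \<alpha>'_def by (intro restrict_inv_into_Bij) (simp add: algebra_auto_def)
  then have closed: "\<alpha>' x \<in> carrier R" if "x \<in> carrier R" for x
    using that by (auto simp: Bij_def bij_betw_def)
  have eqI: "\<alpha>' x = y" if "y \<in> carrier R" "x = \<alpha> y" for x y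
    using that left by simp
  show thesis
  proof (rule that[OF _ left right])
    show "\<alpha>' \<in> algebra_auto K R"
      unfolding algebra_auto_def using Bij
      by (auto intro!: ring_hom_memI eqI simp: closed \<alpha>D right)
  qed
qed

definition twist_left :: "('r, 'm, 'f) bimodule_scheme \<Rightarrow> ('r \<Rightarrow> 'r) \<Rightarrow> ('r, 'm, 'f) bimodule_scheme"
  where "twist_left P \<alpha> = P\<lparr>module.smult := \<lambda>r x. \<alpha> r \<odot>\<^bsub>P\<^esub> x\<rparr>"

definition twist_right :: "('r, 'm, 'f) bimodule_scheme \<Rightarrow> ('r \<Rightarrow> 'r) \<Rightarrow> ('r, 'm, 'f) bimodule_scheme"
  where "twist_right P \<alpha> = P\<lparr>rsmult := \<lambda>x r. x \<triangleleft>\<^bsub>P\<^esub> \<alpha> r\<rparr>"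

lemma twist_simps [simp]:
  "carrier (twist_left P \<alpha>) = carrier P" "\<zero>\<^bsub>twist_left P \<alpha>\<^esub> = \<zero>\<^bsub>P\<^esub>"
  "x \<oplus>\<^bsub>twist_left P \<alpha>\<^esub> y = x \<oplus>\<^bsub>P\<^esub> y" "r \<odot>\<^bsub>twist_left P \<alpha>\<^esub> x = \<alpha> r \<odot>\<^bsub>P\<^esub> x"
  "x \<triangleleft>\<^bsub>twist_left P \<alpha>\<^esub> r = x \<triangleleft>\<^bsub>P\<^esub> r"
  "carrier (twist_right P \<alpha>) = carrier P" "\<zero>\<^bsub>twist_right P \<alpha>\<^esub> = \<zero>\<^bsub>P\<^esub>"
  "x \<oplus>\<^bsub>twist_right P \<alpha>\<^esub> y = x \<oplus>\<^bsub>P\<^esub> y" "r \<odot>\<^bsub>twist_right P \<alpha>\<^esub> x = r \<odot>\<^bsub>P\<^esub> x"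
  "x \<triangleleft>\<^bsub>twist_right P \<alpha>\<^esub> r = x \<triangleleft>\<^bsub>P\<^esub> \<alpha> r"
  by (simp_all add: twist_left_def twist_right_def)

text \<open>Twisting an action, or reading a ring as a bimodule over itself, changes only fields
  outside the additive structure.\<close>

lemma abelian_group_cong:
  assumes "abelian_group G" "carrier H = carrier G" "\<zero>\<^bsub>H\<^esub> = \<zero>\<^bsub>G\<^esub>" "\<And>x y. x \<oplus>\<^bsub>H\<^esub> y = x \<oplus>\<^bsub>G\<^esub> y"
  shows "abelian_group H"
proof -
  interpret G: abelian_group G by fact
  show ?thesis
    by (rule abelian_groupI) (use G.add.r_inv_ex in \<open>auto simp: assms(2-4) G.a_ac intro: G.add.l_inv_ex\<close>)
qed

context K_algebra
begin

text \<open>This keeps \<open>K\<close> central after an action is twisted: the automorphism does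
  not move k 1.\<close>

lemma algebra_auto_scalar:
  assumes "\<alpha> \<in> algebra_auto K R" "k \<in> carrier K"
  shows "\<alpha> (k \<odot>\<^bsub>R\<^esub> \<one>\<^bsub>R\<^esub>) = k \<odot>\<^bsub>R\<^esub> \<one>\<^bsub>R\<^esub>"
  using algebra_autoD(5,6)[OF assms(1)] assms(2) by simp

lemma bimodule_twist_left:
  assumes "bimodule K R P" and \<alpha>: "\<alpha> \<in> algebra_auto K R"
  shows "bimodule K R (twist_left P \<alpha>)"
proof -
  interpret P: bimodule K R P by fact
  show ?thesis
    by (intro bimodule.intro left_module.intro left_module_axioms.intro bimodule_axioms.intro
        abelian_group_cong[OF P.M.abelian_group_axioms] R.ring_axioms)
      (simp_all add: algebra_autoD[OF \<alpha>] algebra_auto_scalar[OF \<alpha>] P.smult_closed P.smult_l_distr P.smult_r_distr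
        P.smult_assoc P.smult_one P.rsmult_closed P.rsmult_l_distr P.rsmult_r_distr P.rsmult_assoc P.rsmult_one
        P.smult_rsmult P.central)
qed

lemma bimodule_twist_right:
  assumes "bimodule K R P" and \<alpha>: "\<alpha> \<in> algebra_auto K R"
  shows "bimodule K R (twist_right P \<alpha>)"
proof -
  interpret P: bimodule K R P by fact
  show ?thesis
    by (intro bimodule.intro left_module.intro left_module_axioms.intro bimodule_axioms.intro
        abelian_group_cong[OF P.M.abelian_group_axioms] R.ring_axioms)
      (simp_all add: algebra_autoD[OF \<alpha>] algebra_auto_scalar[OF \<alpha>] P.smult_closed P.smult_l_distr P.smult_r_distr
        P.smult_assoc P.smult_one P.rsmult_closed P.rsmult_l_distr P.rsmult_r_distr P.rsmult_assoc P.rsmult_one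
        P.smult_rsmult P.central)
qed

lemma regular_bimodule_simps [simp]:
  "carrier (regular_bimodule R) = carrier R" "\<zero>\<^bsub>regular_bimodule R\<^esub> = \<zero>\<^bsub>R\<^esub>"
  "ring.add (regular_bimodule R) = ring.add R" "x \<odot>\<^bsub>regular_bimodule R\<^esub> y = x \<otimes>\<^bsub>R\<^esub> y"
  "x \<triangleleft>\<^bsub>regular_bimodule R\<^esub> y = x \<otimes>\<^bsub>R\<^esub> y"
  by (simp_all add: regular_bimodule_def)

lemma scalar_commute:
  assumes "k \<in> carrier K" "x \<in> carrier R"
  shows "(k \<odot>\<^bsub>R\<^esub> \<one>\<^bsub>R\<^esub>) \<otimes>\<^bsub>R\<^esub> x = k \<odot>\<^bsub>R\<^esub> x" "x \<otimes>\<^bsub>R\<^esub> (k \<odot>\<^bsub>R\<^esub> \<one>\<^bsub>R\<^esub>) = k \<odot>\<^bsub>R\<^esub> x"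
  using assms by (simp_all add: scale_mult_left scale_mult_right)

lemma bimodule_regular: "bimodule K R (regular_bimodule R)"
  by (intro bimodule.intro left_module.intro left_module_axioms.intro bimodule_axioms.intro
      abelian_group_cong[OF R.abelian_group_axioms] R.ring_axioms)
    (simp_all add: R.l_distr R.r_distr R.m_assoc scalar_commute)

lemma twisted_bimodule_eq: "twisted_bimodule R \<alpha> = twist_right (regular_bimodule R) \<alpha>"
  by (simp add: twisted_bimodule_def twist_right_def regular_bimodule_def)

lemma bimodule_twisted: "\<alpha> \<in> algebra_auto K R \<Longrightarrow> bimodule K R (twisted_bimodule R \<alpha>)"
  unfolding twisted_bimodule_eq by (intro bimodule_twist_right bimodule_regular)

text \<open>As a left module \<open>V\<close> is free on the preimage \<open>v\<close> of 1, since y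
  = \<psi>(y) v. Hence x \<otimes> y = x \<psi>(y) \<otimes> v, and x \<mapsto> x \<otimes> v
  inverts the induced map. The twist enters through \<psi>(y r) = \<psi>(y) \<alpha>(r).\<close>

lemma tensor_twisted_right:
  assumes P: "bimodule K R P" and V: "bimodule K R V" and \<alpha>: "\<alpha> \<in> algebra_auto K R"
    and \<psi>: "\<psi> \<in> bimodule_iso R V (twisted_bimodule R \<alpha>)"
  shows "P \<boxtimes>\<^bsub>R\<^esub> V \<simeq>\<^bsub>R\<^esub> twist_right P \<alpha>"
proof -
  interpret P: bimodule K R P by fact
  interpret V: bimodule K R V by fact
  interpret tensor_product K R P V by unfold_locales
  note \<psi>D = bimodule_isoD[OF \<psi>, unfolded twisted_bimodule_eq, simplified]
  define v where "v = inv_into (carrier V) \<psi> \<one>\<^bsub>R\<^esub>"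
  have v: "v \<in> carrier V" "\<psi> v = \<one>\<^bsub>R\<^esub>"
    using \<psi>D(5) by (auto simp: v_def bij_betw_def inv_into_into f_inv_into_f)
  have \<psi>_v: "\<psi> y \<odot>\<^bsub>V\<^esub> v = y" if "y \<in> carrier V" for y
    using that v by (intro inj_onD[OF bij_betw_imp_inj_on[OF \<psi>D(5)]]) (auto simp: \<psi>D V.smult_closed)
  show ?thesis
  proof (rule tensor_isomorphicI[where \<beta> = "\<lambda>x y. x \<triangleleft>\<^bsub>P\<^esub> \<psi> y" and s = "\<lambda>x. pure_tensor x v"])
    show "bimodule K R (twist_right P \<alpha>)" by (rule bimodule_twist_right[OF P \<alpha>])
    have "x \<in> generate (add_monoid (twist_right P \<alpha>)) {x \<triangleleft>\<^bsub>P\<^esub> \<psi> y |x y. x \<in> carrier P \<and> y \<in> carrier V}"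
      if "x \<in> carrier P" for x
      using that v by (intro generate.incl) (metis (mono_tags, lifting) P.rsmult_one mem_Collect_eq)
    then show "carrier (twist_right P \<alpha>)
      \<subseteq> generate (add_monoid (twist_right P \<alpha>)) {x \<triangleleft>\<^bsub>P\<^esub> \<psi> y |x y. x \<in> carrier P \<and> y \<in> carrier V}"
      by auto
  qed (simp_all add: \<psi>D v \<psi>_v algebra_autoD[OF \<alpha>] P.rsmult_closed P.rsmult_l_distr P.rsmult_r_distr P.rsmult_assoc
      P.smult_rsmult pure_tensor_closed pure_tensor_add_left pure_tensor_balanced)
qed

text \<open>On the right \<open>V\<close> is again free on \<open>v\<close>, but with a twisted
  coordinate: \<psi>(v s) = \<alpha>(s) gives y = v \<alpha>'(\<psi>(y)), so y \<otimes> x = v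
  \<otimes> \<alpha>'(\<psi>(y)) x. Therefore the inverse automorphism acts on the left.\<close>

lemma tensor_twisted_left:
  assumes P: "bimodule K R P" and V: "bimodule K R V" and \<alpha>: "\<alpha> \<in> algebra_auto K R" "\<alpha>' \<in> algebra_auto K R"
    and inv: "\<And>x. x \<in> carrier R \<Longrightarrow> \<alpha>' (\<alpha> x) = x" "\<And>x. x \<in> carrier R \<Longrightarrow> \<alpha> (\<alpha>' x) = x"
    and \<psi>: "\<psi> \<in> bimodule_iso R V (twisted_bimodule R \<alpha>)"
  shows "V \<boxtimes>\<^bsub>R\<^esub> P \<simeq>\<^bsub>R\<^esub> twist_left P \<alpha>'"
proof -
  interpret P: bimodule K R P by fact
  interpret V: bimodule K R V by fact
  interpret tensor_product K R V P by unfold_locales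
  note \<psi>D = bimodule_isoD[OF \<psi>, unfolded twisted_bimodule_eq, simplified]
  define v where "v = inv_into (carrier V) \<psi> \<one>\<^bsub>R\<^esub>"
  have v: "v \<in> carrier V" "\<psi> v = \<one>\<^bsub>R\<^esub>"
    using \<psi>D(5) by (auto simp: v_def bij_betw_def inv_into_into f_inv_into_f)
  have \<psi>_v: "v \<triangleleft>\<^bsub>V\<^esub> \<alpha>' (\<psi> y) = y" if "y \<in> carrier V" for y
    using that v
    by (intro inj_onD[OF bij_betw_imp_inj_on[OF \<psi>D(5)]]) (auto simp: \<psi>D V.rsmult_closed algebra_autoD[OF \<alpha>(2)] inv)
  show ?thesis
  proof (rule tensor_isomorphicI[where \<beta> = "\<lambda>y x. \<alpha>' (\<psi> y) \<odot>\<^bsub>P\<^esub> x" and s = "\<lambda>x. pure_tensor v x"])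
    show "bimodule K R (twist_left P \<alpha>')" by (rule bimodule_twist_left[OF P \<alpha>(2)])
    have "x \<in> generate (add_monoid (twist_left P \<alpha>')) {\<alpha>' (\<psi> y) \<odot>\<^bsub>P\<^esub> x |y x. y \<in> carrier V \<and> x \<in> carrier P}"
      if "x \<in> carrier P" for x
      using that v algebra_autoD(5)[OF \<alpha>(2)] 
      by (intro generate.incl) (metis (mono_tags, lifting) P.smult_one mem_Collect_eq)
    then show "carrier (twist_left P \<alpha>')
      \<subseteq> generate (add_monoid (twist_left P \<alpha>')) {\<alpha>' (\<psi> y) \<odot>\<^bsub>P\<^esub> x |y x. y \<in> carrier V \<and> x \<in> carrier P}"
      by auto
  qed (simp_all add: \<psi>D v \<psi>_v algebra_autoD[OF \<alpha>(1)] algebra_autoD[OF \<alpha>(2)] inv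
      P.smult_closed P.smult_l_distr P.smult_r_distr P.smult_assoc
      P.smult_rsmult pure_tensor_closed pure_tensor_add_right pure_tensor_balanced[symmetric])
qed

section \<open>The dual bimodule and its twists\<close>

lemma dual_bimodule_simps [simp]:
  "f \<oplus>\<^bsub>dual_bimodule K R\<^esub> g = (\<lambda>a\<in>carrier R. f a \<oplus>\<^bsub>K\<^esub> g a)"
  "\<zero>\<^bsub>dual_bimodule K R\<^esub> = (\<lambda>a\<in>carrier R. \<zero>\<^bsub>K\<^esub>)"
  "r \<odot>\<^bsub>dual_bimodule K R\<^esub> f = (\<lambda>a\<in>carrier R. f (a \<otimes>\<^bsub>R\<^esub> r))"
  "f \<triangleleft>\<^bsub>dual_bimodule K R\<^esub> r = (\<lambda>a\<in>carrier R. f (r \<otimes>\<^bsub>R\<^esub> a))"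
  by (simp_all add: dual_bimodule_def)

lemma dualI:
  assumes "f \<in> extensional (carrier R)" "\<And>x. x \<in> carrier R \<Longrightarrow> f x \<in> carrier K"
    and "\<And>x y. x \<in> carrier R \<Longrightarrow> y \<in> carrier R \<Longrightarrow> f (x \<oplus>\<^bsub>R\<^esub> y) = f x \<oplus>\<^bsub>K\<^esub> f y"
    and "\<And>k x. k \<in> carrier K \<Longrightarrow> x \<in> carrier R \<Longrightarrow> f (k \<odot>\<^bsub>R\<^esub> x) = k \<otimes>\<^bsub>K\<^esub> f x"
  shows "f \<in> carrier (dual_bimodule K R)"
  using assms by (simp add: dual_bimodule_def PiE_def)

lemma dualD:
  assumes "f \<in> carrier (dual_bimodule K R)"
  shows "f \<in> extensional (carrier R)" "x \<in> carrier R \<Longrightarrow> f x \<in> carrier K"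
    and "x \<in> carrier R \<Longrightarrow> y \<in> carrier R \<Longrightarrow> f (x \<oplus>\<^bsub>R\<^esub> y) = f x \<oplus>\<^bsub>K\<^esub> f y"
    and "k \<in> carrier K \<Longrightarrow> x \<in> carrier R \<Longrightarrow> f (k \<odot>\<^bsub>R\<^esub> x) = k \<otimes>\<^bsub>K\<^esub> f x"
  using assms by (auto simp: dual_bimodule_def PiE_def)

lemma dual_eqI:
  assumes "f \<in> extensional (carrier R)" "g \<in> extensional (carrier R)" "\<And>x. x \<in> carrier R \<Longrightarrow> f x = g x"
  shows "f = g"
  using assms by (rule extensionalityI)

lemma bimodule_dual: "bimodule K R (dual_bimodule K R)"
proof -
  let ?D = "dual_bimodule K R"
  have add: "(\<lambda>a\<in>carrier R. f a \<oplus>\<^bsub>K\<^esub> g a) \<in> carrier ?D" if "f \<in> carrier ?D" "g \<in> carrier ?D" for f g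
    by (intro dualI) (auto simp: dualD[OF that(1)] dualD[OF that(2)] K.r_distr K.a_ac)
  have smult: "(\<lambda>a\<in>carrier R. f (a \<otimes>\<^bsub>R\<^esub> r)) \<in> carrier ?D" if "f \<in> carrier ?D" "r \<in> carrier R" for f r
    by (intro dualI) (auto simp: dualD[OF that(1)] that(2) R.l_distr scale_mult_left)
  have rsmult: "(\<lambda>a\<in>carrier R. f (r \<otimes>\<^bsub>R\<^esub> a)) \<in> carrier ?D" if "f \<in> carrier ?D" "r \<in> carrier R" for f r
    by (intro dualI) (auto simp: dualD[OF that(1)] that(2) R.r_distr scale_mult_right)
  have grp: "abelian_group ?D"
  proof (rule abelian_groupI)
    show "\<zero>\<^bsub>?D\<^esub> \<in> carrier ?D" by (auto intro!: dualI)
    fix f assume f: "f \<in> carrier ?D"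
    have "(\<lambda>a\<in>carrier R. \<ominus>\<^bsub>K\<^esub> f a) \<in> carrier ?D"
      by (intro dualI) (auto simp: dualD[OF f] K.minus_add K.r_minus)
    then show "\<exists>g\<in>carrier ?D. g \<oplus>\<^bsub>?D\<^esub> f = \<zero>\<^bsub>?D\<^esub>"
      by (rule bexI[rotated]) (auto intro!: restrict_ext simp: dualD[OF f] K.l_neg)
    show "\<zero>\<^bsub>?D\<^esub> \<oplus>\<^bsub>?D\<^esub> f = f"
      by (rule dual_eqI) (auto simp: dualD[OF f])
  qed (auto simp: add dualD K.a_ac intro!: restrict_ext)
  show ?thesis
  proof (intro bimodule.intro left_module.intro left_module_axioms.intro bimodule_axioms.intro grp R.ring_axioms)
    fix f assume f: "f \<in> carrier ?D"
    show "\<one>\<^bsub>R\<^esub> \<odot>\<^bsub>?D\<^esub> f = f" "f \<triangleleft>\<^bsub>?D\<^esub> \<one>\<^bsub>R\<^esub> = f"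
      by (rule dual_eqI; auto simp: dualD[OF f])+
  qed (auto simp: smult rsmult dualD R.l_distr R.r_distr R.m_assoc scalar_commute intro!: restrict_ext)
qed

text \<open>Precomposition with \<alpha> moves the twist to the other side because f(\<alpha>(a) r)
  = f(\<alpha>(a \<alpha>'(r))) for the left action, while f(\<alpha>(r) \<alpha>(a)) = f(\<alpha>(r
  a)) removes it from the right action.\<close>

lemma dual_twist_iso:
  assumes \<alpha>: "\<alpha> \<in> algebra_auto K R" "\<alpha>' \<in> algebra_auto K R"
    and inv: "\<And>x. x \<in> carrier R \<Longrightarrow> \<alpha>' (\<alpha> x) = x" "\<And>x. x \<in> carrier R \<Longrightarrow> \<alpha> (\<alpha>' x) = x"
  shows "twist_right (dual_bimodule K R) \<alpha> \<simeq>\<^bsub>R\<^esub> twist_left (dual_bimodule K R) \<alpha>'"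
proof -
  let ?D = "dual_bimodule K R"
  define \<theta> where "\<theta> \<gamma> f = (\<lambda>a\<in>carrier R. f (\<gamma> a))" for \<gamma> and f :: "'r \<Rightarrow> 'k"
  have closed: "\<theta> \<gamma> f \<in> carrier ?D" if "\<gamma> \<in> algebra_auto K R" "f \<in> carrier ?D" for \<gamma> f
    by (intro dualI) (auto simp: \<theta>_def algebra_autoD[OF that(1)] dualD[OF that(2)])
  note \<alpha>D = algebra_autoD[OF \<alpha>(1)] and \<alpha>'D = algebra_autoD[OF \<alpha>(2)]
  have "\<theta> \<alpha> \<in> bimodule_iso R (twist_right ?D \<alpha>) (twist_left ?D \<alpha>')"
  proof (rule bimodule_isoI)
    have "\<theta> \<alpha>' (\<theta> \<alpha> f) = f" "\<theta> \<alpha> (\<theta> \<alpha>' f) = f" if "f \<in> carrier ?D" for f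
      by (rule dual_eqI; auto simp: \<theta>_def dualD[OF that] \<alpha>D \<alpha>'D inv)+
    then show "bij_betw (\<theta> \<alpha>) (carrier (twist_right ?D \<alpha>)) (carrier (twist_left ?D \<alpha>'))"
      by (intro bij_betw_byWitness[where f' = "\<theta> \<alpha>'"]) (auto simp: closed \<alpha>)
  qed (auto simp: \<theta>_def \<alpha>D \<alpha>'D inv intro!: restrict_ext)
  then show ?thesis by (auto simp: bimodule_isomorphic_def)
qed

text \<open>Arbitrary representatives \<open>U\<close> and \<open>V\<close> are allowed because the
  product in \<open>Pic\<close> is a union over all representatives of both classes.\<close>

lemma tensor_dual_commute:
  assumes U: "bimodule K R U" "U \<simeq>\<^bsub>R\<^esub> dual_bimodule K R"
    and V: "bimodule K R V" "V \<simeq>\<^bsub>R\<^esub> twisted_bimodule R \<alpha>" and \<alpha>: "\<alpha> \<in> algebra_auto K R"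
  shows "U \<boxtimes>\<^bsub>R\<^esub> V \<simeq>\<^bsub>R\<^esub> V \<boxtimes>\<^bsub>R\<^esub> U"
proof -
  let ?D = "dual_bimodule K R"
  obtain \<alpha>' where \<alpha>': "\<alpha>' \<in> algebra_auto K R"
    and inv: "\<And>x. x \<in> carrier R \<Longrightarrow> \<alpha>' (\<alpha> x) = x" "\<And>x. x \<in> carrier R \<Longrightarrow> \<alpha> (\<alpha>' x) = x"
    by (rule algebra_auto_inv[OF \<alpha>]) blast
  obtain \<phi> where \<phi>: "\<phi> \<in> bimodule_iso R U ?D" using U by (auto simp: bimodule_isomorphic_def)
  obtain \<psi> where \<psi>: "\<psi> \<in> bimodule_iso R V (twisted_bimodule R \<alpha>)" using V by (auto simp: bimodule_isomorphic_def)
  note \<phi>D = bimodule_isoD[OF \<phi>]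
  have "\<phi> \<in> bimodule_iso R (twist_right U \<alpha>) (twist_right ?D \<alpha>)"
    "\<phi> \<in> bimodule_iso R (twist_left U \<alpha>') (twist_left ?D \<alpha>')"
    by (intro bimodule_isoI; use \<phi>D algebra_autoD[OF \<alpha>] algebra_autoD[OF \<alpha>'] in simp)+
  then have right: "twist_right U \<alpha> \<simeq>\<^bsub>R\<^esub> twist_right ?D \<alpha>" and left: "twist_left U \<alpha>' \<simeq>\<^bsub>R\<^esub> twist_left ?D \<alpha>'"
    by (auto simp: bimodule_isomorphic_def)
  have "bimodule K R (V \<boxtimes>\<^bsub>R\<^esub> U)"
    using U(1) V(1) by (intro tensor_product.bimodule_tensor tensor_product.intro K_algebra_axioms)
  then have UV: "twist_left U \<alpha>' \<simeq>\<^bsub>R\<^esub> V \<boxtimes>\<^bsub>R\<^esub> U"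
    using tensor_twisted_left[OF U(1) V(1) \<alpha> \<alpha>' inv \<psi>] by (rule bimodule_isomorphic_sym)
  have "U \<boxtimes>\<^bsub>R\<^esub> V \<simeq>\<^bsub>R\<^esub> twist_right U \<alpha>" by (rule tensor_twisted_right[OF U(1) V(1) \<alpha> \<psi>])
  also note right
  also note dual_twist_iso[OF \<alpha> \<alpha>' inv]
  also have "twist_left ?D \<alpha>' \<simeq>\<^bsub>R\<^esub> twist_left U \<alpha>'"
    using bimodule_twist_left[OF U(1) \<alpha>'] left by (rule bimodule_isomorphic_sym)
  also note UV
  finally show ?thesis .
qed

end

section \<open>Morita pairings\<close>

context tensor_product
begin

text \<open>If \<open>1\<close> is a sum of values \<open>(p', q')\<close> of the pairing, then the corresponding sum \<open>w\<close> of elementary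
  tensors \<open>p' \<otimes> q'\<close> satisfies \<open>p \<otimes> q = (p, q) w\<close>, so \<open>r \<mapsto> r w\<close> inverts the map induced by the pairing.\<close>

lemma tensor_isomorphic_regular:
  fixes pair :: "'p \<Rightarrow> 'q \<Rightarrow> 'r" and pair' :: "'q \<Rightarrow> 'p \<Rightarrow> 'r"
  assumes closed: "\<And>x y. x \<in> carrier P \<Longrightarrow> y \<in> carrier Q \<Longrightarrow> pair x y \<in> carrier R"
    and add_left: "\<And>x x' y. x \<in> carrier P \<Longrightarrow> x' \<in> carrier P \<Longrightarrow> y \<in> carrier Q
      \<Longrightarrow> pair (x \<oplus>\<^bsub>P\<^esub> x') y = pair x y \<oplus>\<^bsub>R\<^esub> pair x' y"
    and add_right: "\<And>x y y'. x \<in> carrier P \<Longrightarrow> y \<in> carrier Q \<Longrightarrow> y' \<in> carrier Q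
      \<Longrightarrow> pair x (y \<oplus>\<^bsub>Q\<^esub> y') = pair x y \<oplus>\<^bsub>R\<^esub> pair x y'"
    and balanced: "\<And>x y r. x \<in> carrier P \<Longrightarrow> y \<in> carrier Q \<Longrightarrow> r \<in> carrier R
      \<Longrightarrow> pair (x \<triangleleft>\<^bsub>P\<^esub> r) y = pair x (r \<odot>\<^bsub>Q\<^esub> y)"
    and smult: "\<And>x y r. x \<in> carrier P \<Longrightarrow> y \<in> carrier Q \<Longrightarrow> r \<in> carrier R
      \<Longrightarrow> pair (r \<odot>\<^bsub>P\<^esub> x) y = r \<otimes>\<^bsub>R\<^esub> pair x y"
    and rsmult: "\<And>x y r. x \<in> carrier P \<Longrightarrow> y \<in> carrier Q \<Longrightarrow> r \<in> carrier R
      \<Longrightarrow> pair x (y \<triangleleft>\<^bsub>Q\<^esub> r) = pair x y \<otimes>\<^bsub>R\<^esub> r"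
    and closed': "\<And>x y. x \<in> carrier P \<Longrightarrow> y \<in> carrier Q \<Longrightarrow> pair' y x \<in> carrier R"
    and assoc: "\<And>x y x'. x \<in> carrier P \<Longrightarrow> y \<in> carrier Q \<Longrightarrow> x' \<in> carrier P
      \<Longrightarrow> x \<triangleleft>\<^bsub>P\<^esub> pair' y x' = pair x y \<odot>\<^bsub>P\<^esub> x'"
    and assoc': "\<And>x y y'. x \<in> carrier P \<Longrightarrow> y \<in> carrier Q \<Longrightarrow> y' \<in> carrier Q
      \<Longrightarrow> y \<triangleleft>\<^bsub>Q\<^esub> pair x y' = pair' y x \<odot>\<^bsub>Q\<^esub> y'"
    and one: "\<one>\<^bsub>R\<^esub> \<in> generate (add_monoid R) {pair x y | x y. x \<in> carrier P \<and> y \<in> carrier Q}"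
  shows "T \<simeq>\<^bsub>R\<^esub> regular_bimodule R"
proof -
  interpret T: bimodule K R T by (rule bimodule_tensor)
  let ?S = "{pair x y | x y. x \<in> carrier P \<and> y \<in> carrier Q}"
  \<comment> \<open>The group \<open>add_monoid (regular_bimodule R)\<close> is the one that
    \<open>tensor_isomorphicI\<close> asks for; it has the operations of \<open>add_monoid R\<close>
    but is formally a different record.\<close>
  let ?G = "generate (add_monoid (regular_bimodule R)) ?S"
  have inv_regular: "inv\<^bsub>add_monoid (regular_bimodule R)\<^esub> x = \<ominus>\<^bsub>R\<^esub> x" for x
    by (simp add: a_inv_def m_inv_def)
  have pure_minus: "pure_tensor x (\<ominus>\<^bsub>Q\<^esub> y) = \<ominus>\<^bsub>T\<^esub> pure_tensor x y" if "x \<in> carrier P" "y \<in> carrier Q" for x y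
    by (rule additive_map_simps(2)[of Q T "pure_tensor x"])
      (use that in \<open>auto simp: pure_tensor_closed pure_tensor_add_right Q.M.abelian_group_axioms abelian_group_tensor\<close>)
  have rsmult_zero: "y \<triangleleft>\<^bsub>Q\<^esub> \<zero>\<^bsub>R\<^esub> = \<zero>\<^bsub>Q\<^esub>" and rsmult_minus: "r \<in> carrier R \<Longrightarrow> y \<triangleleft>\<^bsub>Q\<^esub> (\<ominus>\<^bsub>R\<^esub> r) = \<ominus>\<^bsub>Q\<^esub> (y \<triangleleft>\<^bsub>Q\<^esub> r)"
    if "y \<in> carrier Q" for y r
    by (rule additive_map_simps(1,2)[of R Q "\<lambda>r. y \<triangleleft>\<^bsub>Q\<^esub> r"];
        use that in \<open>auto simp: Q.rsmult_closed Q.rsmult_r_distr Q.M.abelian_group_axioms KR.R.abelian_group_axioms\<close>)+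
  have pure_zero: "pure_tensor x \<zero>\<^bsub>Q\<^esub> = \<zero>\<^bsub>T\<^esub>" if "x \<in> carrier P" for x
    by (rule additive_map_simps(1)[of Q T "pure_tensor x"])
      (use that in \<open>auto simp: pure_tensor_closed pure_tensor_add_right Q.M.abelian_group_axioms abelian_group_tensor\<close>)
  have smult_zero: "r \<odot>\<^bsub>T\<^esub> \<zero>\<^bsub>T\<^esub> = \<zero>\<^bsub>T\<^esub>" and smult_minus: "A \<in> carrier T \<Longrightarrow> r \<odot>\<^bsub>T\<^esub> (\<ominus>\<^bsub>T\<^esub> A) = \<ominus>\<^bsub>T\<^esub> (r \<odot>\<^bsub>T\<^esub> A)"
    if "r \<in> carrier R" for r A
    by (rule additive_map_simps(1,2)[of T T "\<lambda>A. r \<odot>\<^bsub>T\<^esub> A"];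
        use that in \<open>auto simp: smult_tensor_closed smult_tensor_add abelian_group_tensor\<close>)+
  \<comment> \<open>x \<otimes> y (x', y') = x \<otimes> [y, x'] y' = x [y, x'] \<otimes> y' = (x,
    y) x' \<otimes> y'.\<close>
  have pure_pair: "pure_tensor x (y \<triangleleft>\<^bsub>Q\<^esub> pair x' y') = pair x y \<odot>\<^bsub>T\<^esub> pure_tensor x' y'"
    if "x \<in> carrier P" "y \<in> carrier Q" "x' \<in> carrier P" "y' \<in> carrier Q" for x y x' y'
    using that by (simp add: assoc' closed closed' pure_tensor_balanced[symmetric] assoc smult_pure_tensor)
  \<comment> \<open>Both remaining conjuncts are wanted at z = 1: the one on r z says that the
    values of the pairing generate all of R, and the existential one supplies the element
    \<open>w\<close> that defines the inverse.\<close>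
  have "z \<in> carrier R \<and> (\<forall>r\<in>carrier R. r \<otimes>\<^bsub>R\<^esub> z \<in> ?G) \<and>
      (\<exists>w\<in>carrier T. \<forall>x\<in>carrier P. \<forall>y\<in>carrier Q. pure_tensor x (y \<triangleleft>\<^bsub>Q\<^esub> z) = pair x y \<odot>\<^bsub>T\<^esub> w)"
    if "z \<in> generate (add_monoid R) ?S" for z
    using that
  proof (induction rule: generate.induct)
    case one
    have "\<zero>\<^bsub>R\<^esub> \<in> ?G" using generate.one[of "add_monoid (regular_bimodule R)"] by simp
    then show ?case
      by (auto simp: rsmult_zero pure_zero smult_zero closed intro!: bexI[of _ "\<zero>\<^bsub>T\<^esub>"])
  next
    case (incl h)
    then obtain x' y' where h: "x' \<in> carrier P" "y' \<in> carrier Q" "h = pair x' y'" by blast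
    have "r \<otimes>\<^bsub>R\<^esub> h \<in> ?G" if "r \<in> carrier R" for r
      using that h smult[of x' y' r, symmetric] by (auto intro!: generate.incl P.smult_closed)
    then show ?case
      using h by (auto simp: closed pure_pair intro!: bexI[of _ "pure_tensor x' y'"] pure_tensor_closed)
  next
    case (inv h)
    then obtain x' y' where h: "x' \<in> carrier P" "y' \<in> carrier Q" "h = pair x' y'" by blast
    have inv: "inv\<^bsub>add_monoid R\<^esub> h = \<ominus>\<^bsub>R\<^esub> h" by (simp add: a_inv_def)
    have hR: "h \<in> carrier R" using h closed by simp
    have "r \<otimes>\<^bsub>R\<^esub> (\<ominus>\<^bsub>R\<^esub> h) \<in> ?G" if "r \<in> carrier R" for r
    proof -
      have "inv\<^bsub>add_monoid (regular_bimodule R)\<^esub> pair (r \<odot>\<^bsub>P\<^esub> x') y' \<in> ?G"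
        using that h by (intro generate.inv) (auto intro: P.smult_closed)
      then show ?thesis using that h hR by (simp add: inv_regular[simplified] smult KR.R.r_minus)
    qed
    moreover have "pure_tensor x (y \<triangleleft>\<^bsub>Q\<^esub> (\<ominus>\<^bsub>R\<^esub> h)) = pair x y \<odot>\<^bsub>T\<^esub> (\<ominus>\<^bsub>T\<^esub> pure_tensor x' y')"
      if "x \<in> carrier P" "y \<in> carrier Q" for x y
      using that h hR
      by (simp add: rsmult_minus pure_minus smult_minus pure_tensor_closed Q.rsmult_closed closed pure_pair)
    ultimately show ?case using h hR unfolding inv
      by (auto intro!: bexI[of _ "\<ominus>\<^bsub>T\<^esub> pure_tensor x' y'"] T.M.a_inv_closed pure_tensor_closed)
  next
    case (eng a b)
    then obtain v w where v: "v \<in> carrier T" "\<forall>x\<in>carrier P. \<forall>y\<in>carrier Q. pure_tensor x (y \<triangleleft>\<^bsub>Q\<^esub> a) = pair x y \<odot>\<^bsub>T\<^esub> v"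
      and w: "w \<in> carrier T" "\<forall>x\<in>carrier P. \<forall>y\<in>carrier Q. pure_tensor x (y \<triangleleft>\<^bsub>Q\<^esub> b) = pair x y \<odot>\<^bsub>T\<^esub> w"
      by blast
    have ab: "a \<in> carrier R" "b \<in> carrier R" using eng by auto
    have "r \<otimes>\<^bsub>R\<^esub> (a \<oplus>\<^bsub>R\<^esub> b) \<in> ?G" if "r \<in> carrier R" for r
      using generate.eng[of "r \<otimes>\<^bsub>R\<^esub> a" "add_monoid (regular_bimodule R)" ?S "r \<otimes>\<^bsub>R\<^esub> b"] eng that ab
      by (simp add: KR.R.r_distr)
    then show ?case using v w ab
      by (auto intro!: bexI[of _ "v \<oplus>\<^bsub>T\<^esub> w"] T.M.a_closed
        simp: Q.rsmult_r_distr Q.rsmult_closed pure_tensor_add_right closed smult_tensor_add)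
  qed
  from this[OF one] obtain w where w: "w \<in> carrier T"
      "\<And>x y. x \<in> carrier P \<Longrightarrow> y \<in> carrier Q \<Longrightarrow> pair x y \<odot>\<^bsub>T\<^esub> w = pure_tensor x y"
    and G: "\<And>r. r \<in> carrier R \<Longrightarrow> r \<in> ?G"
    by (auto simp: Q.rsmult_one)
  show ?thesis
    by (rule tensor_isomorphicI[where \<beta> = pair and s = "\<lambda>r. r \<odot>\<^bsub>T\<^esub> w"])
      (use w G in \<open>auto simp: closed add_left add_right balanced smult rsmult smult_tensor_closed T.smult_l_distr
        KR.bimodule_regular\<close>)
qed

end

section \<open>Finite-dimensional algebras\<close>

lemma additive_finsum:
  assumes "abelian_group M" "abelian_group N" "g \<in> carrier M \<rightarrow> carrier N"
    and "\<And>x y. x \<in> carrier M \<Longrightarrow> y \<in> carrier M \<Longrightarrow> g (x \<oplus>\<^bsub>M\<^esub> y) = g x \<oplus>\<^bsub>N\<^esub> g y"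
    and "finite A" "f \<in> A \<rightarrow> carrier M"
  shows "g (\<Oplus>\<^bsub>M\<^esub>i\<in>A. f i) = (\<Oplus>\<^bsub>N\<^esub>i\<in>A. g (f i))"
proof -
  interpret M: abelian_group M by fact
  interpret N: abelian_group N by fact
  show ?thesis
    using assms(5,6)
  proof (induction rule: finite_induct)
    case empty
    then show ?case using additive_map_simps(1)[OF assms(1-4)] by simp
  next
    case (insert a A)
    have "g (\<Oplus>\<^bsub>M\<^esub>i\<in>insert a A. f i) = g (f a) \<oplus>\<^bsub>N\<^esub> g (\<Oplus>\<^bsub>M\<^esub>i\<in>A. f i)"
      using insert by (subst M.finsum_insert) (auto simp: assms(4) Pi_iff)
    also have "\<dots> = (\<Oplus>\<^bsub>N\<^esub>i\<in>insert a A. g (f i))"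
      using insert assms(3) by (subst N.finsum_insert) (auto simp: Pi_iff)
    finally show ?case .
  qed
qed

section \<open>Left ideals\<close>

definition left_ideal :: "('r, 'e) ring_scheme \<Rightarrow> 'r set \<Rightarrow> bool"
  where "left_ideal R I \<longleftrightarrow> I \<subseteq> carrier R \<and> \<zero>\<^bsub>R\<^esub> \<in> I \<and> (\<forall>x\<in>I. \<forall>y\<in>I. x \<oplus>\<^bsub>R\<^esub> y \<in> I) \<and>
    (\<forall>r\<in>carrier R. \<forall>x\<in>I. r \<otimes>\<^bsub>R\<^esub> x \<in> I)"

lemma left_idealD:
  assumes "left_ideal R I"
  shows "I \<subseteq> carrier R" "x \<in> I \<Longrightarrow> x \<in> carrier R" "\<zero>\<^bsub>R\<^esub> \<in> I" "x \<in> I \<Longrightarrow> y \<in> I \<Longrightarrow> x \<oplus>\<^bsub>R\<^esub> y \<in> I"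
    and "r \<in> carrier R \<Longrightarrow> x \<in> I \<Longrightarrow> r \<otimes>\<^bsub>R\<^esub> x \<in> I"
  using assms by (auto simp: left_ideal_def)

lemma (in ring) left_ideal_minus:
  assumes "left_ideal R I" "x \<in> I"
  shows "\<ominus> x \<in> I"
  using left_idealD(5)[OF assms(1), of "\<ominus> \<one>" x] left_idealD(2)[OF assms] assms(2) by (simp add: l_minus)

lemma (in ring) ideal_iff_left_ideal:
  "ideal I R \<longleftrightarrow> left_ideal R I \<and> (\<forall>r\<in>carrier R. \<forall>x\<in>I. x \<otimes> r \<in> I)"
proof
  assume "ideal I R"
  then interpret ideal I R .
  show "left_ideal R I \<and> (\<forall>r\<in>carrier R. \<forall>x\<in>I. x \<otimes> r \<in> I)"
    by (auto simp: left_ideal_def I_l_closed I_r_closed a_Hcarr)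
next
  assume I: "left_ideal R I \<and> (\<forall>r\<in>carrier R. \<forall>x\<in>I. x \<otimes> r \<in> I)"
  then have "subgroup I (add_monoid R)"
    using left_idealD[of R I] left_ideal_minus by (intro add.subgroupI) auto
  then show "ideal I R"
    using I left_idealD(5)[of R I] by (intro idealI ring_axioms) auto
qed

context K_algebra
begin

lemma left_ideal_scale:
  assumes "left_ideal R I" "k \<in> carrier K" "x \<in> I"
  shows "k \<odot>\<^bsub>R\<^esub> x \<in> I"
  using left_idealD(5)[OF assms(1), of "k \<odot>\<^bsub>R\<^esub> \<one>\<^bsub>R\<^esub>" x] left_idealD(2)[OF assms(1,3)] assms(2,3)
  by (simp add: scalar_commute)

end

text \<open>Numbering the basis serves two purposes: coordinates become sequences, so that modules
  can be encoded in \<open>nat \<Rightarrow> 'k\<close>, and their order gives a meaning to leading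
  coordinates.\<close>

locale algebra_dual_basis = K_algebra K R
  for K :: "('k, 'd) ring_scheme" (structure) and R :: "('k, 'r, 'e) module_scheme" (structure) +
  fixes m :: nat and b :: "nat \<Rightarrow> 'r" and \<delta> :: "nat \<Rightarrow> 'r \<Rightarrow> 'k"
  assumes b_closed: "i < m \<Longrightarrow> b i \<in> carrier R"
    and \<delta>_dual: "i < m \<Longrightarrow> \<delta> i \<in> carrier (dual_bimodule K R)"
    and expansion: "x \<in> carrier R \<Longrightarrow> x = (\<Oplus>\<^bsub>R\<^esub>i\<in>{..<m}. \<delta> i x \<odot>\<^bsub>R\<^esub> b i)"

text \<open>A spanning set of least cardinality is independent, and independence makes the
  coefficients of a vector unique, hence linear in the vector.\<close>

lemma (in fd_algebra) dual_basis_exists: "\<exists>m b \<delta>. algebra_dual_basis K R m b \<delta>"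
proof -
  define spans where "spans B \<longleftrightarrow> finite B \<and> B \<subseteq> carrier R \<and>
      (\<forall>x\<in>carrier R. \<exists>c\<in>B \<rightarrow> carrier K. x = (\<Oplus>\<^bsub>R\<^esub>b\<in>B. c b \<odot>\<^bsub>R\<^esub> b))" for B
  obtain B\<^sub>0 where "spans B\<^sub>0" using finite_dimensional unfolding spans_def by blast
  then obtain B where B: "spans B" and minimal: "\<And>B'. spans B' \<Longrightarrow> card B \<le> card B'"
    using ex_has_least_nat[of spans B\<^sub>0 card] by blast
  have fin: "finite B" and BR: "\<And>b. b \<in> B \<Longrightarrow> b \<in> carrier R" using B by (auto simp: spans_def)
  let ?comb = "\<lambda>c. \<Oplus>\<^bsub>R\<^esub>b\<in>B. c b \<odot>\<^bsub>R\<^esub> b"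
  have term_closed: "(\<lambda>b. c b \<odot>\<^bsub>R\<^esub> b) \<in> A \<rightarrow> carrier R" if "c \<in> B \<rightarrow> carrier K" "A \<subseteq> B" for c A
    using that BR by (auto simp: Pi_iff subset_iff)
  have indep: "d b0 = \<zero>\<^bsub>K\<^esub>" if d: "d \<in> B \<rightarrow> carrier K" "?comb d = \<zero>\<^bsub>R\<^esub>" and b0: "b0 \<in> B" for d b0
  proof (rule ccontr)
    assume nz: "d b0 \<noteq> \<zero>\<^bsub>K\<^esub>"
    let ?B = "B - {b0}"
    have B_eq: "B = insert b0 ?B" using b0 by auto
    have split: "?comb c = c b0 \<odot>\<^bsub>R\<^esub> b0 \<oplus>\<^bsub>R\<^esub> (\<Oplus>\<^bsub>R\<^esub>b\<in>?B. c b \<odot>\<^bsub>R\<^esub> b)" if "c \<in> B \<rightarrow> carrier K" for c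
    proof -
      have "?comb c = (\<Oplus>\<^bsub>R\<^esub>b\<in>insert b0 ?B. c b \<odot>\<^bsub>R\<^esub> b)" by (rule arg_cong[OF B_eq])
      also have "\<dots> = c b0 \<odot>\<^bsub>R\<^esub> b0 \<oplus>\<^bsub>R\<^esub> (\<Oplus>\<^bsub>R\<^esub>b\<in>?B. c b \<odot>\<^bsub>R\<^esub> b)"
        using that fin BR b0 term_closed[OF that, of ?B] by (intro R.finsum_insert) (auto simp: Pi_iff)
      finally show ?thesis .
    qed
    \<comment> \<open>Scaling the relation so that b0 has coefficient -1 expresses b0 through the
      others; the smaller set still spans, against minimality.\<close>
    define k where "k = \<ominus>\<^bsub>K\<^esub> (inv\<^bsub>K\<^esub> (d b0))"
    have db0: "d b0 \<in> Units K" using nz d b0 K.field_Units by auto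
    have k: "k \<in> carrier K" "k \<otimes>\<^bsub>K\<^esub> d b0 = \<ominus>\<^bsub>K\<^esub> \<one>\<^bsub>K\<^esub>"
      using db0 K.Units_closed[OF db0] by (simp_all add: k_def K.l_minus)
    have "\<zero>\<^bsub>R\<^esub> = k \<odot>\<^bsub>R\<^esub> ?comb d" using k d by simp
    also have "\<dots> = \<ominus>\<^bsub>R\<^esub> b0 \<oplus>\<^bsub>R\<^esub> (\<Oplus>\<^bsub>R\<^esub>b\<in>?B. (k \<otimes>\<^bsub>K\<^esub> d b) \<odot>\<^bsub>R\<^esub> b)"
    proof -
      have "k \<odot>\<^bsub>R\<^esub> (d b0 \<odot>\<^bsub>R\<^esub> b0) = \<ominus>\<^bsub>R\<^esub> b0"
        using k d b0 BR by (simp add: KR.smult_assoc1[symmetric] Pi_iff KR.smult_l_minus)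
      moreover have "k \<odot>\<^bsub>R\<^esub> (\<Oplus>\<^bsub>R\<^esub>b\<in>?B. d b \<odot>\<^bsub>R\<^esub> b) = (\<Oplus>\<^bsub>R\<^esub>b\<in>?B. (k \<otimes>\<^bsub>K\<^esub> d b) \<odot>\<^bsub>R\<^esub> b)"
        using k d BR fin term_closed[OF d(1), of ?B]
        by (subst KR.finsum_smult_ldistr) (auto simp: KR.smult_assoc1 Pi_iff intro!: R.finsum_cong')
      ultimately show ?thesis
        using k d b0 BR R.finsum_closed[OF term_closed[OF d(1), of ?B]]
        unfolding split[OF d(1)] by (subst KR.smult_r_distr) (auto simp: Pi_iff)
    qed
    finally have b0_eq: "b0 = (\<Oplus>\<^bsub>R\<^esub>b\<in>?B. (k \<otimes>\<^bsub>K\<^esub> d b) \<odot>\<^bsub>R\<^esub> b)"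
    proof -
      assume z: "\<zero>\<^bsub>R\<^esub> = \<ominus>\<^bsub>R\<^esub> b0 \<oplus>\<^bsub>R\<^esub> (\<Oplus>\<^bsub>R\<^esub>b\<in>?B. (k \<otimes>\<^bsub>K\<^esub> d b) \<odot>\<^bsub>R\<^esub> b)" (is "_ = _ \<oplus>\<^bsub>R\<^esub> ?S")
      have S: "?S \<in> carrier R" using k d BR by (intro R.finsum_closed) (auto simp: Pi_iff)
      have "b0 \<oplus>\<^bsub>R\<^esub> \<zero>\<^bsub>R\<^esub> = b0 \<oplus>\<^bsub>R\<^esub> (\<ominus>\<^bsub>R\<^esub> b0 \<oplus>\<^bsub>R\<^esub> ?S)" using z by simp
      then show "b0 = ?S" using BR[OF b0] S by (simp add: R.r_neg2)
    qed
    have "spans ?B"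
      unfolding spans_def
    proof (intro conjI ballI)
      fix x assume "x \<in> carrier R"
      then obtain c where c: "c \<in> B \<rightarrow> carrier K" "x = ?comb c" using B by (auto simp: spans_def)
      let ?c = "\<lambda>b. c b0 \<otimes>\<^bsub>K\<^esub> (k \<otimes>\<^bsub>K\<^esub> d b) \<oplus>\<^bsub>K\<^esub> c b"
      have c0: "c b0 \<in> carrier K" using c b0 by auto
      have kd: "(\<lambda>b. k \<otimes>\<^bsub>K\<^esub> d b) \<in> B \<rightarrow> carrier K" using k d by auto
      have "x = c b0 \<odot>\<^bsub>R\<^esub> (\<Oplus>\<^bsub>R\<^esub>b\<in>?B. (k \<otimes>\<^bsub>K\<^esub> d b) \<odot>\<^bsub>R\<^esub> b) \<oplus>\<^bsub>R\<^esub> (\<Oplus>\<^bsub>R\<^esub>b\<in>?B. c b \<odot>\<^bsub>R\<^esub> b)"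
        using c(2) split[OF c(1)] b0_eq by simp
      also have "\<dots> = (\<Oplus>\<^bsub>R\<^esub>b\<in>?B. c b0 \<odot>\<^bsub>R\<^esub> ((k \<otimes>\<^bsub>K\<^esub> d b) \<odot>\<^bsub>R\<^esub> b) \<oplus>\<^bsub>R\<^esub> c b \<odot>\<^bsub>R\<^esub> b)"
        using fin c0 term_closed[OF kd, of ?B] term_closed[OF c(1), of ?B]
        by (subst KR.finsum_smult_ldistr, simp_all, subst R.finsum_addf) (auto simp: Pi_iff)
      also have "\<dots> = (\<Oplus>\<^bsub>R\<^esub>b\<in>?B. ?c b \<odot>\<^bsub>R\<^esub> b)"
        using c c0 k d BR by (intro R.finsum_cong') (auto simp: KR.smult_l_distr KR.smult_assoc1 Pi_iff)
      finally show "\<exists>c\<in>?B \<rightarrow> carrier K. x = (\<Oplus>\<^bsub>R\<^esub>b\<in>?B. c b \<odot>\<^bsub>R\<^esub> b)"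
        using c c0 k d by (intro bexI[of _ ?c]) (auto simp: Pi_iff)
    qed (use fin BR in auto)
    then show False using minimal[of ?B] card_Diff1_less[OF fin b0] by simp
  qed
  have comb_add: "?comb (\<lambda>b. c b \<oplus>\<^bsub>K\<^esub> c' b) = ?comb c \<oplus>\<^bsub>R\<^esub> ?comb c'"
    if "c \<in> B \<rightarrow> carrier K" "c' \<in> B \<rightarrow> carrier K" for c c'
  proof -
    have "?comb (\<lambda>b. c b \<oplus>\<^bsub>K\<^esub> c' b) = (\<Oplus>\<^bsub>R\<^esub>b\<in>B. c b \<odot>\<^bsub>R\<^esub> b \<oplus>\<^bsub>R\<^esub> c' b \<odot>\<^bsub>R\<^esub> b)"
      using that BR by (intro R.finsum_cong') (auto simp: KR.smult_l_distr Pi_iff)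
    also have "\<dots> = ?comb c \<oplus>\<^bsub>R\<^esub> ?comb c'"
      using term_closed[OF that(1)] term_closed[OF that(2)] by (intro R.finsum_addf) auto
    finally show ?thesis .
  qed
  have comb_scale: "?comb (\<lambda>b. k \<otimes>\<^bsub>K\<^esub> c b) = k \<odot>\<^bsub>R\<^esub> ?comb c"
    if "c \<in> B \<rightarrow> carrier K" "k \<in> carrier K" for c k
    using that term_closed[OF that(1)] BR fin
    by (subst KR.finsum_smult_ldistr) (auto simp: KR.smult_assoc1 Pi_iff intro!: R.finsum_cong')
  have unique: "c b = c' b"
    if c: "c \<in> B \<rightarrow> carrier K" and c': "c' \<in> B \<rightarrow> carrier K" and eq: "?comb c = ?comb c'" and b: "b \<in> B" for c c' b
  proof -
    \<comment> \<open>The difference is written with the factor -1 so that \<open>comb_add\<close>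
      and \<open>comb_scale\<close> apply to it.\<close>
    let ?d = "\<lambda>b. c b \<oplus>\<^bsub>K\<^esub> (\<ominus>\<^bsub>K\<^esub> \<one>\<^bsub>K\<^esub>) \<otimes>\<^bsub>K\<^esub> c' b"
    have closed: "?comb c' \<in> carrier R" using term_closed[OF c'] by auto
    have "?comb ?d = ?comb c \<oplus>\<^bsub>R\<^esub> (\<ominus>\<^bsub>K\<^esub> \<one>\<^bsub>K\<^esub>) \<odot>\<^bsub>R\<^esub> ?comb c'"
      using c c' by (subst comb_add) (auto simp: comb_scale Pi_iff)
    also have "\<dots> = \<zero>\<^bsub>R\<^esub>" using closed by (simp add: eq KR.smult_l_minus R.r_neg)
    finally have "?d b = \<zero>\<^bsub>K\<^esub>" using c c' b by (intro indep) auto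
    moreover have "c b \<in> carrier K" "c' b \<in> carrier K" using c c' b by auto
    ultimately show ?thesis by (simp add: K.l_minus K.minus_eq[symmetric])
  qed
  define \<kappa> where "\<kappa> x = (SOME c. c \<in> B \<rightarrow> carrier K \<and> x = ?comb c)" for x
  have \<kappa>: "\<kappa> x \<in> B \<rightarrow> carrier K" "x = ?comb (\<kappa> x)" if "x \<in> carrier R" for x
    using that B someI_ex[of "\<lambda>c. c \<in> B \<rightarrow> carrier K \<and> x = ?comb c"] unfolding \<kappa>_def spans_def by blast+
  obtain e where e: "bij_betw e {0..<card B} B" using ex_bij_betw_nat_finite[OF fin] by blast
  then have e: "bij_betw e {..<card B} B" by (simp add: atLeast0LessThan)
  have eB: "e i \<in> B" if "i < card B" for i using that e by (auto simp: bij_betw_def)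
  have \<kappa>_add: "\<kappa> (x \<oplus>\<^bsub>R\<^esub> y) b = \<kappa> x b \<oplus>\<^bsub>K\<^esub> \<kappa> y b" if "x \<in> carrier R" "y \<in> carrier R" "b \<in> B" for x y b
    using that \<kappa>[of x] \<kappa>[of y] \<kappa>[of "x \<oplus>\<^bsub>R\<^esub> y"]
    by (intro unique[of "\<kappa> (x \<oplus>\<^bsub>R\<^esub> y)" "\<lambda>b. \<kappa> x b \<oplus>\<^bsub>K\<^esub> \<kappa> y b"]) (auto simp: comb_add Pi_iff)
  have \<kappa>_scale: "\<kappa> (k \<odot>\<^bsub>R\<^esub> x) b = k \<otimes>\<^bsub>K\<^esub> \<kappa> x b" if "k \<in> carrier K" "x \<in> carrier R" "b \<in> B" for k x b
    using that \<kappa>[of x] \<kappa>[of "k \<odot>\<^bsub>R\<^esub> x"]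
    by (intro unique[of "\<kappa> (k \<odot>\<^bsub>R\<^esub> x)" "\<lambda>b. k \<otimes>\<^bsub>K\<^esub> \<kappa> x b"]) (auto simp: comb_scale Pi_iff)
  have "algebra_dual_basis K R (card B) e (\<lambda>i. \<lambda>x\<in>carrier R. \<kappa> x (e i))"
  proof
    show "(\<lambda>x\<in>carrier R. \<kappa> x (e i)) \<in> carrier (dual_bimodule K R)" if "i < card B" for i
      using \<kappa> eB[OF that] by (intro dualI) (auto simp: \<kappa>_add \<kappa>_scale Pi_iff)
    show "x = (\<Oplus>\<^bsub>R\<^esub>i\<in>{..<card B}. (\<lambda>x\<in>carrier R. \<kappa> x (e i)) x \<odot>\<^bsub>R\<^esub> e i)" if x: "x \<in> carrier R" for x
    proof -
      have "x = (\<Oplus>\<^bsub>R\<^esub>b\<in>e ` {..<card B}. \<kappa> x b \<odot>\<^bsub>R\<^esub> b)" using \<kappa>(2)[OF x] e by (simp add: bij_betw_def)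
      also have "\<dots> = (\<Oplus>\<^bsub>R\<^esub>i\<in>{..<card B}. \<kappa> x (e i) \<odot>\<^bsub>R\<^esub> e i)"
        using e term_closed[OF \<kappa>(1)[OF x], of B] by (intro R.finsum_reindex) (auto simp: bij_betw_def)
      finally show ?thesis using x by simp
    qed
  qed (use eB BR in auto)
  then show ?thesis by blast
qed

context algebra_dual_basis
begin

lemma \<delta>_closed: "i < m \<Longrightarrow> x \<in> carrier R \<Longrightarrow> \<delta> i x \<in> carrier K"
  using dualD(2)[OF \<delta>_dual] .

lemma eq_if_coordinates_eq:
  assumes "x \<in> carrier R" "y \<in> carrier R" "\<And>i. i < m \<Longrightarrow> \<delta> i x = \<delta> i y"
  shows "x = y"
proof -
  have "x = (\<Oplus>\<^bsub>R\<^esub>i\<in>{..<m}. \<delta> i x \<odot>\<^bsub>R\<^esub> b i)" by (rule expansion[OF assms(1)])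
  also have "\<dots> = (\<Oplus>\<^bsub>R\<^esub>i\<in>{..<m}. \<delta> i y \<odot>\<^bsub>R\<^esub> b i)"
    using assms by (intro R.finsum_cong') (auto simp: \<delta>_closed b_closed)
  also have "\<dots> = y" by (rule expansion[OF assms(2), symmetric])
  finally show ?thesis .
qed

lemma dual_separates:
  assumes "x \<in> carrier R" "y \<in> carrier R" "\<And>f. f \<in> carrier (dual_bimodule K R) \<Longrightarrow> f x = f y"
  shows "x = y"
  using assms \<delta>_dual by (intro eq_if_coordinates_eq) auto

lemma dual_expansion:
  assumes f: "f \<in> carrier (dual_bimodule K R)" and x: "x \<in> carrier R"
  shows "f x = (\<Oplus>\<^bsub>K\<^esub>i\<in>{..<m}. \<delta> i x \<otimes>\<^bsub>K\<^esub> f (b i))"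
proof -
  have "f x = f (\<Oplus>\<^bsub>R\<^esub>i\<in>{..<m}. \<delta> i x \<odot>\<^bsub>R\<^esub> b i)" using expansion[OF x] by simp
  also have "\<dots> = (\<Oplus>\<^bsub>K\<^esub>i\<in>{..<m}. f (\<delta> i x \<odot>\<^bsub>R\<^esub> b i))"
    using x by (intro additive_finsum R.abelian_group_axioms K.abelian_group_axioms)
      (auto simp: dualD[OF f] \<delta>_closed b_closed)
  also have "\<dots> = (\<Oplus>\<^bsub>K\<^esub>i\<in>{..<m}. \<delta> i x \<otimes>\<^bsub>K\<^esub> f (b i))"
    using x by (intro K.finsum_cong') (auto simp: dualD[OF f] \<delta>_closed b_closed)
  finally show ?thesis .
qed

lemma dual_eq_if_eq_on_basis:
  assumes f: "f \<in> carrier (dual_bimodule K R)" and g: "g \<in> carrier (dual_bimodule K R)"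
    and eq: "\<And>i. i < m \<Longrightarrow> f (b i) = g (b i)"
  shows "f = g"
proof (rule dual_eqI)
  show "f x = g x" if x: "x \<in> carrier R" for x
    unfolding dual_expansion[OF f x] dual_expansion[OF g x]
    using x eq by (intro K.finsum_cong') (auto simp: \<delta>_closed b_closed dualD[OF g])
qed (use dualD(1)[OF f] dualD(1)[OF g] in auto)

text \<open>Every f is the sum of the f(b i) \<delta> i, so linearity forces \<Phi> to be evaluation
  at the sum of the \<Phi>(\<delta> i) b i. A scalar k acts on forms through k 1, since the bimodule
  record carries only the actions of R.\<close>

lemma dual_reflexive:
  assumes closed: "\<And>f. f \<in> carrier (dual_bimodule K R) \<Longrightarrow> \<Phi> f \<in> carrier K"
    and add: "\<And>f g. f \<in> carrier (dual_bimodule K R) \<Longrightarrow> g \<in> carrier (dual_bimodule K R)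
      \<Longrightarrow> \<Phi> (f \<oplus>\<^bsub>dual_bimodule K R\<^esub> g) = \<Phi> f \<oplus>\<^bsub>K\<^esub> \<Phi> g"
    and scale: "\<And>k f. k \<in> carrier K \<Longrightarrow> f \<in> carrier (dual_bimodule K R)
      \<Longrightarrow> \<Phi> ((k \<odot>\<^bsub>R\<^esub> \<one>\<^bsub>R\<^esub>) \<odot>\<^bsub>dual_bimodule K R\<^esub> f) = k \<otimes>\<^bsub>K\<^esub> \<Phi> f"
  shows "\<exists>x\<in>carrier R. \<forall>f\<in>carrier (dual_bimodule K R). \<Phi> f = f x"
proof
  let ?D = "dual_bimodule K R"
  interpret D: bimodule K R ?D by (rule bimodule_dual)
  let ?x = "\<Oplus>\<^bsub>R\<^esub>i\<in>{..<m}. \<Phi> (\<delta> i) \<odot>\<^bsub>R\<^esub> b i"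
  show "?x \<in> carrier R" by (intro R.finsum_closed) (auto simp: closed \<delta>_dual b_closed)
  show "\<forall>f\<in>carrier ?D. \<Phi> f = f ?x"
  proof
    fix f assume f: "f \<in> carrier ?D"
    have fb: "f (b i) \<in> carrier K" if "i < m" for i using that by (simp add: dualD[OF f] b_closed)
    define g where "g i = (f (b i) \<odot>\<^bsub>R\<^esub> \<one>\<^bsub>R\<^esub>) \<odot>\<^bsub>?D\<^esub> \<delta> i" for i
    have g: "g i \<in> carrier ?D" if "i < m" for i
      using that unfolding g_def by (intro D.smult_closed) (auto simp: fb \<delta>_dual)
    have g_apply: "g i x = f (b i) \<otimes>\<^bsub>K\<^esub> \<delta> i x" if "i < m" "x \<in> carrier R" for i x
      using that by (simp add: g_def scalar_commute fb dualD[OF \<delta>_dual])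
    have sum: "(\<Oplus>\<^bsub>?D\<^esub>i\<in>{..<m}. g i) \<in> carrier ?D" by (rule D.M.finsum_closed) (simp add: g)
    have f_eq: "f = (\<Oplus>\<^bsub>?D\<^esub>i\<in>{..<m}. g i)"
    proof (rule dual_eqI[OF dualD(1)[OF f] dualD(1)[OF sum]])
      fix x assume x: "x \<in> carrier R"
      have "(\<Oplus>\<^bsub>?D\<^esub>i\<in>{..<m}. g i) x = (\<Oplus>\<^bsub>K\<^esub>i\<in>{..<m}. g i x)"
        using x by (intro additive_finsum[where g = "\<lambda>f. f x"] K.abelian_group_axioms D.M.abelian_group_axioms)
          (auto simp: g dualD)
      also have "\<dots> = (\<Oplus>\<^bsub>K\<^esub>i\<in>{..<m}. \<delta> i x \<otimes>\<^bsub>K\<^esub> f (b i))"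
        using x by (intro K.finsum_cong') (auto simp: g_apply fb \<delta>_closed K.m_comm)
      finally show "f x = (\<Oplus>\<^bsub>?D\<^esub>i\<in>{..<m}. g i) x" using dual_expansion[OF f x] by simp
    qed
    have "\<Phi> f = (\<Oplus>\<^bsub>K\<^esub>i\<in>{..<m}. \<Phi> (g i))"
      by (subst f_eq, rule additive_finsum[where M = ?D and g = \<Phi>])
        (auto simp: g closed add K.abelian_group_axioms D.M.abelian_group_axioms simp del: dual_bimodule_simps)
    also have "\<dots> = (\<Oplus>\<^bsub>K\<^esub>i\<in>{..<m}. f (\<Phi> (\<delta> i) \<odot>\<^bsub>R\<^esub> b i))"
      by (intro K.finsum_cong')
        (auto simp: g_def scale fb \<delta>_dual dualD[OF f] closed b_closed K.m_comm simp del: dual_bimodule_simps)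
    also have "\<dots> = f ?x"
      by (rule additive_finsum[symmetric])
        (auto simp: dualD[OF f] closed \<delta>_dual b_closed K.abelian_group_axioms R.abelian_group_axioms)
    finally show "\<Phi> f = f ?x" .
  qed
qed

text \<open>The positions of the leading coordinates of the elements of \<open>I\<close>; their number plays the role
  of the dimension.\<close>

definition pivots :: "'r set \<Rightarrow> nat set"
  where "pivots I = {i. i < m \<and> (\<exists>v\<in>I. \<delta> i v \<noteq> \<zero>\<^bsub>K\<^esub> \<and> (\<forall>j. i < j \<longrightarrow> j < m \<longrightarrow> \<delta> j v = \<zero>\<^bsub>K\<^esub>))}"

lemma finite_pivots: "finite (pivots I)"
  by (rule finite_subset[of _ "{..<m}"]) (auto simp: pivots_def)

text \<open>Gaussian elimination: an element of \<open>J\<close> has its leading position among the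
  pivots of \<open>I\<close>, so a multiple of an element of \<open>I\<close> cancels its leading
  coordinate, and the remainder is treated in the same way.\<close>

lemma eq_if_pivots_eq:
  assumes I: "left_ideal R I" and J: "left_ideal R J" and sub: "I \<subseteq> J" and eq: "pivots I = pivots J"
  shows "I = J"
proof -
  note ID = left_idealD[OF I] and JD = left_idealD[OF J]
  \<comment> \<open>Only the first \<open>n\<close> coordinates of \<open>w\<close> may be nonzero;
    for n = m this is no restriction, and for n = 0 it forces w = 0.\<close>
  have "w \<in> I" if "w \<in> J" "n \<le> m" "\<And>j. n \<le> j \<Longrightarrow> j < m \<Longrightarrow> \<delta> j w = \<zero>\<^bsub>K\<^esub>" for n w
    using that
  proof (induction n arbitrary: w)
    case 0
    have "\<delta> j \<zero>\<^bsub>R\<^esub> = \<zero>\<^bsub>K\<^esub>" if "j < m" for j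
      by (rule additive_map_simps(1)) (use dualD[OF \<delta>_dual[OF that]] R.abelian_group_axioms K.abelian_group_axioms in auto)
    then have "w = \<zero>\<^bsub>R\<^esub>" using 0 JD by (intro eq_if_coordinates_eq) auto
    then show ?case using ID by simp
  next
    case (Suc n)
    have n: "n < m" using Suc.prems by simp
    note \<delta>n = dualD[OF \<delta>_dual[OF n]]
    have w: "w \<in> carrier R" using Suc.prems JD by auto
    show ?case
    proof (cases "\<delta> n w = \<zero>\<^bsub>K\<^esub>")
      case True
      then have "\<delta> j w = \<zero>\<^bsub>K\<^esub>" if "n \<le> j" "j < m" for j
        using that Suc.prems(3)[of j] by (cases "j = n") auto
      then show ?thesis using Suc.prems n by (intro Suc.IH) auto
    next
      case False
      then have "n \<in> pivots J" unfolding pivots_def using Suc.prems n by (auto simp: Suc_le_eq)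
      then have "n \<in> pivots I" using eq by simp
      then obtain v where v: "v \<in> I" "\<delta> n v \<noteq> \<zero>\<^bsub>K\<^esub>" "\<And>j. n < j \<Longrightarrow> j < m \<Longrightarrow> \<delta> j v = \<zero>\<^bsub>K\<^esub>"
        unfolding pivots_def by blast
      have vR: "v \<in> carrier R" using v ID by auto
      have U: "\<delta> n v \<in> Units K" using v \<delta>n(2)[OF vR] K.field_Units by auto
      \<comment> \<open>Chosen so that the coordinate \<open>n\<close> of w + k v vanishes; the
        higher ones vanish for both summands.\<close>
      define k where "k = \<ominus>\<^bsub>K\<^esub> (\<delta> n w \<otimes>\<^bsub>K\<^esub> inv\<^bsub>K\<^esub> (\<delta> n v))"
      have k: "k \<in> carrier K" using U \<delta>n(2)[OF w] by (simp add: k_def)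
      let ?u = "w \<oplus>\<^bsub>R\<^esub> k \<odot>\<^bsub>R\<^esub> v"
      have u: "\<delta> j ?u = \<delta> j w \<oplus>\<^bsub>K\<^esub> k \<otimes>\<^bsub>K\<^esub> \<delta> j v" if "j < m" for j
        using dualD[OF \<delta>_dual[OF that]] w vR k by simp
      have "\<delta> j ?u = \<zero>\<^bsub>K\<^esub>" if "n \<le> j" "j < m" for j
      proof (cases "j = n")
        case True
        have "k \<otimes>\<^bsub>K\<^esub> \<delta> n v = \<ominus>\<^bsub>K\<^esub> \<delta> n w"
          using U \<delta>n(2)[OF w] \<delta>n(2)[OF vR] by (simp add: k_def K.l_minus K.m_assoc)
        then show ?thesis using u[OF n] True \<delta>n(2)[OF w] by (simp add: K.r_neg)
      next
        case False
        then show ?thesis using that u[of j] v(3)[of j] Suc.prems(3)[of j] k by simp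
      qed
      moreover have kv: "k \<odot>\<^bsub>R\<^esub> v \<in> I" using left_ideal_scale[OF I k v(1)] .
      ultimately have "?u \<in> I"
        using Suc.prems n sub JD(4) by (intro Suc.IH) auto
      moreover have "\<ominus>\<^bsub>R\<^esub> (k \<odot>\<^bsub>R\<^esub> v) \<in> I" using R.left_ideal_minus[OF I kv] .
      ultimately have "?u \<oplus>\<^bsub>R\<^esub> \<ominus>\<^bsub>R\<^esub> (k \<odot>\<^bsub>R\<^esub> v) \<in> I" by (rule ID(4))
      then show ?thesis using w k vR by (simp add: R.a_assoc R.r_neg)
    qed
  qed
  from this[of _ m] sub show ?thesis by auto
qed

text \<open>The descending chain condition in the form used for annihilators: a strict inclusion of
  left ideals lowers a natural number.\<close>

lemma card_pivots_less:
  assumes "left_ideal R I" "left_ideal R J" "I \<subset> J"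
  shows "card (pivots I) < card (pivots J)"
proof (rule psubset_card_mono[OF finite_pivots])
  have "pivots I \<subseteq> pivots J" using assms(3) unfolding pivots_def by blast
  then show "pivots I \<subset> pivots J" using eq_if_pivots_eq[OF assms(1,2)] assms(3) by blast
qed

end

section \<open>Modules in a universe\<close>

definition transfer_module :: "('m \<Rightarrow> 'u) \<Rightarrow> ('r, 'm, 'f) module_scheme \<Rightarrow> ('r, 'u) module"
  where "transfer_module e M = \<lparr>carrier = e ` carrier M, monoid.mult = undefined, monoid.one = undefined,
    ring.zero = e \<zero>\<^bsub>M\<^esub>,
    ring.add = \<lambda>x y. e (inv_into (carrier M) e x \<oplus>\<^bsub>M\<^esub> inv_into (carrier M) e y),
    module.smult = \<lambda>r x. e (r \<odot>\<^bsub>M\<^esub> inv_into (carrier M) e x)\<rparr>"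

definition transfer_bimodule :: "('m \<Rightarrow> 'u) \<Rightarrow> ('r, 'm, 'f) bimodule_scheme \<Rightarrow> ('r, 'u) bimodule"
  where "transfer_bimodule e M = module.extend (transfer_module e M)
    \<lparr>rsmult = \<lambda>x r. e (inv_into (carrier M) e x \<triangleleft>\<^bsub>M\<^esub> r)\<rparr>"

lemma abelian_group_transfer:
  assumes M: "abelian_group M" and bij: "bij_betw e (carrier M) (carrier N)"
    and zero: "e \<zero>\<^bsub>M\<^esub> = \<zero>\<^bsub>N\<^esub>"
    and add: "\<And>x y. x \<in> carrier M \<Longrightarrow> y \<in> carrier M \<Longrightarrow> e (x \<oplus>\<^bsub>M\<^esub> y) = e x \<oplus>\<^bsub>N\<^esub> e y"
  shows "abelian_group N"
proof -
  interpret M: abelian_group M by fact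
  have N: "carrier N = e ` carrier M" using bij by (simp add: bij_betw_def)
  show ?thesis
  proof (rule abelian_groupI)
    fix x assume "x \<in> carrier N"
    then obtain a where a: "a \<in> carrier M" "x = e a" by (auto simp: N)
    then show "\<exists>y\<in>carrier N. y \<oplus>\<^bsub>N\<^esub> x = \<zero>\<^bsub>N\<^esub>"
      by (intro bexI[of _ "e (\<ominus>\<^bsub>M\<^esub> a)"]) (auto simp: N zero[symmetric] add[symmetric] M.l_neg)
  qed (auto simp: N zero[symmetric] add[symmetric] M.a_ac)
qed

lemma transfer_simps:
  assumes "inj_on e (carrier M)"
  shows "carrier (transfer_module e M) = e ` carrier M"
    and "e \<zero>\<^bsub>M\<^esub> = \<zero>\<^bsub>transfer_module e M\<^esub>"
    and "x \<in> carrier M \<Longrightarrow> y \<in> carrier M \<Longrightarrow> e (x \<oplus>\<^bsub>M\<^esub> y) = e x \<oplus>\<^bsub>transfer_module e M\<^esub> e y"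
    and "x \<in> carrier M \<Longrightarrow> e (r \<odot>\<^bsub>M\<^esub> x) = r \<odot>\<^bsub>transfer_module e M\<^esub> e x"
  using assms by (simp_all add: transfer_module_def)

lemma left_module_transfer:
  assumes "left_module R M" "inj_on e (carrier M)"
  shows "left_module R (transfer_module e M)"
proof -
  interpret M: left_module R M by fact
  note t = transfer_simps[OF assms(2)]
  show ?thesis
  proof (intro left_module.intro left_module_axioms.intro M.R.ring_axioms)
    show "abelian_group (transfer_module e M)"
      by (rule abelian_group_transfer[OF M.M.abelian_group_axioms, where e = e])
        (use assms(2) in \<open>auto simp: t bij_betw_def\<close>)
  qed (auto simp: t(1) t(2-4)[symmetric] M.smult_closed M.smult_l_distr M.smult_r_distr M.smult_assoc M.smult_one)
qed

lemma bimodule_transfer: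
  assumes "bimodule K R M" "inj_on e (carrier M)"
  shows "bimodule K R (transfer_bimodule e M)" "e \<in> bimodule_iso R M (transfer_bimodule e M)"
proof -
  interpret M: bimodule K R M by fact
  let ?N = "transfer_bimodule e M"
  have t: "carrier ?N = e ` carrier M" "e \<zero>\<^bsub>M\<^esub> = \<zero>\<^bsub>?N\<^esub>"
    "\<And>x y. x \<in> carrier M \<Longrightarrow> y \<in> carrier M \<Longrightarrow> e (x \<oplus>\<^bsub>M\<^esub> y) = e x \<oplus>\<^bsub>?N\<^esub> e y"
    "\<And>x r. x \<in> carrier M \<Longrightarrow> e (r \<odot>\<^bsub>M\<^esub> x) = r \<odot>\<^bsub>?N\<^esub> e x"
    "\<And>x r. x \<in> carrier M \<Longrightarrow> e (x \<triangleleft>\<^bsub>M\<^esub> r) = e x \<triangleleft>\<^bsub>?N\<^esub> r"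
    using assms(2) by (simp_all add: transfer_bimodule_def transfer_module_def module.defs)
  show "bimodule K R ?N"
  proof (intro bimodule.intro left_module.intro left_module_axioms.intro bimodule_axioms.intro M.R.ring_axioms)
    show "abelian_group ?N"
      by (rule abelian_group_transfer[OF M.M.abelian_group_axioms, where e = e])
        (use assms(2) in \<open>auto simp: t bij_betw_def\<close>)
  qed (auto simp: t(1) t(2-5)[symmetric] M.smult_closed M.smult_l_distr M.smult_r_distr M.smult_assoc M.smult_one
      M.rsmult_closed M.rsmult_l_distr M.rsmult_r_distr M.rsmult_assoc M.rsmult_one M.smult_rsmult M.central)
  show "e \<in> bimodule_iso R M ?N"
    using assms(2) by (intro bimodule_isoI) (auto simp: t bij_betw_def)
qed

text \<open>Injectivity is defined by test modules in \<open>'u\<close>; transport of structure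
  extends it to modules of any type that embed there. An embedding of the larger module suffices, as
  composing it with \<open>i\<close> embeds the smaller one.\<close>

lemma injective_left_module_extend:
  fixes e :: "'n \<Rightarrow> 'u"
  assumes E: "injective_left_module TYPE('u) R E"
    and M: "left_module R M" and N: "left_module R N" and e: "inj_on e (carrier N)"
    and i: "i \<in> left_module_hom R M N" "inj_on i (carrier M)" and g: "g \<in> left_module_hom R M E"
  obtains h where "h \<in> left_module_hom R N E" "\<And>x. x \<in> carrier M \<Longrightarrow> h (i x) = g x"
proof -
  note iD = left_module_homD[OF i(1)] and gD = left_module_homD[OF g]
  interpret M: left_module R M by fact
  have ei: "inj_on (e \<circ> i) (carrier M)"
    using iD by (intro comp_inj_on i(2) inj_on_subset[OF e]) auto
  let ?M = "transfer_module (e \<circ> i) M" and ?N = "transfer_module e N"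
  note tM = transfer_simps[OF ei, simplified] and tN = transfer_simps[OF e, simplified]
  \<comment> \<open>Since \<open>M\<close> is transported along \<open>e \<circ> i\<close> and
    \<open>N\<close> along \<open>e\<close>, the injection \<open>i\<close> becomes an inclusion of
    carriers.\<close>
  let ?i = "\<lambda>x. x" and ?g = "\<lambda>x. g (inv_into (carrier M) (e \<circ> i) x)"
  have inv: "inv_into (carrier M) (e \<circ> i) (e (i x)) = x" if "x \<in> carrier M" for x
    using inv_into_f_f[OF ei that] by simp
  have i_hom: "?i \<in> left_module_hom R ?M ?N"
    unfolding left_module_hom_def
    by (auto simp: tM(1) tN(1) tM(3,4)[symmetric] tN(3,4)[symmetric] iD)
  have g_hom: "?g \<in> left_module_hom R ?M E"
    unfolding left_module_hom_def
    by (auto simp: tM(1) tM(3,4)[symmetric] inv gD M.smult_closed)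
  have MN: "left_module R ?M" "left_module R ?N"
    using left_module_transfer[OF M ei] left_module_transfer[OF N e] .
  have "inj_on ?i (carrier ?M)" by simp
  from E[unfolded injective_left_module_def, THEN conjunct2, rule_format, OF MN i_hom this g_hom]
  obtain h where h: "h \<in> left_module_hom R ?N E" "\<And>x. x \<in> carrier ?M \<Longrightarrow> h x = ?g x"
    by blast
  note hD = left_module_homD[OF h(1)]
  show thesis
  proof
    show "(\<lambda>x. h (e x)) \<in> left_module_hom R N E"
      unfolding left_module_hom_def by (auto simp: hD tN)
    show "h (e (i x)) = g x" if "x \<in> carrier M" for x
      using h(2)[of "e (i x)"] that inv by (simp add: tM(1))
  qed
qed

definition power_module :: "nat \<Rightarrow> ('r, 'm, 'f) module_scheme \<Rightarrow> ('r, nat \<Rightarrow> 'm) module"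
  where "power_module n M = \<lparr>carrier = {..<n} \<rightarrow>\<^sub>E carrier M, monoid.mult = undefined, monoid.one = undefined,
    ring.zero = \<lambda>i\<in>{..<n}. \<zero>\<^bsub>M\<^esub>, ring.add = \<lambda>s t. \<lambda>i\<in>{..<n}. s i \<oplus>\<^bsub>M\<^esub> t i,
    module.smult = \<lambda>r t. \<lambda>i\<in>{..<n}. r \<odot>\<^bsub>M\<^esub> t i\<rparr>"

lemma power_module_simps [simp]:
  "carrier (power_module n M) = {..<n} \<rightarrow>\<^sub>E carrier M"
  "\<zero>\<^bsub>power_module n M\<^esub> = (\<lambda>i\<in>{..<n}. \<zero>\<^bsub>M\<^esub>)"
  "s \<oplus>\<^bsub>power_module n M\<^esub> t = (\<lambda>i\<in>{..<n}. s i \<oplus>\<^bsub>M\<^esub> t i)"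
  "r \<odot>\<^bsub>power_module n M\<^esub> t = (\<lambda>i\<in>{..<n}. r \<odot>\<^bsub>M\<^esub> t i)"
  by (simp_all add: power_module_def)

lemma left_module_power:
  assumes "left_module R M"
  shows "left_module R (power_module n M)"
proof -
  interpret M: left_module R M by fact
  show ?thesis
  proof (intro left_module.intro left_module_axioms.intro abelian_groupI M.R.ring_axioms)
    fix t assume t: "t \<in> carrier (power_module n M)"
    show "\<exists>s\<in>carrier (power_module n M). s \<oplus>\<^bsub>power_module n M\<^esub> t = \<zero>\<^bsub>power_module n M\<^esub>"
      using t by (intro bexI[of _ "\<lambda>i\<in>{..<n}. \<ominus>\<^bsub>M\<^esub> t i"]) (auto simp: PiE_iff M.M.l_neg intro!: restrict_ext)
    show "\<zero>\<^bsub>power_module n M\<^esub> \<oplus>\<^bsub>power_module n M\<^esub> t = t" "\<one>\<^bsub>R\<^esub> \<odot>\<^bsub>power_module n M\<^esub> t = t"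
      by (rule extensionalityI[of _ "{..<n}"]; use t in \<open>auto simp: PiE_iff M.smult_one M.smult_closed\<close>)+
  qed (auto simp: PiE_iff M.smult_closed M.smult_l_distr M.smult_r_distr M.smult_assoc M.M.a_ac intro!: restrict_ext)
qed

section \<open>Annihilators in quasi-Frobenius algebras\<close>

text \<open>Extensionality makes maps that agree on the dual equal, as the group laws on this set
  demand.\<close>

definition (in K_algebra) left_dual :: "(('r \<Rightarrow> 'k) \<Rightarrow> 'r) set"
  where "left_dual = left_module_hom R (dual_bimodule K R) (regular_bimodule R)
    \<inter> extensional (carrier (dual_bimodule K R))"

definition left_ann :: "('r, 'e) ring_scheme \<Rightarrow> 'r set \<Rightarrow> 'r set"
  where "left_ann R I = {x \<in> carrier R. \<forall>y\<in>I. x \<otimes>\<^bsub>R\<^esub> y = \<zero>\<^bsub>R\<^esub>}"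

definition right_ann :: "('r, 'e) ring_scheme \<Rightarrow> 'r set \<Rightarrow> 'r set"
  where "right_ann R I = {x \<in> carrier R. \<forall>y\<in>I. y \<otimes>\<^bsub>R\<^esub> x = \<zero>\<^bsub>R\<^esub>}"

lemma (in ring) left_ideal_left_ann: "I \<subseteq> carrier R \<Longrightarrow> left_ideal R (left_ann R I)"
  by (auto simp: left_ideal_def left_ann_def l_distr m_assoc subset_iff)

lemma (in ring) ideal_left_ann:
  assumes "ideal I R"
  shows "ideal (left_ann R I) R"
  using assms unfolding ideal_iff_left_ideal left_ideal_def left_ann_def
  by (auto simp: l_distr m_assoc subset_iff)

lemma (in ring) ideal_right_ann:
  assumes "ideal I R"
  shows "ideal (right_ann R I) R"
  using assms unfolding ideal_iff_left_ideal left_ideal_def right_ann_def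
  by (auto simp: r_distr m_assoc[symmetric] subset_iff)

locale qf_algebra = algebra_dual_basis K R m b \<delta>
  for K :: "('k, 'd) ring_scheme" (structure) and R :: "('k, 'r, 'e) module_scheme" (structure)
    and m :: nat and b :: "nat \<Rightarrow> 'r" and \<delta> :: "nat \<Rightarrow> 'r \<Rightarrow> 'k" +
  assumes quasi_frobenius: "quasi_frobenius K R"
begin

abbreviation "D \<equiv> dual_bimodule K R"

sublocale D: bimodule K R D by (rule bimodule_dual)

lemma injective: "injective_left_module TYPE(nat \<Rightarrow> 'k) R (regular_bimodule R)"
  using quasi_frobenius by (simp add: quasi_frobenius_def)

lemma left_module_regular: "left_module R (regular_bimodule R)"
  using bimodule_regular by (simp add: bimodule_def)

lemma left_dualD:
  assumes "q \<in> left_dual"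
  shows "f \<in> carrier D \<Longrightarrow> q f \<in> carrier R"
    and "f \<in> carrier D \<Longrightarrow> g \<in> carrier D \<Longrightarrow> q (f \<oplus>\<^bsub>D\<^esub> g) = q f \<oplus>\<^bsub>R\<^esub> q g"
    and "r \<in> carrier R \<Longrightarrow> f \<in> carrier D \<Longrightarrow> q (r \<odot>\<^bsub>D\<^esub> f) = r \<otimes>\<^bsub>R\<^esub> q f"
    and "q \<in> extensional (carrier D)"
  using left_module_homD[of q R D "regular_bimodule R"] assms
  by (auto simp: left_dual_def simp del: dual_bimodule_simps)

lemma left_dualI:
  assumes "\<And>f. f \<in> carrier D \<Longrightarrow> q f \<in> carrier R"
    and "\<And>f g. f \<in> carrier D \<Longrightarrow> g \<in> carrier D \<Longrightarrow> q (f \<oplus>\<^bsub>D\<^esub> g) = q f \<oplus>\<^bsub>R\<^esub> q g"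
    and "\<And>r f. r \<in> carrier R \<Longrightarrow> f \<in> carrier D \<Longrightarrow> q (r \<odot>\<^bsub>D\<^esub> f) = r \<otimes>\<^bsub>R\<^esub> q f"
    and "q \<in> extensional (carrier D)"
  shows "q \<in> left_dual"
  using assms by (auto simp: left_dual_def left_module_hom_def simp del: dual_bimodule_simps)

text \<open>The map \<open>x \<mapsto> (x \<delta>\<^sub>i)\<^sub>i\<close> embeds \<open>R\<close> into a power of \<open>R\<^sup>*\<close>; it splits since \<open>R\<close> is injective.\<close>

lemma dual_is_generator:
  "\<one>\<^bsub>R\<^esub> \<in> generate (add_monoid R) {q f | f q. f \<in> carrier D \<and> q \<in> left_dual}"
proof -
  let ?G = "generate (add_monoid R) {q f | f q. f \<in> carrier D \<and> q \<in> left_dual}"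
  let ?N = "power_module m D"
  \<comment> \<open>A tuple of m linear forms is determined by the m by m matrix of its values on
    the basis; the pairing of naturals lays this matrix out as a sequence, which places the power in
    the universe.\<close>
  define e where "e t n = (case prod_decode n of (i, j) \<Rightarrow> if i < m \<and> j < m then t i (b j) else \<zero>\<^bsub>K\<^esub>)"
    for t :: "nat \<Rightarrow> 'r \<Rightarrow> 'k" and n
  define \<iota> where "\<iota> x = (\<lambda>i\<in>{..<m}. x \<odot>\<^bsub>D\<^esub> \<delta> i)" for x
  have e: "inj_on e (carrier ?N)"
  proof (rule inj_onI)
    fix s t assume s: "s \<in> carrier ?N" and t: "t \<in> carrier ?N" and eq: "e s = e t"
    have "s i (b j) = t i (b j)" if "i < m" "j < m" for i j
      using fun_cong[OF eq, of "prod_encode (i, j)"] that by (simp add: e_def)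
    then show "s = t"
      using s t by (intro PiE_ext[of s "{..<m}" "\<lambda>_. carrier D"] dual_eq_if_eq_on_basis) auto
  qed
  have \<iota>: "\<iota> \<in> left_module_hom R (regular_bimodule R) ?N"
    unfolding left_module_hom_def
    by (auto simp: \<iota>_def D.smult_closed D.smult_l_distr D.smult_assoc \<delta>_dual intro!: restrict_ext
        simp del: dual_bimodule_simps)
  have "inj_on \<iota> (carrier (regular_bimodule R))"
  proof (rule inj_onI, simp)
    fix x y assume xy: "x \<in> carrier R" "y \<in> carrier R" "\<iota> x = \<iota> y"
    have "\<delta> i x = \<delta> i y" if "i < m" for i
      using fun_cong[OF fun_cong[OF xy(3), of i], of "\<one>\<^bsub>R\<^esub>"] that xy by (simp add: \<iota>_def)
    then show "x = y" using xy by (intro eq_if_coordinates_eq) auto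
  qed
  moreover have "(\<lambda>x. x) \<in> left_module_hom R (regular_bimodule R) (regular_bimodule R)"
    by (simp add: left_module_hom_def)
  ultimately obtain h where h: "h \<in> left_module_hom R ?N (regular_bimodule R)"
    and h_\<iota>: "\<And>x. x \<in> carrier (regular_bimodule R) \<Longrightarrow> h (\<iota> x) = x"
    using injective_left_module_extend[OF injective left_module_regular
        left_module_power[OF D.left_module_axioms] e \<iota>] by blast
  note hD = left_module_homD[OF h]
  \<comment> \<open>The inclusion of the factor \<open>k\<close>. Composed with the splitting
    \<open>h\<close> it gives \<open>q k\<close>, so that 1 = h(\<iota> 1) is the sum of the values
    of \<open>q k\<close> at \<delta> k.\<close>
  define single where "single k f = (\<lambda>i\<in>{..<m}. if i = k then f else \<zero>\<^bsub>D\<^esub>)" for k and f :: "'r \<Rightarrow> 'k"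
  have single: "single k f \<in> carrier ?N" if "f \<in> carrier D" for k f
    using that by (auto simp: single_def simp del: dual_bimodule_simps)
  define q where "q k = (\<lambda>f\<in>carrier D. h (single k f))" for k
  have q: "q k \<in> left_dual" for k
  proof (rule left_dualI)
    fix f assume f: "f \<in> carrier D"
    show "q k f \<in> carrier R" using hD(1)[OF single[OF f]] f by (simp add: q_def)
    show "q k (r \<odot>\<^bsub>D\<^esub> f) = r \<otimes>\<^bsub>R\<^esub> q k f" if r: "r \<in> carrier R" for r
    proof -
      have "r \<odot>\<^bsub>D\<^esub> \<zero>\<^bsub>D\<^esub> = \<zero>\<^bsub>D\<^esub>"
        by (rule additive_map_simps(1)[of D D "\<lambda>x. r \<odot>\<^bsub>D\<^esub> x"])
          (use r in \<open>auto simp: D.M.abelian_group_axioms D.smult_closed D.smult_r_distr simp del: dual_bimodule_simps\<close>)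
      then have "single k (r \<odot>\<^bsub>D\<^esub> f) = r \<odot>\<^bsub>?N\<^esub> single k f"
        by (auto simp: single_def intro!: restrict_ext simp del: dual_bimodule_simps)
      then show ?thesis
        using hD(3)[OF r single[OF f]] f r D.smult_closed[OF r f]
        by (simp add: q_def del: dual_bimodule_simps power_module_simps)
    qed
    show "q k (f \<oplus>\<^bsub>D\<^esub> g) = q k f \<oplus>\<^bsub>R\<^esub> q k g" if g: "g \<in> carrier D" for g
    proof -
      have "single k (f \<oplus>\<^bsub>D\<^esub> g) = single k f \<oplus>\<^bsub>?N\<^esub> single k g"
        by (auto simp: single_def intro!: restrict_ext simp del: dual_bimodule_simps)
      then show ?thesis
        using hD(2)[OF single[OF f] single[OF g]] f g D.M.a_closed[OF f g]
        by (simp add: q_def del: dual_bimodule_simps power_module_simps)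
    qed
  qed (simp add: q_def)
  \<comment> \<open>Induction on the number of leading components in which \<open>t\<close> may be
    nonzero; each step splits off the last of them, which contributes a value of
    \<open>q k\<close>.\<close>
  have "h t \<in> ?G" if "t \<in> carrier ?N" "k \<le> m" "\<And>i. k \<le> i \<Longrightarrow> i < m \<Longrightarrow> t i = \<zero>\<^bsub>D\<^esub>" for k t
    using that
  proof (induction k arbitrary: t)
    case 0
    interpret N: left_module R ?N by (rule left_module_power[OF D.left_module_axioms])
    have "t = \<zero>\<^bsub>?N\<^esub>"
      using 0 by (intro PiE_ext[of t "{..<m}" "\<lambda>_. carrier D"]) (auto simp del: dual_bimodule_simps)
    moreover have "h \<zero>\<^bsub>?N\<^esub> = \<zero>\<^bsub>R\<^esub>"
      by (rule additive_map_simps(1)[OF N.M.abelian_group_axioms R.abelian_group_axioms])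
        (use hD in \<open>auto simp del: dual_bimodule_simps power_module_simps\<close>)
    ultimately show ?case
      using generate.one[of "add_monoid R"] by (simp del: dual_bimodule_simps power_module_simps)
  next
    case (Suc k)
    let ?t = "\<lambda>i\<in>{..<m}. if i = k then \<zero>\<^bsub>D\<^esub> else t i"
    have tk: "t k \<in> carrier D" using Suc.prems(1,2) by (simp add: PiE_iff del: dual_bimodule_simps)
    have t': "?t \<in> carrier ?N"
      using Suc.prems(1) by (simp add: PiE_iff del: dual_bimodule_simps)
    have t_eq: "t = ?t \<oplus>\<^bsub>?N\<^esub> single k (t k)"
    proof (rule extensionalityI[of _ "{..<m}"])
      fix i assume i: "i \<in> {..<m}"
      then have "t i \<in> carrier D" using Suc.prems(1) by auto
      then show "t i = (?t \<oplus>\<^bsub>?N\<^esub> single k (t k)) i"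
        using i by (cases "i = k") (simp_all add: single_def del: dual_bimodule_simps)
    qed (use Suc.prems(1) in \<open>simp_all add: PiE_iff\<close>)
    have "h t = h (?t \<oplus>\<^bsub>?N\<^esub> single k (t k))" using t_eq by (rule arg_cong)
    then have "h t = h ?t \<oplus>\<^bsub>R\<^esub> q k (t k)"
      unfolding hD(2)[OF t' single[OF tk]] using tk by (simp add: q_def del: dual_bimodule_simps power_module_simps)
    moreover have "h ?t \<in> ?G"
    proof (rule Suc.IH[OF t'])
      show "?t i = \<zero>\<^bsub>D\<^esub>" if "k \<le> i" "i < m" for i
        using that Suc.prems(3)[of i] by (cases "i = k") (simp_all del: dual_bimodule_simps)
    qed (use Suc.prems(2) in simp)
    moreover have "q k (t k) \<in> ?G" using q tk by (intro generate.incl) blast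
    ultimately show ?case using generate.eng[of "h ?t" "add_monoid R"] by simp
  qed
  from this[of "\<iota> \<one>\<^bsub>R\<^esub>" m] show ?thesis
    using h_\<iota>[of "\<one>\<^bsub>R\<^esub>"] left_module_homD(1)[OF \<iota>, of "\<one>\<^bsub>R\<^esub>"] by simp
qed

text \<open>By injectivity \<open>g\<close> extends to an endomorphism h of the left module R, and
  such a map is right multiplication by h(1).\<close>

lemma left_ideal_hom_extends:
  assumes L: "left_ideal R L" and closed: "\<And>x. x \<in> L \<Longrightarrow> g x \<in> carrier R"
    and add: "\<And>x y. x \<in> L \<Longrightarrow> y \<in> L \<Longrightarrow> g (x \<oplus>\<^bsub>R\<^esub> y) = g x \<oplus>\<^bsub>R\<^esub> g y"
    and mult: "\<And>r x. r \<in> carrier R \<Longrightarrow> x \<in> L \<Longrightarrow> g (r \<otimes>\<^bsub>R\<^esub> x) = r \<otimes>\<^bsub>R\<^esub> g x"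
  obtains c where "c \<in> carrier R" "\<And>x. x \<in> L \<Longrightarrow> g x = x \<otimes>\<^bsub>R\<^esub> c"
proof -
  note LD = left_idealD[OF L]
  let ?E = "regular_bimodule R"
  let ?L = "?E\<lparr>carrier := L\<rparr>"
  have L_simps: "carrier ?L = L" "ring.add ?L = ring.add R" "ring.zero ?L = ring.zero R" "module.smult ?L = monoid.mult R"
    by (simp_all add: regular_bimodule_def)
  have "\<exists>y\<in>L. y \<oplus>\<^bsub>R\<^esub> x = \<zero>\<^bsub>R\<^esub>" if "x \<in> L" for x
    using R.left_ideal_minus[OF L that] LD(2)[OF that] by (intro bexI[of _ "\<ominus>\<^bsub>R\<^esub> x"]) (auto simp: R.l_neg)
  then have left_L: "left_module R ?L"
    by (intro left_module.intro left_module_axioms.intro abelian_groupI R.ring_axioms)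
      (auto simp: L_simps LD R.a_ac R.l_distr R.r_distr R.m_assoc)
  \<comment> \<open>Coordinates embed R in the universe over which injectivity is tested.\<close>
  have e: "inj_on (\<lambda>x n. if n < m then \<delta> n x else \<zero>\<^bsub>K\<^esub>) (carrier ?E)"
  proof (rule inj_onI, rule eq_if_coordinates_eq)
    fix x y i assume "i < m"
      and "(\<lambda>n. if n < m then \<delta> n x else \<zero>\<^bsub>K\<^esub>) = (\<lambda>n. if n < m then \<delta> n y else \<zero>\<^bsub>K\<^esub>)"
    then show "\<delta> i x = \<delta> i y" by (auto dest: fun_cong[of _ _ i])
  qed auto
  have "(\<lambda>x. x) \<in> left_module_hom R ?L ?E" "g \<in> left_module_hom R ?L ?E"
    using LD by (auto simp: left_module_hom_def L_simps closed add mult)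
  then obtain h where h: "h \<in> left_module_hom R ?E ?E" "\<And>x. x \<in> carrier ?L \<Longrightarrow> h x = g x"
    using injective_left_module_extend[OF injective left_L left_module_regular e, of "\<lambda>x. x" g] by auto
  note hD = left_module_homD[OF h(1), simplified]
  show thesis
  proof
    show "h \<one>\<^bsub>R\<^esub> \<in> carrier R" by (simp add: hD)
    show "g x = x \<otimes>\<^bsub>R\<^esub> h \<one>\<^bsub>R\<^esub>" if "x \<in> L" for x
      using h(2)[of x] hD(3)[of x "\<one>\<^bsub>R\<^esub>"] that LD by (simp add: L_simps)
  qed
qed

text \<open>This says that \<open>r(I \<inter> J) = r(I) + r(J)\<close> for the right annihilator \<open>r\<close>.\<close>

lemma right_ann_Int:
  assumes I: "left_ideal R I" and J: "left_ideal R J" and a: "a \<in> right_ann R (I \<inter> J)"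
  obtains c where "c \<in> right_ann R I" "a \<ominus>\<^bsub>R\<^esub> c \<in> right_ann R J"
proof -
  note ID = left_idealD[OF I] and JD = left_idealD[OF J]
  have aR: "a \<in> carrier R" and aIJ: "\<And>x. x \<in> I \<Longrightarrow> x \<in> J \<Longrightarrow> x \<otimes>\<^bsub>R\<^esub> a = \<zero>\<^bsub>R\<^esub>"
    using a by (auto simp: right_ann_def)
  define L where "L = {x \<oplus>\<^bsub>R\<^esub> y | x y. x \<in> I \<and> y \<in> J}"
  \<comment> \<open>The map x + y \<mapsto> y a on I + J, well defined because a is killed by I
    \<inter> J. Its extension is right multiplication by some c with x c = 0 on I and y c = y a on
    J.\<close>
  define g where "g z = (SOME w. \<exists>x\<in>I. \<exists>y\<in>J. z = x \<oplus>\<^bsub>R\<^esub> y \<and> w = y \<otimes>\<^bsub>R\<^esub> a)" for z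
  have well_defined: "y \<otimes>\<^bsub>R\<^esub> a = y' \<otimes>\<^bsub>R\<^esub> a"
    if xy: "x \<in> I" "y \<in> J" "x' \<in> I" "y' \<in> J" "x \<oplus>\<^bsub>R\<^esub> y = x' \<oplus>\<^bsub>R\<^esub> y'" for x y x' y'
  proof -
    have R: "x \<in> carrier R" "y \<in> carrier R" "x' \<in> carrier R" "y' \<in> carrier R" using xy ID JD by auto
    have "y \<oplus>\<^bsub>R\<^esub> \<ominus>\<^bsub>R\<^esub> y' = \<ominus>\<^bsub>R\<^esub> x \<oplus>\<^bsub>R\<^esub> (x \<oplus>\<^bsub>R\<^esub> y) \<oplus>\<^bsub>R\<^esub> \<ominus>\<^bsub>R\<^esub> y'"
      using R by (simp add: R.r_neg1)
    also have "\<dots> = \<ominus>\<^bsub>R\<^esub> x \<oplus>\<^bsub>R\<^esub> x'" using R by (simp add: xy(5) R.a_assoc R.r_neg)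
    finally have eq: "y \<oplus>\<^bsub>R\<^esub> \<ominus>\<^bsub>R\<^esub> y' = \<ominus>\<^bsub>R\<^esub> x \<oplus>\<^bsub>R\<^esub> x'" .
    have "y \<oplus>\<^bsub>R\<^esub> \<ominus>\<^bsub>R\<^esub> y' \<in> J" using xy R.left_ideal_minus[OF J] JD by auto
    moreover have "y \<oplus>\<^bsub>R\<^esub> \<ominus>\<^bsub>R\<^esub> y' \<in> I" unfolding eq using xy R.left_ideal_minus[OF I] ID by auto
    ultimately have "(y \<oplus>\<^bsub>R\<^esub> \<ominus>\<^bsub>R\<^esub> y') \<otimes>\<^bsub>R\<^esub> a = \<zero>\<^bsub>R\<^esub>" using aIJ by blast
    then have "y \<otimes>\<^bsub>R\<^esub> a \<ominus>\<^bsub>R\<^esub> y' \<otimes>\<^bsub>R\<^esub> a = \<zero>\<^bsub>R\<^esub>"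
      using R aR by (simp add: R.l_distr R.l_minus R.minus_eq)
    then show ?thesis using R aR by simp
  qed
  have g: "g (x \<oplus>\<^bsub>R\<^esub> y) = y \<otimes>\<^bsub>R\<^esub> a" if xy: "x \<in> I" "y \<in> J" for x y
    unfolding g_def
  proof (rule some_equality)
    fix w assume "\<exists>x'\<in>I. \<exists>y'\<in>J. x \<oplus>\<^bsub>R\<^esub> y = x' \<oplus>\<^bsub>R\<^esub> y' \<and> w = y' \<otimes>\<^bsub>R\<^esub> a"
    then show "w = y \<otimes>\<^bsub>R\<^esub> a" using well_defined[OF xy] by auto
  qed (use xy in blast)
  have LE: "\<exists>x\<in>I. \<exists>y\<in>J. z = x \<oplus>\<^bsub>R\<^esub> y" if "z \<in> L" for z using that by (auto simp: L_def)
  have sum: "(x \<oplus>\<^bsub>R\<^esub> y) \<oplus>\<^bsub>R\<^esub> (x' \<oplus>\<^bsub>R\<^esub> y') = (x \<oplus>\<^bsub>R\<^esub> x') \<oplus>\<^bsub>R\<^esub> (y \<oplus>\<^bsub>R\<^esub> y')"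
    if "x \<in> I" "y \<in> J" "x' \<in> I" "y' \<in> J" for x y x' y'
    using that by (simp add: ID(2) JD(2) R.a_ac)
  have prod: "r \<otimes>\<^bsub>R\<^esub> (x \<oplus>\<^bsub>R\<^esub> y) = r \<otimes>\<^bsub>R\<^esub> x \<oplus>\<^bsub>R\<^esub> r \<otimes>\<^bsub>R\<^esub> y" if "x \<in> I" "y \<in> J" "r \<in> carrier R" for r x y
    using that by (simp add: ID(2) JD(2) R.r_distr)
  have IL: "x \<in> L" if "x \<in> I" for x
  proof -
    have "x = x \<oplus>\<^bsub>R\<^esub> \<zero>\<^bsub>R\<^esub>" using ID(2)[OF that] by simp
    then show ?thesis unfolding L_def using that JD(3) by blast
  qed
  have JL: "y \<in> L" if "y \<in> J" for y
  proof -
    have "y = \<zero>\<^bsub>R\<^esub> \<oplus>\<^bsub>R\<^esub> y" using JD(2)[OF that] by simp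
    then show ?thesis unfolding L_def using that ID(3) by blast
  qed
  have L: "left_ideal R L"
    unfolding left_ideal_def
  proof (intro conjI ballI subsetI)
    show "\<zero>\<^bsub>R\<^esub> \<in> L" using IL ID(3) by blast
    fix z assume z: "z \<in> L"
    then obtain x y where xy: "x \<in> I" "y \<in> J" "z = x \<oplus>\<^bsub>R\<^esub> y" using LE by blast
    show "z \<in> carrier R" using xy by (simp add: ID(2) JD(2))
    show "r \<otimes>\<^bsub>R\<^esub> z \<in> L" if "r \<in> carrier R" for r
      unfolding L_def xy(3) prod[OF xy(1,2) that] using xy that ID(5) JD(5) by blast
    fix z' assume "z' \<in> L"
    then obtain x' y' where xy': "x' \<in> I" "y' \<in> J" "z' = x' \<oplus>\<^bsub>R\<^esub> y'" using LE by blast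
    show "z \<oplus>\<^bsub>R\<^esub> z' \<in> L"
      unfolding L_def xy(3) xy'(3) sum[OF xy(1,2) xy'(1,2)] using xy xy' ID(4) JD(4) by blast
  qed
  obtain c where c: "c \<in> carrier R" and gc: "\<And>z. z \<in> L \<Longrightarrow> g z = z \<otimes>\<^bsub>R\<^esub> c"
  proof (rule left_ideal_hom_extends[OF L, of g])
    fix z assume "z \<in> L"
    then obtain x y where xy: "x \<in> I" "y \<in> J" "z = x \<oplus>\<^bsub>R\<^esub> y" using LE by blast
    show "g z \<in> carrier R" using xy aR by (simp add: g JD(2))
    show "g (r \<otimes>\<^bsub>R\<^esub> z) = r \<otimes>\<^bsub>R\<^esub> g z" if "r \<in> carrier R" for r
      unfolding xy(3) prod[OF xy(1,2) that] using xy that aR ID(5) JD by (simp add: g R.m_assoc)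
    fix z' assume "z' \<in> L"
    then obtain x' y' where xy': "x' \<in> I" "y' \<in> J" "z' = x' \<oplus>\<^bsub>R\<^esub> y'" using LE by blast
    show "g (z \<oplus>\<^bsub>R\<^esub> z') = g z \<oplus>\<^bsub>R\<^esub> g z'"
      unfolding xy(3) xy'(3) sum[OF xy(1,2) xy'(1,2)] using xy xy' aR ID(4) JD by (simp add: g R.l_distr)
  qed (blast intro: that)
  show thesis
  proof
    have "x \<otimes>\<^bsub>R\<^esub> c = \<zero>\<^bsub>R\<^esub>" if "x \<in> I" for x
      using gc[OF IL[OF that]] g[OF that JD(3)] ID(2)[OF that] aR by simp
    then show "c \<in> right_ann R I" using c by (simp add: right_ann_def)
    have "y \<otimes>\<^bsub>R\<^esub> c = y \<otimes>\<^bsub>R\<^esub> a" if "y \<in> J" for y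
      using gc[OF JL[OF that]] g[OF ID(3) that] JD(2)[OF that] aR by simp
    then have "y \<otimes>\<^bsub>R\<^esub> (a \<ominus>\<^bsub>R\<^esub> c) = \<zero>\<^bsub>R\<^esub>" if "y \<in> J" for y
      using that JD(2)[OF that] aR c by (simp add: R.minus_eq R.r_distr R.r_minus R.r_neg)
    then show "a \<ominus>\<^bsub>R\<^esub> c \<in> right_ann R J" using aR c by (simp add: right_ann_def)
  qed
qed

text \<open>The map x u \<mapsto> x a on the left ideal R u is well defined because x u = 0 implies
  x a = 0. It is therefore right multiplication by some d, and x = 1 gives a = u d.\<close>

lemma right_ann_left_ann_singleton:
  assumes u: "u \<in> carrier R" and a: "a \<in> right_ann R (left_ann R {u})"
  obtains d where "d \<in> carrier R" "a = u \<otimes>\<^bsub>R\<^esub> d"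
proof -
  have aR: "a \<in> carrier R" and ab: "\<And>x. x \<in> carrier R \<Longrightarrow> x \<otimes>\<^bsub>R\<^esub> u = \<zero>\<^bsub>R\<^esub> \<Longrightarrow> x \<otimes>\<^bsub>R\<^esub> a = \<zero>\<^bsub>R\<^esub>"
    using a by (auto simp: right_ann_def left_ann_def)
  define L where "L = {x \<otimes>\<^bsub>R\<^esub> u | x. x \<in> carrier R}"
  define g where "g z = (SOME w. \<exists>x\<in>carrier R. z = x \<otimes>\<^bsub>R\<^esub> u \<and> w = x \<otimes>\<^bsub>R\<^esub> a)" for z
  have well_defined: "x \<otimes>\<^bsub>R\<^esub> a = y \<otimes>\<^bsub>R\<^esub> a" if "x \<in> carrier R" "y \<in> carrier R" "x \<otimes>\<^bsub>R\<^esub> u = y \<otimes>\<^bsub>R\<^esub> u" for x y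
  proof -
    have "(x \<ominus>\<^bsub>R\<^esub> y) \<otimes>\<^bsub>R\<^esub> u = \<zero>\<^bsub>R\<^esub>" using that u by (simp add: R.minus_eq R.l_distr R.l_minus R.r_neg)
    then have "(x \<ominus>\<^bsub>R\<^esub> y) \<otimes>\<^bsub>R\<^esub> a = \<zero>\<^bsub>R\<^esub>" using that by (intro ab) auto
    then have "x \<otimes>\<^bsub>R\<^esub> a \<ominus>\<^bsub>R\<^esub> y \<otimes>\<^bsub>R\<^esub> a = \<zero>\<^bsub>R\<^esub>"
      using that aR by (simp add: R.l_distr R.l_minus R.minus_eq)
    then show ?thesis using that aR by simp
  qed
  have g: "g (x \<otimes>\<^bsub>R\<^esub> u) = x \<otimes>\<^bsub>R\<^esub> a" if x: "x \<in> carrier R" for x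
    unfolding g_def
  proof (rule some_equality)
    fix w assume "\<exists>y\<in>carrier R. x \<otimes>\<^bsub>R\<^esub> u = y \<otimes>\<^bsub>R\<^esub> u \<and> w = y \<otimes>\<^bsub>R\<^esub> a"
    then show "w = x \<otimes>\<^bsub>R\<^esub> a" using well_defined[OF x] by auto
  qed (use x in blast)
  have LE: "\<exists>x\<in>carrier R. z = x \<otimes>\<^bsub>R\<^esub> u" if "z \<in> L" for z using that by (auto simp: L_def)
  have sum: "x \<otimes>\<^bsub>R\<^esub> u \<oplus>\<^bsub>R\<^esub> y \<otimes>\<^bsub>R\<^esub> u = (x \<oplus>\<^bsub>R\<^esub> y) \<otimes>\<^bsub>R\<^esub> u"
    and prod: "x \<otimes>\<^bsub>R\<^esub> (y \<otimes>\<^bsub>R\<^esub> u) = (x \<otimes>\<^bsub>R\<^esub> y) \<otimes>\<^bsub>R\<^esub> u" if "x \<in> carrier R" "y \<in> carrier R" for x y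
    using that u by (simp_all add: R.l_distr R.m_assoc)
  have L: "left_ideal R L"
    unfolding left_ideal_def
  proof (intro conjI ballI subsetI)
    show "\<zero>\<^bsub>R\<^esub> \<in> L" unfolding L_def using u by (auto intro!: exI[of _ "\<zero>\<^bsub>R\<^esub>"])
    fix z assume "z \<in> L"
    then obtain x where x: "x \<in> carrier R" "z = x \<otimes>\<^bsub>R\<^esub> u" using LE by blast
    show "z \<in> carrier R" using x u by simp
    show "r \<otimes>\<^bsub>R\<^esub> z \<in> L" if "r \<in> carrier R" for r
      unfolding L_def x(2) prod[OF that x(1)] using x that by blast
    fix z' assume "z' \<in> L"
    then obtain x' where x': "x' \<in> carrier R" "z' = x' \<otimes>\<^bsub>R\<^esub> u" using LE by blast
    show "z \<oplus>\<^bsub>R\<^esub> z' \<in> L" unfolding L_def x(2) x'(2) sum[OF x(1) x'(1)] using x x' by blast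
  qed
  obtain c where c: "c \<in> carrier R" and gc: "\<And>z. z \<in> L \<Longrightarrow> g z = z \<otimes>\<^bsub>R\<^esub> c"
  proof (rule left_ideal_hom_extends[OF L, of g])
    fix z assume "z \<in> L"
    then obtain x where x: "x \<in> carrier R" "z = x \<otimes>\<^bsub>R\<^esub> u" using LE by blast
    show "g z \<in> carrier R" using x aR by (simp add: g)
    show "g (r \<otimes>\<^bsub>R\<^esub> z) = r \<otimes>\<^bsub>R\<^esub> g z" if "r \<in> carrier R" for r
      unfolding x(2) prod[OF that x(1)] using x that aR by (simp add: g R.m_assoc)
    fix z' assume "z' \<in> L"
    then obtain x' where x': "x' \<in> carrier R" "z' = x' \<otimes>\<^bsub>R\<^esub> u" using LE by blast
    show "g (z \<oplus>\<^bsub>R\<^esub> z') = g z \<oplus>\<^bsub>R\<^esub> g z'"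
      unfolding x(2) x'(2) sum[OF x(1) x'(1)] using x x' aR by (simp add: g R.l_distr)
  qed (blast intro: that)
  have "u \<in> L" unfolding L_def using u by (auto intro!: exI[of _ "\<one>\<^bsub>R\<^esub>"])
  then have "a = u \<otimes>\<^bsub>R\<^esub> c" using gc[of u] g[of "\<one>\<^bsub>R\<^esub>"] u aR by simp
  then show thesis using that c by blast
qed

text \<open>Since l(F \<union> {u}) = l(F) \<inter> l(u), the sum rule writes a as an element of
  r(l(F)) plus one of r(l(u)) = u R; the former is in \<open>I\<close> by induction, the latter
  because \<open>I\<close> is also a right ideal. For empty F the left annihilator is R, so a =
  0.\<close>

lemma mem_if_right_ann_left_ann_finite:
  assumes I: "ideal I R" and F: "finite F" "F \<subseteq> I"
  shows "a \<in> right_ann R (left_ann R F) \<Longrightarrow> a \<in> I"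
  using F
proof (induction F arbitrary: a rule: finite_induct)
  case empty
  then have "\<one>\<^bsub>R\<^esub> \<otimes>\<^bsub>R\<^esub> a = \<zero>\<^bsub>R\<^esub>" "a \<in> carrier R" by (auto simp: right_ann_def left_ann_def)
  then show ?case using additive_subgroup.zero_closed[OF ideal.axioms(1)[OF I]] by simp
next
  case (insert u F)
  interpret I: ideal I R by (rule I)
  have bR: "u \<in> carrier R" and FR: "F \<subseteq> carrier R" using insert.prems I.a_subset by auto
  have "left_ann R (insert u F) = left_ann R F \<inter> left_ann R {u}" by (auto simp: left_ann_def)
  then obtain c where c: "c \<in> right_ann R (left_ann R F)" "a \<ominus>\<^bsub>R\<^esub> c \<in> right_ann R (left_ann R {u})"
    using right_ann_Int[of "left_ann R F" "left_ann R {u}" a] R.left_ideal_left_ann[OF FR]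
      R.left_ideal_left_ann[of "{u}"] bR insert.prems by auto
  have cI: "c \<in> I" using insert.IH c insert.prems by auto
  obtain d where "d \<in> carrier R" "a \<ominus>\<^bsub>R\<^esub> c = u \<otimes>\<^bsub>R\<^esub> d"
    using right_ann_left_ann_singleton[OF bR c(2)] by blast
  then have "a \<ominus>\<^bsub>R\<^esub> c \<in> I" using insert.prems I.I_r_closed by auto
  then have "(a \<ominus>\<^bsub>R\<^esub> c) \<oplus>\<^bsub>R\<^esub> c \<in> I" using cI by auto
  moreover have "a \<in> carrier R" "c \<in> carrier R" using insert.prems c by (auto simp: right_ann_def)
  ultimately show ?case by (simp add: R.minus_eq R.a_assoc R.l_neg)
qed

text \<open>The chain condition reduces to a finite subset: if l(F) is as small as possible among
  finite F inside \<open>I\<close>, adding another element of \<open>I\<close> cannot shrink it, so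
  l(F) is contained in l(I).\<close>

lemma right_ann_left_ann:
  assumes I: "ideal I R"
  shows "right_ann R (left_ann R I) = I"
proof
  interpret I: ideal I R by (rule I)
  let ?d = "\<lambda>F. card (pivots (left_ann R F))"
  obtain F where F: "finite F" "F \<subseteq> I" and min: "\<And>F'. finite F' \<Longrightarrow> F' \<subseteq> I \<Longrightarrow> ?d F \<le> ?d F'"
    using ex_has_least_nat[of "\<lambda>F. finite F \<and> F \<subseteq> I" "{}" ?d] by auto
  have FR: "F \<subseteq> carrier R" using F I.a_subset by auto
  have "left_ann R F \<subseteq> left_ann R {y}" if "y \<in> I" for y
  proof -
    have sub: "left_ann R (insert y F) \<subseteq> left_ann R F" by (auto simp: left_ann_def)
    have "\<not> left_ann R (insert y F) \<subset> left_ann R F"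
      using card_pivots_less[of "left_ann R (insert y F)" "left_ann R F"] min[of "insert y F"] F that FR I.a_subset
      by (auto simp: R.left_ideal_left_ann subset_iff not_less[symmetric])
    with sub have "left_ann R (insert y F) = left_ann R F" by blast
    then show ?thesis by (auto simp: left_ann_def)
  qed
  then have "left_ann R F \<subseteq> left_ann R I" unfolding left_ann_def by blast
  then have "right_ann R (left_ann R I) \<subseteq> right_ann R (left_ann R F)" by (auto simp: right_ann_def)
  then show "right_ann R (left_ann R I) \<subseteq> I" using mem_if_right_ann_left_ann_finite[OF I F] by blast
  show "I \<subseteq> right_ann R (left_ann R I)" using I.a_subset by (auto simp: right_ann_def left_ann_def)
qed

section \<open>Double annihilators\<close>

definition double_left_ann :: "'r set \<Rightarrow> 'r set" where "double_left_ann I = left_ann R (left_ann R I)"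
definition double_right_ann :: "'r set \<Rightarrow> 'r set" where "double_right_ann I = right_ann R (right_ann R I)"

text \<open>The rule r(l(J)) = J is applied to the ideal l(I) first and then to
  \<open>I\<close>.\<close>

lemma double_right_ann_double_left_ann: "ideal I R \<Longrightarrow> double_right_ann (double_left_ann I) = I"
  by (simp add: double_right_ann_def double_left_ann_def right_ann_left_ann R.ideal_left_ann)

lemma ideal_double_left_ann: "ideal I R \<Longrightarrow> ideal (double_left_ann I) R"
  by (simp add: double_left_ann_def R.ideal_left_ann)

lemma ideal_double_right_ann: "ideal I R \<Longrightarrow> ideal (double_right_ann I) R"
  by (simp add: double_right_ann_def R.ideal_right_ann)

lemma double_right_ann_carrier: "double_right_ann (carrier R) = carrier R"
proof -
  have "x = \<zero>\<^bsub>R\<^esub>" if "x \<in> right_ann R (carrier R)" for x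
    using that R.l_one[of x] by (auto simp: right_ann_def simp del: R.l_one)
  then have "right_ann R (carrier R) = {\<zero>\<^bsub>R\<^esub>}" by (auto simp: right_ann_def)
  then show ?thesis by (auto simp: double_right_ann_def right_ann_def)
qed

text \<open>A single r turns the intersection into the sum r(I) + r(J); what annihilates both
  summands annihilates the sum, so the second r returns an intersection.\<close>

lemma double_right_ann_Int:
  assumes "ideal I R" "ideal J R"
  shows "double_right_ann (I \<inter> J) = double_right_ann I \<inter> double_right_ann J"
proof
  show "double_right_ann (I \<inter> J) \<subseteq> double_right_ann I \<inter> double_right_ann J" by (auto simp: double_right_ann_def right_ann_def)
  show "double_right_ann I \<inter> double_right_ann J \<subseteq> double_right_ann (I \<inter> J)"
  proof
    fix x assume x: "x \<in> double_right_ann I \<inter> double_right_ann J"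
    have "z \<otimes>\<^bsub>R\<^esub> x = \<zero>\<^bsub>R\<^esub>" if z: "z \<in> right_ann R (I \<inter> J)" for z
    proof -
      obtain c where c: "c \<in> right_ann R I" "z \<ominus>\<^bsub>R\<^esub> c \<in> right_ann R J"
        using right_ann_Int[OF _ _ z] assms by (auto simp: R.ideal_iff_left_ideal)
      have R: "c \<in> carrier R" "z \<in> carrier R" "x \<in> carrier R" using c z x by (auto simp: right_ann_def double_right_ann_def)
      have "c \<otimes>\<^bsub>R\<^esub> x = \<zero>\<^bsub>R\<^esub>" "(z \<ominus>\<^bsub>R\<^esub> c) \<otimes>\<^bsub>R\<^esub> x = \<zero>\<^bsub>R\<^esub>" using c x by (auto simp: double_right_ann_def right_ann_def)
      then show ?thesis using R by (simp add: R.minus_eq R.l_distr R.l_minus)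
    qed
    then show "x \<in> double_right_ann (I \<inter> J)" using x by (auto simp: double_right_ann_def right_ann_def)
  qed
qed

text \<open>Write \<open>l\<close> and \<open>r\<close> for the annihilators. If \<open>r(I) = 0\<close> but \<open>I \<noteq> R\<close>, then the ideals
  \<open>I \<inter> l\<^sup>2(I) \<inter> \<dots> \<inter> l\<^sup>2\<^sup>n(I)\<close> form an infinite strictly descending chain: \<open>r\<^sup>2\<^sup>n\<close> maps the \<open>n\<close>-th one to \<open>I\<close>
  and all previous ones to \<open>R\<close>.\<close>

lemma ideal_eq_carrier_if_right_ann_zero:
  assumes I: "ideal I R" and ann: "right_ann R I \<subseteq> {\<zero>\<^bsub>R\<^esub>}"
  shows "I = carrier R"
proof (rule ccontr)
  assume neq: "I \<noteq> carrier R"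
  \<comment> \<open>Everything is killed by 0, so r(r(I)) = R, and further applications of r^2 stay
    at R.\<close>
  have r_I: "double_right_ann I = carrier R" using ann by (auto simp: double_right_ann_def right_ann_def)
  have r_R: "(double_right_ann ^^ j) (carrier R) = carrier R" for j by (induction j) (simp_all add: double_right_ann_carrier)
  have r_I': "(double_right_ann ^^ j) I = carrier R" if "0 < j" for j
    using that r_I r_R by (cases j) (simp_all add: funpow_swap1)
  have l_I: "ideal ((double_left_ann ^^ k) I) R" for k by (induction k) (simp_all add: I ideal_double_left_ann)
  have r_l: "(double_right_ann ^^ (j + k)) ((double_left_ann ^^ k) I) = (double_right_ann ^^ j) I" for j k
  proof (induction k)
    case (Suc k)
    have "(double_right_ann ^^ (j + Suc k)) ((double_left_ann ^^ Suc k) I) = (double_right_ann ^^ (j + k)) (double_right_ann (double_left_ann ((double_left_ann ^^ k) I)))"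
      by (simp add: funpow_swap1)
    then show ?case using Suc double_right_ann_double_left_ann[OF l_I] by simp
  qed simp
  have r_Int: "ideal J R \<Longrightarrow> ideal J' R \<Longrightarrow> (double_right_ann ^^ j) (J \<inter> J') = (double_right_ann ^^ j) J \<inter> (double_right_ann ^^ j) J' \<and>
      ideal ((double_right_ann ^^ j) J) R \<and> ideal ((double_right_ann ^^ j) J') R" for j J J'
    by (induction j) (simp_all add: double_right_ann_Int ideal_double_right_ann)
  define A where "A = rec_nat I (\<lambda>n Z. Z \<inter> (double_left_ann ^^ Suc n) I)"
  have A: "A 0 = I" "A (Suc n) = A n \<inter> (double_left_ann ^^ Suc n) I" for n by (simp_all add: A_def)
  have A_ideal: "ideal (A n) R" for n
    by (induction n) (simp_all only: A I R.i_intersect l_I)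
  have IR: "I \<subseteq> carrier R" using additive_subgroup.a_subset[OF ideal.axioms(1)[OF I]] .
  have r_A: "(n < j \<longrightarrow> (double_right_ann ^^ j) (A n) = carrier R) \<and> (double_right_ann ^^ n) (A n) = I" for n j
  proof (induction n arbitrary: j)
    case 0
    then show ?case by (simp add: A r_I')
  next
    case (Suc n)
    \<comment> \<open>Both intersectands are sent to R: \<open>A n\<close> by induction, and the
      iterate of l^2 because n + 1 applications of r^2 bring it back to \<open>I\<close> and at
      least one more follows. With exactly n + 1 applications the second intersectand stops at
      \<open>I\<close>.\<close>
    have "(double_right_ann ^^ j) (A (Suc n)) = carrier R" if "Suc n < j" for j
      unfolding A(2) r_Int[THEN conjunct1, OF A_ideal l_I]
      using Suc[of j] that r_l[of "j - Suc n" "Suc n"] r_I'[of "j - Suc n"] by simp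
    moreover have "(double_right_ann ^^ Suc n) (A (Suc n)) = I"
      unfolding A(2) r_Int[THEN conjunct1, OF A_ideal l_I]
      using Suc[of "Suc n"] r_l[of 0 "Suc n"] IR by auto
    ultimately show ?case by blast
  qed
  \<comment> \<open>Applying r^2 exactly n + 1 times separates the two: \<open>A n\<close> goes to
    R, its successor to \<open>I\<close>.\<close>
  have "A (Suc n) \<subset> A n" for n
    using A(2)[of n] r_A[of n "Suc n"] r_A[of "Suc n" "Suc n"] neq by (metis Int_lower1 lessI psubsetI)
  then have less: "card (pivots (A (Suc n))) < card (pivots (A n))" for n
    using A_ideal by (intro card_pivots_less) (auto simp: R.ideal_iff_left_ideal)
  have "card (pivots (A n)) + n \<le> card (pivots (A 0))" for n
  proof (induction n)
    case (Suc n)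
    then show ?case using less[of n] by simp
  qed simp
  from this[of "Suc (card (pivots (A 0)))"] show False by simp
qed

end

section \<open>Invertibility of the dual\<close>

context qf_algebra
begin

lemma D_simps_apply:
  assumes "x \<in> carrier R"
  shows "(f \<oplus>\<^bsub>D\<^esub> g) x = f x \<oplus>\<^bsub>K\<^esub> g x" "(r \<odot>\<^bsub>D\<^esub> f) x = f (x \<otimes>\<^bsub>R\<^esub> r)" "(f \<triangleleft>\<^bsub>D\<^esub> r) x = f (r \<otimes>\<^bsub>R\<^esub> x)"
  using assms by simp_all

text \<open>The transpose of \<open>q : R\<^sup>* \<rightarrow> R\<close>, as a map \<open>R\<^sup>* \<rightarrow> R\<^sup>*\<^sup>* = R\<close>.\<close>

definition transpose :: "(('r \<Rightarrow> 'k) \<Rightarrow> 'r) \<Rightarrow> ('r \<Rightarrow> 'k) \<Rightarrow> 'r"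
  where "transpose q f = (SOME x. x \<in> carrier R \<and> (\<forall>g\<in>carrier D. f (q g) = g x))"

text \<open>The assignment g \<mapsto> f(q(g)) is a linear form on \<open>D\<close>, as q is
  R-linear and K acts through k 1; reflexivity makes it evaluation at an element of R.\<close>

lemma transpose:
  assumes q: "q \<in> left_dual" and f: "f \<in> carrier D"
  shows "transpose q f \<in> carrier R" and "g \<in> carrier D \<Longrightarrow> g (transpose q f) = f (q g)"
proof -
  note qD = left_dualD[OF q] and fD = dualD[OF f]
  have "\<exists>x\<in>carrier R. \<forall>g\<in>carrier D. f (q g) = g x"
  proof (rule dual_reflexive)
    fix g assume g: "g \<in> carrier D"
    note qg = qD(1)[OF g]
    show "f (q g) \<in> carrier K" using qg by (rule fD(2))
    show "f (q (g \<oplus>\<^bsub>D\<^esub> h)) = f (q g) \<oplus>\<^bsub>K\<^esub> f (q h)" if "h \<in> carrier D" for h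
      unfolding qD(2)[OF g that] using qg qD(1)[OF that] by (rule fD(3))
    show "f (q ((k \<odot>\<^bsub>R\<^esub> \<one>\<^bsub>R\<^esub>) \<odot>\<^bsub>D\<^esub> g)) = k \<otimes>\<^bsub>K\<^esub> f (q g)" if k: "k \<in> carrier K" for k
      unfolding qD(3)[OF KR.smult_closed[OF k R.one_closed] g] scalar_commute(1)[OF k qg]
      using k qg by (rule fD(4))
  qed
  then have "\<exists>x. x \<in> carrier R \<and> (\<forall>g\<in>carrier D. f (q g) = g x)" by blast
  from someI_ex[OF this]
  have "transpose q f \<in> carrier R \<and> (\<forall>g\<in>carrier D. f (q g) = g (transpose q f))"
    unfolding transpose_def .
  then show "transpose q f \<in> carrier R" "g \<in> carrier D \<Longrightarrow> g (transpose q f) = f (q g)" by (blast dest: sym)+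
qed

lemma transpose_eqI:
  assumes "q \<in> left_dual" "f \<in> carrier D" "x \<in> carrier R" "\<And>g. g \<in> carrier D \<Longrightarrow> g x = f (q g)"
  shows "transpose q f = x"
  using assms by (intro dual_separates) (auto simp: transpose)

definition left_dual_bimodule :: "('r, ('r \<Rightarrow> 'k) \<Rightarrow> 'r) bimodule"
  where "left_dual_bimodule =
    \<lparr>carrier = left_dual, monoid.mult = undefined, monoid.one = undefined,
     ring.zero = (\<lambda>f\<in>carrier D. \<zero>\<^bsub>R\<^esub>),
     ring.add = (\<lambda>p q. \<lambda>f\<in>carrier D. p f \<oplus>\<^bsub>R\<^esub> q f),
     module.smult = (\<lambda>r q. \<lambda>f\<in>carrier D. q (f \<triangleleft>\<^bsub>D\<^esub> r)),
     rsmult = (\<lambda>q r. \<lambda>f\<in>carrier D. q f \<otimes>\<^bsub>R\<^esub> r)\<rparr>"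

abbreviation "LD \<equiv> left_dual_bimodule"

lemma left_dual_bimodule_simps [simp]:
  "carrier LD = left_dual" "\<zero>\<^bsub>LD\<^esub> = (\<lambda>f\<in>carrier D. \<zero>\<^bsub>R\<^esub>)"
  "p \<oplus>\<^bsub>LD\<^esub> q = (\<lambda>f\<in>carrier D. p f \<oplus>\<^bsub>R\<^esub> q f)"
  "r \<odot>\<^bsub>LD\<^esub> q = (\<lambda>f\<in>carrier D. q (f \<triangleleft>\<^bsub>D\<^esub> r))"
  "q \<triangleleft>\<^bsub>LD\<^esub> r = (\<lambda>f\<in>carrier D. q f \<otimes>\<^bsub>R\<^esub> r)"
  by (simp_all add: left_dual_bimodule_def)

lemma bimodule_left_dual: "bimodule K R LD"
proof -
  note [simp del] = dual_bimodule_simps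
  note [simp] = D.smult_closed D.rsmult_closed
  have add: "(\<lambda>f\<in>carrier D. p f \<oplus>\<^bsub>R\<^esub> q f) \<in> left_dual" if "p \<in> left_dual" "q \<in> left_dual" for p q
    by (intro left_dualI) (auto simp: left_dualD[OF that(1)] left_dualD[OF that(2)] R.r_distr R.a_ac)
  have smult: "(\<lambda>f\<in>carrier D. q (f \<triangleleft>\<^bsub>D\<^esub> r)) \<in> left_dual" if "q \<in> left_dual" "r \<in> carrier R" for q r
    by (intro left_dualI) (auto simp: left_dualD[OF that(1)] that(2) D.rsmult_l_distr D.smult_rsmult)
  have rsmult: "(\<lambda>f\<in>carrier D. q f \<otimes>\<^bsub>R\<^esub> r) \<in> left_dual" if "q \<in> left_dual" "r \<in> carrier R" for q r
    by (intro left_dualI) (auto simp: left_dualD[OF that(1)] that(2) R.l_distr R.m_assoc)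
  have grp: "abelian_group LD"
  proof (rule abelian_groupI)
    show "\<zero>\<^bsub>LD\<^esub> \<in> carrier LD" by (auto intro!: left_dualI)
    fix q assume "q \<in> carrier LD"
    then have q: "q \<in> left_dual" by simp
    have "(\<lambda>f\<in>carrier D. \<ominus>\<^bsub>R\<^esub> q f) \<in> left_dual"
      by (intro left_dualI) (auto simp: left_dualD[OF q] R.minus_add R.r_minus)
    then show "\<exists>p\<in>carrier LD. p \<oplus>\<^bsub>LD\<^esub> q = \<zero>\<^bsub>LD\<^esub>"
      by (intro bexI[of _ "\<lambda>f\<in>carrier D. \<ominus>\<^bsub>R\<^esub> q f"]) (auto intro!: restrict_ext simp: left_dualD[OF q] R.l_neg)
    show "\<zero>\<^bsub>LD\<^esub> \<oplus>\<^bsub>LD\<^esub> q = q"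
      by (rule extensionalityI[of _ "carrier D"]) (auto simp: left_dualD[OF q])
  qed (auto simp: add left_dualD R.a_ac intro!: restrict_ext)
  show ?thesis
  proof (intro bimodule.intro left_module.intro left_module_axioms.intro bimodule_axioms.intro grp R.ring_axioms)
    fix q assume "q \<in> carrier LD"
    then have q: "q \<in> left_dual" by simp
    show "\<one>\<^bsub>R\<^esub> \<odot>\<^bsub>LD\<^esub> q = q" "q \<triangleleft>\<^bsub>LD\<^esub> \<one>\<^bsub>R\<^esub> = q"
      by (rule extensionalityI[of _ "carrier D"]; auto simp: left_dualD[OF q] D.rsmult_one)+
    show "(k \<odot>\<^bsub>R\<^esub> \<one>\<^bsub>R\<^esub>) \<odot>\<^bsub>LD\<^esub> q = q \<triangleleft>\<^bsub>LD\<^esub> (k \<odot>\<^bsub>R\<^esub> \<one>\<^bsub>R\<^esub>)" if "k \<in> carrier K" for k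
      using that by (auto simp: D.central[symmetric] left_dualD[OF q] scalar_commute intro!: restrict_ext)
  qed (auto simp: smult rsmult left_dualD R.l_distr R.r_distr R.m_assoc D.rsmult_r_distr D.rsmult_assoc
      intro!: restrict_ext)
qed

sublocale LD: bimodule K R LD by (rule bimodule_left_dual)

text \<open>The first associativity law f [q, f'] = (f, q) f' of the Morita context. At a, both
  sides are f'(q(a f)): the left by definition of the transpose, the right because q(a f) = a
  q(f).\<close>

lemma rsmult_transpose:
  assumes q: "q \<in> left_dual" and f: "f \<in> carrier D" and f': "f' \<in> carrier D"
  shows "f \<triangleleft>\<^bsub>D\<^esub> transpose q f' = q f \<odot>\<^bsub>D\<^esub> f'"
proof (rule dual_eqI)
  note t = transpose[OF q f'] and qD = left_dualD[OF q]
  show "f \<triangleleft>\<^bsub>D\<^esub> transpose q f' \<in> extensional (carrier R)" "q f \<odot>\<^bsub>D\<^esub> f' \<in> extensional (carrier R)"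
    by simp_all
  fix a assume a: "a \<in> carrier R"
  have "(f \<triangleleft>\<^bsub>D\<^esub> transpose q f') a = (a \<odot>\<^bsub>D\<^esub> f) (transpose q f')" using a t(1) by simp
  also have "\<dots> = f' (q (a \<odot>\<^bsub>D\<^esub> f))" by (rule t(2)[OF D.smult_closed[OF a f]])
  also have "\<dots> = (q f \<odot>\<^bsub>D\<^esub> f') a" using a by (simp add: qD(3)[OF a f] del: dual_bimodule_simps add: D_simps_apply)
  finally show "(f \<triangleleft>\<^bsub>D\<^esub> transpose q f') a = (q f \<odot>\<^bsub>D\<^esub> f') a" .
qed

text \<open>The second associativity law q (f, q') = [q, f] q' follows from the first by applying
  q': q(g) q'(f) = q'(q(g) f) = q'(g [q, f]).\<close>

lemma rsmult_left_dual:
  assumes q: "q \<in> left_dual" "q' \<in> left_dual" and f: "f \<in> carrier D"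
  shows "q \<triangleleft>\<^bsub>LD\<^esub> q' f = transpose q f \<odot>\<^bsub>LD\<^esub> q'"
  using assms left_dualD[OF q(1)] left_dualD[OF q(2)]
  by (auto simp: rsmult_transpose simp del: dual_bimodule_simps intro!: restrict_ext)

text \<open>The axioms that make [q, f] a balanced bimodule pairing. Each is tested against all
  forms g, which separate the points of R.\<close>

lemma transpose_linear:
  assumes q: "q \<in> left_dual" and f: "f \<in> carrier D"
  shows transpose_add_left: "q' \<in> left_dual \<Longrightarrow> transpose (q \<oplus>\<^bsub>LD\<^esub> q') f = transpose q f \<oplus>\<^bsub>R\<^esub> transpose q' f"
    and transpose_add_right: "f' \<in> carrier D \<Longrightarrow> transpose q (f \<oplus>\<^bsub>D\<^esub> f') = transpose q f \<oplus>\<^bsub>R\<^esub> transpose q f'"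
    and transpose_balanced: "r \<in> carrier R \<Longrightarrow> transpose (q \<triangleleft>\<^bsub>LD\<^esub> r) f = transpose q (r \<odot>\<^bsub>D\<^esub> f)"
    and transpose_smult: "r \<in> carrier R \<Longrightarrow> transpose (r \<odot>\<^bsub>LD\<^esub> q) f = r \<otimes>\<^bsub>R\<^esub> transpose q f"
    and transpose_rsmult: "r \<in> carrier R \<Longrightarrow> transpose q (f \<triangleleft>\<^bsub>D\<^esub> r) = transpose q f \<otimes>\<^bsub>R\<^esub> r"
proof -
  note [simp del] = dual_bimodule_simps left_dual_bimodule_simps
  have LD_apply: "(p \<oplus>\<^bsub>LD\<^esub> p') g = p g \<oplus>\<^bsub>R\<^esub> p' g" "(r \<odot>\<^bsub>LD\<^esub> p) g = p (g \<triangleleft>\<^bsub>D\<^esub> r)" "(p \<triangleleft>\<^bsub>LD\<^esub> r) g = p g \<otimes>\<^bsub>R\<^esub> r"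
    if "g \<in> carrier D" for g p p' r using that by (simp_all add: left_dual_bimodule_simps)
  have closed: "p \<oplus>\<^bsub>LD\<^esub> p' \<in> left_dual" "r \<odot>\<^bsub>LD\<^esub> p \<in> left_dual" "p \<triangleleft>\<^bsub>LD\<^esub> r \<in> left_dual"
    if "p \<in> left_dual" "p' \<in> left_dual" "r \<in> carrier R" for p p' r
    using that LD.M.a_closed[of p p'] LD.smult_closed[of r p] LD.rsmult_closed[of p r]
    by (simp_all add: left_dual_bimodule_simps(1))
  note fD = dualD[OF f] and qD = left_dualD[OF q]
  note simps = transpose[OF q] q f D.smult_closed D.rsmult_closed fD qD D_simps_apply LD_apply
  show "transpose (q \<oplus>\<^bsub>LD\<^esub> q') f = transpose q f \<oplus>\<^bsub>R\<^esub> transpose q' f" if q': "q' \<in> left_dual"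
    by (rule transpose_eqI) (use closed[OF q q' R.zero_closed] in \<open>auto simp: simps dualD transpose[OF q'] left_dualD[OF q']\<close>)
  show "transpose q (f \<oplus>\<^bsub>D\<^esub> f') = transpose q f \<oplus>\<^bsub>R\<^esub> transpose q f'" if f': "f' \<in> carrier D"
    by (rule transpose_eqI) (use f' in \<open>auto simp: simps dualD[where f = f'] dualD(3)\<close>)
  show "transpose (q \<triangleleft>\<^bsub>LD\<^esub> r) f = transpose q (r \<odot>\<^bsub>D\<^esub> f)" if r: "r \<in> carrier R"
    by (rule transpose_eqI) (use closed[OF q q r] r in \<open>auto simp: simps\<close>)
  show "transpose (r \<odot>\<^bsub>LD\<^esub> q) f = r \<otimes>\<^bsub>R\<^esub> transpose q f" if r: "r \<in> carrier R"
  proof (rule transpose_eqI)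
    fix g assume g: "g \<in> carrier D"
    have "g (r \<otimes>\<^bsub>R\<^esub> transpose q f) = (g \<triangleleft>\<^bsub>D\<^esub> r) (transpose q f)" using r f by (simp add: simps)
    also have "\<dots> = f ((r \<odot>\<^bsub>LD\<^esub> q) g)" using g r f by (simp add: simps)
    finally show "g (r \<otimes>\<^bsub>R\<^esub> transpose q f) = f ((r \<odot>\<^bsub>LD\<^esub> q) g)" .
  qed (use closed[OF q q r] r f in \<open>auto simp: simps\<close>)
  show "transpose q (f \<triangleleft>\<^bsub>D\<^esub> r) = transpose q f \<otimes>\<^bsub>R\<^esub> r" if r: "r \<in> carrier R"
  proof (rule transpose_eqI)
    fix g assume g: "g \<in> carrier D"
    have "g (transpose q f \<otimes>\<^bsub>R\<^esub> r) = (r \<odot>\<^bsub>D\<^esub> g) (transpose q f)" using r f by (simp add: simps)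
    also have "\<dots> = (f \<triangleleft>\<^bsub>D\<^esub> r) (q g)" using g r f by (simp add: simps)
    finally show "g (transpose q f \<otimes>\<^bsub>R\<^esub> r) = (f \<triangleleft>\<^bsub>D\<^esub> r) (q g)" .
  qed (use r f in \<open>auto simp: simps\<close>)
qed

text \<open>The right annihilator of the span vanishes by adjunction with the other pairing: f'(x
  q(f)) = f([q, f'] x) = 0 when x is killed by all values [q, f']. The q(f) generate 1, so f'(x) = 0
  for every f', and x = 0.\<close>

lemma dual_is_right_generator:
  "\<one>\<^bsub>R\<^esub> \<in> generate (add_monoid R) {transpose q f | q f. q \<in> left_dual \<and> f \<in> carrier D}"
proof -
  note [simp del] = dual_bimodule_simps left_dual_bimodule_simps
  let ?S = "{transpose q f | q f. q \<in> left_dual \<and> f \<in> carrier D}"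
  let ?T = "generate (add_monoid R) ?S"
  have minus: "inv\<^bsub>add_monoid R\<^esub> x = \<ominus>\<^bsub>R\<^esub> x" for x by (simp add: a_inv_def)
  \<comment> \<open>The generators are stable under multiplication from both sides, r [q, f] =
    [r q, f] and [q, f] r = [q, f r].\<close>
  have mem: "z \<in> carrier R \<and> (\<forall>r\<in>carrier R. r \<otimes>\<^bsub>R\<^esub> z \<in> ?T \<and> z \<otimes>\<^bsub>R\<^esub> r \<in> ?T)" if "z \<in> ?T" for z
    using that
  proof (induction rule: generate.induct)
    case one
    then show ?case using generate.one[of "add_monoid R" ?S] by simp
  next
    case (incl h)
    then obtain q f where h: "q \<in> left_dual" "f \<in> carrier D" "h = transpose q f" by blast
    have "r \<otimes>\<^bsub>R\<^esub> h \<in> ?T \<and> h \<otimes>\<^bsub>R\<^esub> r \<in> ?T" if r: "r \<in> carrier R" for r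
      using h r LD.smult_closed[of r q] D.rsmult_closed[of f r]
      by (auto simp: transpose_smult[symmetric] transpose_rsmult[symmetric] left_dual_bimodule_simps(1)
          intro!: generate.incl)
    then show ?case using h by (simp add: transpose)
  next
    case (inv h)
    then obtain q f where h: "q \<in> left_dual" "f \<in> carrier D" "h = transpose q f" by blast
    have hR: "h \<in> carrier R" using h by (simp add: transpose)
    have "\<ominus>\<^bsub>R\<^esub> (r \<otimes>\<^bsub>R\<^esub> h) \<in> ?T \<and> \<ominus>\<^bsub>R\<^esub> (h \<otimes>\<^bsub>R\<^esub> r) \<in> ?T" if r: "r \<in> carrier R" for r
      unfolding minus[symmetric]
      using h r LD.smult_closed[of r q] D.rsmult_closed[of f r]
      by (auto simp: transpose_smult[symmetric] transpose_rsmult[symmetric] left_dual_bimodule_simps(1)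
          intro!: generate.inv)
    then show ?case unfolding minus using hR by (simp add: R.l_minus R.r_minus)
  next
    case (eng x y)
    then show ?case using generate.eng[of _ "add_monoid R" ?S] by (simp add: R.l_distr R.r_distr)
  qed
  have "left_ideal R ?T"
    using mem generate.one[of "add_monoid R" ?S] generate.eng[of _ "add_monoid R" ?S] by (auto simp: left_ideal_def)
  then have "ideal ?T R" using mem by (simp add: R.ideal_iff_left_ideal)
  moreover have "right_ann R ?T \<subseteq> {\<zero>\<^bsub>R\<^esub>}"
  proof
    fix x assume "x \<in> right_ann R ?T"
    then have x: "x \<in> carrier R" and Tx: "\<And>t. t \<in> ?T \<Longrightarrow> t \<otimes>\<^bsub>R\<^esub> x = \<zero>\<^bsub>R\<^esub>" by (auto simp: right_ann_def)
    have f0: "f \<zero>\<^bsub>R\<^esub> = \<zero>\<^bsub>K\<^esub>" and f_minus: "y \<in> carrier R \<Longrightarrow> f (\<ominus>\<^bsub>R\<^esub> y) = \<ominus>\<^bsub>K\<^esub> f y" if "f \<in> carrier D" for f y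
      by (rule additive_map_simps(1,2)[OF R.abelian_group_axioms K.abelian_group_axioms];
          use dualD[OF that] in auto)+
    have base: "f' (x \<otimes>\<^bsub>R\<^esub> q f) = \<zero>\<^bsub>K\<^esub>" if "f' \<in> carrier D" "f \<in> carrier D" "q \<in> left_dual" for f' f q
    proof -
      have "f' (x \<otimes>\<^bsub>R\<^esub> q f) = (f \<triangleleft>\<^bsub>D\<^esub> transpose q f') x"
        using that x by (simp add: rsmult_transpose D_simps_apply)
      also have "\<dots> = f (transpose q f' \<otimes>\<^bsub>R\<^esub> x)" using x by (simp add: D_simps_apply)
      also have "transpose q f' \<otimes>\<^bsub>R\<^esub> x = \<zero>\<^bsub>R\<^esub>"
        by (rule Tx, rule generate.incl) (use that in blast)
      also have "f \<zero>\<^bsub>R\<^esub> = \<zero>\<^bsub>K\<^esub>" by (rule f0[OF that(2)])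
      finally show ?thesis .
    qed
    \<comment> \<open>The vanishing passes from the values q(f) to the group they generate, in order
      to be applied to z = 1.\<close>
    have "z \<in> carrier R \<and> (\<forall>f'\<in>carrier D. f' (x \<otimes>\<^bsub>R\<^esub> z) = \<zero>\<^bsub>K\<^esub>)"
      if "z \<in> generate (add_monoid R) {q f | f q. f \<in> carrier D \<and> q \<in> left_dual}" for z
      using that
    proof (induction rule: generate.induct)
      case one
      then show ?case using x by (simp add: f0)
    next
      case (incl h)
      then show ?case using base left_dualD(1) by auto
    next
      case (inv h)
      then obtain q f where h: "q \<in> left_dual" "f \<in> carrier D" "h = q f" by blast
      then have hR: "h \<in> carrier R" by (simp add: left_dualD(1))
      moreover have "f' (x \<otimes>\<^bsub>R\<^esub> \<ominus>\<^bsub>R\<^esub> h) = \<zero>\<^bsub>K\<^esub>" if f': "f' \<in> carrier D" for f'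
        using base[OF f' h(2,1)]
        unfolding R.r_minus[OF x hR] f_minus[OF f' R.m_closed[OF x hR]] h(3)[symmetric] by simp
      ultimately show ?case unfolding minus by simp
    next
      case (eng y z)
      then show ?case using x by (simp add: R.r_distr dualD)
    qed
    from this[OF dual_is_generator] have "f' x = f' \<zero>\<^bsub>R\<^esub>" if "f' \<in> carrier D" for f'
      using that x by (simp add: f0)
    then show "x \<in> {\<zero>\<^bsub>R\<^esub>}" using x by (auto intro: dual_separates)
  qed
  ultimately have "?T = carrier R" by (rule ideal_eq_carrier_if_right_ann_zero)
  then show ?thesis by simp
qed

text \<open>Stated for isomorphic copies \<open>P\<close> and \<open>Q\<close> because the bimodules
  that enter \<open>Pic\<close> have carriers in the universe. The pairings are pulled back along
  \<phi> and \<psi>; the two conclusions differ by exchanging their roles.\<close>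

lemma
  assumes P: "bimodule K R P" and Q: "bimodule K R Q"
    and \<phi>: "\<phi> \<in> bimodule_iso R P D" and \<psi>: "\<psi> \<in> bimodule_iso R Q LD"
  shows tensor_dual_left_dual: "P \<boxtimes>\<^bsub>R\<^esub> Q \<simeq>\<^bsub>R\<^esub> regular_bimodule R"
    and tensor_left_dual_dual: "Q \<boxtimes>\<^bsub>R\<^esub> P \<simeq>\<^bsub>R\<^esub> regular_bimodule R"
proof -
  note [simp del] = dual_bimodule_simps left_dual_bimodule_simps
  interpret P: bimodule K R P by fact
  interpret Q: bimodule K R Q by fact
  interpret PQ: tensor_product K R P Q by unfold_locales
  interpret QP: tensor_product K R Q P by unfold_locales
  note \<phi>D = bimodule_isoD[OF \<phi>] and \<psi>D = bimodule_isoD[OF \<psi>, unfolded left_dual_bimodule_simps(1)]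
  let ?pair = "\<lambda>x y. \<psi> y (\<phi> x)" and ?pair' = "\<lambda>y x. transpose (\<psi> y) (\<phi> x)"
  have LD_apply: "(p \<oplus>\<^bsub>LD\<^esub> p') g = p g \<oplus>\<^bsub>R\<^esub> p' g" "(r \<odot>\<^bsub>LD\<^esub> p) g = p (g \<triangleleft>\<^bsub>D\<^esub> r)" "(p \<triangleleft>\<^bsub>LD\<^esub> r) g = p g \<otimes>\<^bsub>R\<^esub> r"
    if "g \<in> carrier D" for g p p' r using that by (simp_all add: left_dual_bimodule_simps)
  have closed: "?pair x y \<in> carrier R" "?pair' y x \<in> carrier R" if "x \<in> carrier P" "y \<in> carrier Q" for x y
    using that by (simp_all add: left_dualD \<phi>D \<psi>D transpose)
  have assoc: "x \<triangleleft>\<^bsub>P\<^esub> ?pair' y x' = ?pair x y \<odot>\<^bsub>P\<^esub> x'"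
    if "x \<in> carrier P" "y \<in> carrier Q" "x' \<in> carrier P" for x y x'
    using that
    by (intro inj_onD[OF bij_betw_imp_inj_on[OF \<phi>D(5)]])
      (auto simp: \<phi>D \<psi>D closed rsmult_transpose P.smult_closed P.rsmult_closed)
  have assoc': "y \<triangleleft>\<^bsub>Q\<^esub> ?pair x y' = ?pair' y x \<odot>\<^bsub>Q\<^esub> y'"
    if "x \<in> carrier P" "y \<in> carrier Q" "y' \<in> carrier Q" for x y y'
    using that
    by (intro inj_onD[OF bij_betw_imp_inj_on[OF \<psi>D(5)]])
      (auto simp: \<phi>D \<psi>D closed rsmult_left_dual Q.smult_closed Q.rsmult_closed)
  have images: "carrier D = \<phi> ` carrier P" "left_dual = \<psi> ` carrier Q"
    using \<phi>D(5) \<psi>D(5) by (auto simp: bij_betw_def)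
  have "{q f | f q. f \<in> carrier D \<and> q \<in> left_dual} = {?pair x y | x y. x \<in> carrier P \<and> y \<in> carrier Q}"
    unfolding images by blast
  then have one: "\<one>\<^bsub>R\<^esub> \<in> generate (add_monoid R) {?pair x y | x y. x \<in> carrier P \<and> y \<in> carrier Q}"
    using dual_is_generator by simp
  have "{transpose q f | q f. q \<in> left_dual \<and> f \<in> carrier D} = {?pair' y x | y x. y \<in> carrier Q \<and> x \<in> carrier P}"
    unfolding images by blast
  then have one': "\<one>\<^bsub>R\<^esub> \<in> generate (add_monoid R) {?pair' y x | y x. y \<in> carrier Q \<and> x \<in> carrier P}"
    using dual_is_right_generator by simp
  show "P \<boxtimes>\<^bsub>R\<^esub> Q \<simeq>\<^bsub>R\<^esub> regular_bimodule R"
    by (rule PQ.tensor_isomorphic_regular[of ?pair ?pair'])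
      (use one in \<open>simp_all add: closed assoc assoc' \<phi>D \<psi>D LD_apply left_dualD\<close>)
  show "Q \<boxtimes>\<^bsub>R\<^esub> P \<simeq>\<^bsub>R\<^esub> regular_bimodule R"
    by (rule QP.tensor_isomorphic_regular[of ?pair' ?pair])
      (use one' in \<open>simp_all add: closed assoc assoc' \<phi>D \<psi>D transpose_linear\<close>)
qed

section \<open>Copies in the universe of carriers\<close>

lemma dual_coordinates_inj: "inj_on (\<lambda>f n. if n < m then f (b n) else \<zero>\<^bsub>K\<^esub>) (carrier D)"
proof (rule inj_onI, rule dual_eq_if_eq_on_basis)
  fix f g i assume "(\<lambda>n. if n < m then f (b n) else \<zero>\<^bsub>K\<^esub>) = (\<lambda>n. if n < m then g (b n) else \<zero>\<^bsub>K\<^esub>)" "i < m"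
  then show "f (b i) = g (b i)" by (auto dest: fun_cong[of _ _ i])
qed auto

text \<open>The entry \<delta> i (q (\<delta> j)) is also the coordinate j of the transpose of q at
  \<delta> i. So the matrix determines these transposes, and evaluating any form f on them recovers
  the coordinates of q(f).\<close>

lemma left_dual_coordinates_inj:
  "inj_on (\<lambda>q n. case prod_decode n of (i, j) \<Rightarrow> if i < m \<and> j < m then \<delta> i (q (\<delta> j)) else \<zero>\<^bsub>K\<^esub>) (carrier LD)"
    (is "inj_on ?e _")
proof (rule inj_onI)
  fix p q assume "p \<in> carrier LD" "q \<in> carrier LD" and eq: "?e p = ?e q"
  then have p: "p \<in> left_dual" and q: "q \<in> left_dual" by auto
  have "\<delta> i (p (\<delta> j)) = \<delta> i (q (\<delta> j))" if "i < m" "j < m" for i j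
    using fun_cong[OF eq, of "prod_encode (i, j)"] that by simp
  then have "transpose p (\<delta> i) = transpose q (\<delta> i)" if "i < m" for i
    using that by (intro eq_if_coordinates_eq) (auto simp: transpose[OF p] transpose[OF q] \<delta>_dual)
  then have "p f = q f" if "f \<in> carrier D" for f
    using that transpose(2)[OF p \<delta>_dual that] transpose(2)[OF q \<delta>_dual that]
    by (intro eq_if_coordinates_eq) (auto simp: left_dualD(1)[OF p] left_dualD(1)[OF q])
  then show "p = q"
    using left_dualD(4)[OF p] left_dualD(4)[OF q] by (rule extensionalityI[rotated 2])
qed

text \<open>The carrier of \<open>D\<close> consists of functions on R, whereas \<open>Pic\<close>
  is built from bimodules in the universe; the class of \<open>D\<close> belongs to it through the
  copy \<open>P\<close>.\<close>

lemma invertible_dual: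
  obtains P :: "('r, nat \<Rightarrow> 'k) bimodule" where "invertible_bimodule K R P" "D \<simeq>\<^bsub>R\<^esub> P"
proof -
  note P = bimodule_transfer[OF D.bimodule_axioms dual_coordinates_inj]
  note Q = bimodule_transfer[OF LD.bimodule_axioms left_dual_coordinates_inj]
  note \<phi> = bimodule_iso_inv[OF D.bimodule_axioms P(2)] and \<psi> = bimodule_iso_inv[OF LD.bimodule_axioms Q(2)]
  show thesis
    using that[unfolded invertible_bimodule_def bimodule_isomorphic_def]
      P Q(1) tensor_dual_left_dual[OF P(1) Q(1) \<phi> \<psi>] tensor_left_dual_dual[OF P(1) Q(1) \<phi> \<psi>]
    unfolding bimodule_isomorphic_def by blast
qed

end

section \<open>The Picard group\<close>

lemma bimodule_class_cong:
  assumes "bimodule K R P" "P \<simeq>\<^bsub>R\<^esub> Q"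
  shows "bimodule_class K R P = bimodule_class K R Q"
  using assms bimodule_isomorphic_trans[of R _ P Q] bimodule_isomorphic_trans[of R _ Q P] bimodule_isomorphic_sym[of K R P Q]
  by (auto simp: bimodule_class_def)

context K_algebra
begin

text \<open>Right multiplication by u is the isomorphism, because x \<alpha>(r) u = (x u)
  (\<open>inv u\<close> \<alpha>(r) u).\<close>

lemma twisted_inner_iso:
  assumes u: "u \<in> Units R" and \<alpha>: "\<alpha> \<in> algebra_auto K R"
    and \<beta>: "\<And>x. x \<in> carrier R \<Longrightarrow> \<beta> x = inv\<^bsub>R\<^esub> u \<otimes>\<^bsub>R\<^esub> \<alpha> x \<otimes>\<^bsub>R\<^esub> u"
  shows "twisted_bimodule R \<alpha> \<simeq>\<^bsub>R\<^esub> twisted_bimodule R \<beta>"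
proof -
  note uR = R.Units_closed[OF u] R.Units_inv_closed[OF u]
  have "(\<lambda>x. x \<otimes>\<^bsub>R\<^esub> u) \<in> bimodule_iso R (twisted_bimodule R \<alpha>) (twisted_bimodule R \<beta>)"
    unfolding twisted_bimodule_eq
  proof (rule bimodule_isoI)
    show "bij_betw (\<lambda>x. x \<otimes>\<^bsub>R\<^esub> u) (carrier (twist_right (regular_bimodule R) \<alpha>)) (carrier (twist_right (regular_bimodule R) \<beta>))"
      by (rule bij_betw_byWitness[where f' = "\<lambda>x. x \<otimes>\<^bsub>R\<^esub> inv\<^bsub>R\<^esub> u"]) (auto simp: uR R.m_assoc u)
    fix r x assume "r \<in> carrier R" "x \<in> carrier (twist_right (regular_bimodule R) \<alpha>)"
    then have rx: "r \<in> carrier R" "x \<in> carrier R" by simp_all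
    have "x \<otimes>\<^bsub>R\<^esub> u \<otimes>\<^bsub>R\<^esub> (inv\<^bsub>R\<^esub> u \<otimes>\<^bsub>R\<^esub> \<alpha> r \<otimes>\<^bsub>R\<^esub> u) = x \<otimes>\<^bsub>R\<^esub> (u \<otimes>\<^bsub>R\<^esub> inv\<^bsub>R\<^esub> u) \<otimes>\<^bsub>R\<^esub> \<alpha> r \<otimes>\<^bsub>R\<^esub> u"
      using rx uR by (simp add: R.m_assoc algebra_autoD[OF \<alpha>] del: R.Units_r_inv)
    then show "x \<triangleleft>\<^bsub>twist_right (regular_bimodule R) \<alpha>\<^esub> r \<otimes>\<^bsub>R\<^esub> u = x \<otimes>\<^bsub>R\<^esub> u \<triangleleft>\<^bsub>twist_right (regular_bimodule R) \<beta>\<^esub> r"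
      using rx u uR by (simp add: \<beta> algebra_autoD[OF \<alpha>])
  qed (auto simp: uR R.l_distr R.m_assoc)
  then show ?thesis by (auto simp: bimodule_isomorphic_def)
qed

text \<open>Products in \<open>BijGroup\<close> are compositions only for elements of
  \<open>Bij\<close>, so this is what allows a coset of \<open>Inn R\<close> to be computed.\<close>

lemma Inn_Bij:
  assumes u: "u \<in> Units R"
  shows "(\<lambda>r\<in>carrier R. inv\<^bsub>R\<^esub> u \<otimes>\<^bsub>R\<^esub> r \<otimes>\<^bsub>R\<^esub> u) \<in> Bij (carrier R)"
proof -
  note uR = R.Units_closed[OF u] R.Units_inv_closed[OF u]
  have "inv\<^bsub>R\<^esub> u \<otimes>\<^bsub>R\<^esub> (u \<otimes>\<^bsub>R\<^esub> x) = x" "u \<otimes>\<^bsub>R\<^esub> (inv\<^bsub>R\<^esub> u \<otimes>\<^bsub>R\<^esub> x) = x" if "x \<in> carrier R" for x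
    using that uR u by (simp_all add: R.m_assoc[symmetric])
  then have "bij_betw (\<lambda>r. inv\<^bsub>R\<^esub> u \<otimes>\<^bsub>R\<^esub> r \<otimes>\<^bsub>R\<^esub> u) (carrier R) (carrier R)"
    by (intro bij_betw_byWitness[where f' = "\<lambda>r. u \<otimes>\<^bsub>R\<^esub> r \<otimes>\<^bsub>R\<^esub> inv\<^bsub>R\<^esub> u"]) (auto simp: uR R.m_assoc u)
  then show ?thesis by (simp add: Bij_def)
qed

text \<open>Members of a coset differ by an inner automorphism, which does not change the class of
  the twisted bimodule, so \<open>the_elem\<close> returns the class of any one of them.\<close>

lemma Out_to_Pic_eq:
  assumes C: "C \<in> carrier (Out K R)"
  obtains \<alpha> where "\<alpha> \<in> algebra_auto K R" "Out_to_Pic K R C = bimodule_class K R (twisted_bimodule R \<alpha>)"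
proof -
  obtain \<alpha> where \<alpha>: "\<alpha> \<in> algebra_auto K R" and C_eq: "C = Inn R #>\<^bsub>Aut K R\<^esub> \<alpha>"
    using C by (auto simp: Out_def Aut_def carrier_FactGroup)
  have \<alpha>B: "\<alpha> \<in> Bij (carrier R)" using \<alpha> by (simp add: algebra_auto_def)
  have mult: "h \<otimes>\<^bsub>Aut K R\<^esub> \<alpha> = compose (carrier R) h \<alpha>" if "h \<in> Inn R" for h
    using that \<alpha>B Inn_Bij by (auto simp: Aut_def BijGroup_def Inn_def)
  have class_eq: "bimodule_class K R (twisted_bimodule R \<beta>) = bimodule_class K R (twisted_bimodule R \<alpha>)" if "\<beta> \<in> C" for \<beta>
  proof -
    from that obtain h where h: "h \<in> Inn R" "\<beta> = compose (carrier R) h \<alpha>"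
      unfolding C_eq r_coset_def using mult by auto
    then obtain u where u: "u \<in> Units R" "h = (\<lambda>r\<in>carrier R. inv\<^bsub>R\<^esub> u \<otimes>\<^bsub>R\<^esub> r \<otimes>\<^bsub>R\<^esub> u)" by (auto simp: Inn_def)
    have "twisted_bimodule R \<alpha> \<simeq>\<^bsub>R\<^esub> twisted_bimodule R \<beta>"
      by (rule twisted_inner_iso[OF u(1) \<alpha>]) (simp add: h u compose_def algebra_autoD[OF \<alpha>])
    then show ?thesis by (rule bimodule_class_cong[OF bimodule_twisted[OF \<alpha>], symmetric])
  qed
  \<comment> \<open>Conjugation by 1 shows that the coset is nonempty, without which the image would
    not be a singleton.\<close>
  have "(\<lambda>r\<in>carrier R. inv\<^bsub>R\<^esub> \<one>\<^bsub>R\<^esub> \<otimes>\<^bsub>R\<^esub> r \<otimes>\<^bsub>R\<^esub> \<one>\<^bsub>R\<^esub>) \<in> Inn R" unfolding Inn_def by blast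
  then have "C \<noteq> {}" unfolding C_eq r_coset_def by blast
  then have "Out_to_Pic K R C = bimodule_class K R (twisted_bimodule R \<alpha>)"
    unfolding Out_to_Pic_def using class_eq by (intro the_elem_image_unique)
  then show thesis using that \<alpha> by blast
qed

text \<open>Both products are unions over the same pairs (U, V), and the two sets contributed by a
  pair coincide.\<close>

lemma Pic_mult_dual_commute:
  assumes \<alpha>: "\<alpha> \<in> algebra_auto K R"
  defines "A \<equiv> bimodule_class K R (dual_bimodule K R)" and "B \<equiv> bimodule_class K R (twisted_bimodule R \<alpha>)"
  shows "A \<otimes>\<^bsub>Pic K R\<^esub> B = B \<otimes>\<^bsub>Pic K R\<^esub> A"
proof -
  have "bimodule_class K R (U \<boxtimes>\<^bsub>R\<^esub> V) = bimodule_class K R (V \<boxtimes>\<^bsub>R\<^esub> U)" if "U \<in> A" "V \<in> B" for U V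
  proof (rule bimodule_class_cong)
    have U: "bimodule K R U" "U \<simeq>\<^bsub>R\<^esub> dual_bimodule K R" and V: "bimodule K R V" "V \<simeq>\<^bsub>R\<^esub> twisted_bimodule R \<alpha>"
      using that by (auto simp: A_def B_def bimodule_class_def)
    show "bimodule K R (U \<boxtimes>\<^bsub>R\<^esub> V)"
      using U V by (intro tensor_product.bimodule_tensor tensor_product.intro K_algebra_axioms)
    show "U \<boxtimes>\<^bsub>R\<^esub> V \<simeq>\<^bsub>R\<^esub> V \<boxtimes>\<^bsub>R\<^esub> U" by (rule tensor_dual_commute[OF U V \<alpha>])
  qed
  then show ?thesis by (fastforce simp: Pic_def)
qed

end

lemma bimodule_isomorphic_refl: "P \<simeq>\<^bsub>R\<^esub> P"
  unfolding bimodule_isomorphic_def by (auto intro!: exI[of _ "\<lambda>x. x"] bimodule_isoI simp: ex_in_conv[symmetric] bij_betw_def)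

theorem proposition2p5:
  fixes K :: "('k, 'd) ring_scheme" and R :: "('k, 'r, 'e) module_scheme"
  assumes "fd_algebra K R" and "quasi_frobenius K R"
  shows "(\<forall>\<alpha>\<in>carrier (Aut K R).
           dual_bimodule K R \<boxtimes>\<^bsub>R\<^esub> twisted_bimodule R \<alpha> \<simeq>\<^bsub>R\<^esub> twisted_bimodule R \<alpha> \<boxtimes>\<^bsub>R\<^esub> dual_bimodule K R) \<and>
         bimodule_class K R (dual_bimodule K R)
           \<in> centralizer (Pic K R) (Out_to_Pic K R ` carrier (Out K R))"
proof -
  interpret fd_algebra K R by fact
  obtain m b \<delta> where "algebra_dual_basis K R m b \<delta>" using dual_basis_exists by blast
  then interpret qf_algebra K R m b \<delta> using assms(2) by (simp add: qf_algebra_def qf_algebra_axioms_def)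
  obtain P :: "('r, nat \<Rightarrow> 'k) bimodule" where P: "invertible_bimodule K R P" "D \<simeq>\<^bsub>R\<^esub> P"
    by (rule invertible_dual)
  \<comment> \<open>The centralizer includes membership in \<open>Pic\<close>; here the
    invertibility of the dual enters.\<close>
  then have "bimodule_class K R D \<in> carrier (Pic K R)"
    using bimodule_class_cong[OF bimodule_dual P(2)] by (auto simp: Pic_def)
  then have "bimodule_class K R D \<in> centralizer (Pic K R) (Out_to_Pic K R ` carrier (Out K R))"
    using Pic_mult_dual_commute by (auto simp: centralizer_def elim!: Out_to_Pic_eq)
  moreover have "D \<boxtimes>\<^bsub>R\<^esub> twisted_bimodule R \<alpha> \<simeq>\<^bsub>R\<^esub> twisted_bimodule R \<alpha> \<boxtimes>\<^bsub>R\<^esub> D" if "\<alpha> \<in> carrier (Aut K R)" for \<alpha>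
  proof -
    have \<alpha>: "\<alpha> \<in> algebra_auto K R" using that by (simp add: Aut_def)
    show ?thesis
      by (rule tensor_dual_commute[OF bimodule_dual bimodule_isomorphic_refl bimodule_twisted[OF \<alpha>]
            bimodule_isomorphic_refl \<alpha>])
  qed
  ultimately show ?thesis by blast
qed

end
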